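(* Consider the singular delayed system and its Weierstrass canonical form described in the context. Assume that $u\in C^{(\ell-1)}(\mathbf{R}_0^+\cup[-h,0),\mathbf{R})$, that the external disturbance, of the form $v_0(t)=Q^{-1}(\eta_1^T(t),\eta_2^T(t))^T$, satisfies $\eta_2\in C^{(\ell-1)}(\mathbf{R}_0^+\cup[-h,0),\mathbf{R}^{n_2})$, with $u(t)=\Psi(t)$ and $\eta_2(t)=\Psi_{v02}(t)$ for all $t\in[-h,0)$ for some given $\Psi\in C^{(\ell-1)}([-h,0],\mathbf{R})$ and $\Psi_{v02}\in C^{(\ell-1)}([-h,0],\mathbf{R}^{n_2})$, and that the pair $(E,A)$ is solvable. Define the sets of admissible initial states $S(\Psi)\subset\mathbf{R}^n$ and admissible initial data $A(\Psi)\subset\mathbf{R}^n\times C^{(\ell-1)}([-h,0],\mathbf{R})\times C^{(\ell-1)}([-h,0],\mathbf{R}^{n_2})$ by $$S(\Psi):=\left\{z=(z_1^T,z_2^T)^T:z_1\in\mathbf{R}^{n_1},\ z_2=-\sum_{i=0}^{\ell-1}N^i\left[\alpha_2u^{(i)}(0)+\beta_2\Psi^{(i)}(-h)+\Psi_{v02}^{(i)}(0)\right]\in\mathbf{R}^{n_2}\right\},$$ $$A(\Psi):=\left\{(z_0,\Psi,\Psi_{v02}):z_0\in S(\Psi),\ \Psi\in C^{(\ell-1)}([-h,0],\mathbf{R}),\ \Psi_{v02}\in C^{(\ell-1)}([-h,0],\mathbf{R}^{n_2})\right\}.$$ If $\ell=0,1$, or if $(z_0,\Psi,\Psi_{v02})\in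 A(\Psi)$ with $\ell\ge2$, then the unique output trajectory solution of the system on $\mathbf{R}_0^+$ is, with $z_{10}=z_1(0)$, $$y(t)=\gamma_1^Te^{Wt}\left[z_{10}+\int_0^te^{-W\tau}(\alpha_1u(\tau)+\beta_1u(\tau-h)+\eta_1(\tau))d\tau\right]-\gamma_2^T\sum_{i=0}^{\ell-1}N^i\left[\alpha_2u^{(i)}(t)+\beta_2u^{(i)}(t-h)+\eta_2^{(i)}(t)\right],\quad\forall t>h,$$ $$y(t)=\gamma_1^Te^{Wt}\left[z_{10}+\int_0^te^{-W\tau}(\alpha_1u(\tau)+\beta_1\Psi(\tau-h)+\eta_1(\tau))d\tau\right]-\gamma_2^T\sum_{i=0}^{\ell-1}N^i\left[\alpha_2u^{(i)}(t)+\beta_2\Psi^{(i)}(t-h)+\eta_2^{(i)}(t)\right],\quad\forall t\in[0,h],$$ where, for $i=1,2$, $$\gamma_i^T=c_1^TP_{1i}+c_2^TP_{2i},\quad\alpha_i=Q_{i1}b_1+Q_{i2}b_2,\quad\beta_i=Q_{i1}d_1+Q_{i2}d_2,\quad\eta_i=Q_{i1}v_{01}+Q_{i2}v_{02}.$$ In particular, the output trajectory solution becomes $$y(t)=\gamma_1^Te^{Wt}\left[z_{10}+\int_0^te^{-W\tau}(\alpha_1u(\tau)+\beta_1u(\tau-h)+\eta_1(\tau))d\tau\right]-\gamma_2^T\left[\alpha_2u(t)+\beta_2u(t-h)+\eta_2(t)\right],\quad\forall t>h,$$ $$y(t)=\gamma_1^Te^{Wt}\left[z_{10}+\int_0^te^{-W\tau}(\alpha_1u(\tau)+\beta_1\Psi(\tau-h)+\eta_1(\tau))d\tau\right]-\gamma_2^T\left[\alpha_2u(t)+\beta_2\Psi(t-h)+\eta_2(t)\right],\quad\forall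 t\in[0,h],$$ for $\ell=1$ (singular solvable system with zero nilpotent matrix) and $(z_0,\Psi,\Psi_{v02})\in A(\Psi)$, even if $u\notin C^{(\ell-1)}(\mathbf{R}_0^+\cup[-h,0),\mathbf{R})$ or $\Psi_{v02}\notin C^{(\ell-1)}(\mathbf{R}_0^+\cup[-h,0),\mathbf{R}^{n_2})$; and $$y(t)=\gamma_1^Te^{Wt}\left[z_{10}+\int_0^te^{-W\tau}(\alpha_1u(\tau)+\beta_1u(\tau-h)+\eta_1(\tau))d\tau\right],\quad\forall t>h,$$ $$y(t)=\gamma_1^Te^{Wt}\left[z_{10}+\int_0^te^{-W\tau}(\alpha_1u(\tau)+\beta_1\Psi(\tau-h)+\eta_1(\tau))d\tau\right],\quad\forall t\in[0,h],$$ for $\ell=0$ (nonsingular system, i.e. in standard form, for which solvability always holds) and $(z_0,\Psi,\Psi_{v02})\in A(\Psi)$, even if $u\notin C^{(\ell-1)}(\mathbf{R}_0^+\cup[-h,0),\mathbf{R})$ or $\Psi_{v02}\notin C^{(\ell-1)}(\mathbf{R}_0^+\cup[-h,0),\mathbf{R}^{n_2})$.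
   Context: **System.** $h>0$, $E,A\in\mathbf{R}^{n\times n}$ ($E$ singular, except in the case $\ell=0$ where $E$ is nonsingular), $b,d,c\in\mathbf{R}^n$: $$E\dot x(t)=Ax(t)+bu(t)+du(t-h)+v_0(t),\quad y(t)=c^Tx(t),\quad x(0)=x_0,\quad u(t)=\Psi(t)\ \forall t\in[-h,0],$$ with scalar $u,y$ and disturbance $v_0(t)\in\mathbf{R}^n$. The pair $(E,A)$ is solvable if $\det(E-sA)$ is not identically zero for $s\in\mathbf{C}$ (regular pencil). **Weierstrass canonical form.** Under solvability there are nonsingular real $n\times n$ matrices $P,Q$ with $QEP=\operatorname{Diag}(I_{n_1},N)$, $QAP=\operatorname{Diag}(W,I_{n_2})$, $n_1+n_2=n$, where $W\in\mathbf{R}^{n_1\times n_1}$ (stated in the paper to be nonsingular) and $N\in\mathbf{R}^{n_2\times n_2}$ is nilpotent with nilpotency index $\ell$ (identified in the paper with the index $\operatorname{ind}(E)$ of $E$; $\ell=0$ corresponds to nonsingular $E$, where the $z_2$ block is absent). With $z=(z_1^T,z_2^T)^T=P^{-1}x$, $z_0=z(0)$, $Qb=(\alpha_1^T,\alpha_2^T)^T$, $Qd=(\beta_1^T,\beta_2^T)^T$, $Qv_0=(\eta_1^T,\eta_2^T)^T$, $c^TP=(\gamma_1^T,\gamma_2^T)$, the system is equivalent to $$\dot z_1=Wz_1+\alpha_1u(t)+\beta_1u(t-h)+\eta_1(t),\quad N\dot z_2=z_2+\alpha_2u(t)+\beta_2u(t-h)+\eta_2(t),\quad y=\gamma_1^Tz_1+\gamma_2^Tz_2.$$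 Here $P=(P_{ij})$, $Q=(Q_{ij})$, $i,j=1,2$, are block partitions with blocks of size $n_i\times n_j$, and $b=(b_1^T,b_2^T)^T$, $d=(d_1^T,d_2^T)^T$, $c=(c_1^T,c_2^T)^T$, $v_0=(v_{01}^T,v_{02}^T)^T$ are partitioned conformally. $C^{(q)}(D_R,\mathbf{R}^p)$ is the space of $\mathbf{R}^p$-valued functions of class $q$ on $D_R$.
   Formalization: For ℓ=1 the condition x(0)=x_0 is read as E x(0)=E x_0; literal x(0)=x_0 is claimed only for admissible data, with η_2(0)=Ψ_{v02}(0) added if regularity is dropped. E ẋ is taken as the integrated derivative of E x, and u, η_1 are locally integrable. *)

theory Defs
  imports "HOL-Analysis.Analysis" "Jordan_Normal_Form.Determinant"
begin

text \<open>
  Vectors and matrices are those of \<^theory>\<open>Jordan_Normal_Form.Matrix\<close>, whose dimensions are natural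
  numbers that may be \<open>0\<close>; either block of the Weierstrass form may be absent. Limits, derivatives
  and integrals of vector-valued functions are taken componentwise.
\<close>

section \<open>Derivatives and functions of class q\<close>

text \<open>One-sided at endpoints of \<open>S\<close> that belong to \<open>S\<close>.\<close>

primrec deriv_on :: "real set \<Rightarrow> nat \<Rightarrow> (real \<Rightarrow> real) \<Rightarrow> real \<Rightarrow> real" where
  "deriv_on S 0 f = f"
| "deriv_on S (Suc i) f = (\<lambda>t. vector_derivative (deriv_on S i f) (at t within S))"

text \<open>
  The order is an integer because the class \<open>l - 1\<close> occurs with \<open>l = 0\<close>. For \<open>q < 0\<close> membership
  imposes no condition.
\<close>

definition C_on :: "int \<Rightarrow> real set \<Rightarrow> (real \<Rightarrow> real) \<Rightarrow> bool" where
  "C_on q S f \<longleftrightarrow>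
     (\<forall>i. int i < q \<longrightarrow> (\<forall>t\<in>S. deriv_on S i f differentiable (at t within S))) \<and>
     (\<forall>i. int i \<le> q \<longrightarrow> continuous_on S (deriv_on S i f))"

definition vec_deriv_on ::
  "nat \<Rightarrow> real set \<Rightarrow> nat \<Rightarrow> (real \<Rightarrow> real Matrix.vec) \<Rightarrow> real \<Rightarrow> real Matrix.vec" where
  "vec_deriv_on m S i f t = Matrix.vec m (\<lambda>j. deriv_on S i (\<lambda>s. vec_index (f s) j) t)"

definition vec_C_on :: "nat \<Rightarrow> int \<Rightarrow> real set \<Rightarrow> (real \<Rightarrow> real Matrix.vec) \<Rightarrow> bool" where
  "vec_C_on m q S f \<longleftrightarrow>
     (\<forall>t\<in>S. f t \<in> carrier_vec m) \<and> (\<forall>j<m. C_on q S (\<lambda>t. vec_index (f t) j))"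

definition vec_continuous_on :: "nat \<Rightarrow> real set \<Rightarrow> (real \<Rightarrow> real Matrix.vec) \<Rightarrow> bool" where
  "vec_continuous_on m S f \<longleftrightarrow> (\<forall>j<m. continuous_on S (\<lambda>t. vec_index (f t) j))"


section \<open>Integrals\<close>

definition has_vec_integral ::
  "(real \<Rightarrow> real Matrix.vec) \<Rightarrow> real Matrix.vec \<Rightarrow> real set \<Rightarrow> bool" where
  "has_vec_integral f v S \<longleftrightarrow>
     (\<forall>j<dim_vec v. ((\<lambda>t. vec_index (f t) j) has_integral vec_index v j) S)"

definition vec_integral :: "nat \<Rightarrow> real set \<Rightarrow> (real \<Rightarrow> real Matrix.vec) \<Rightarrow> real Matrix.vec" where
  "vec_integral m S f = Matrix.vec m (\<lambda>j. integral S (\<lambda>t. vec_index (f t) j))"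

definition loc_integrable_from :: "real \<Rightarrow> (real \<Rightarrow> real) \<Rightarrow> bool" where
  "loc_integrable_from a f \<longleftrightarrow> (\<forall>T\<ge>a. f absolutely_integrable_on {a..T})"

definition vec_loc_integrable_from :: "nat \<Rightarrow> real \<Rightarrow> (real \<Rightarrow> real Matrix.vec) \<Rightarrow> bool" where
  "vec_loc_integrable_from m a f \<longleftrightarrow> (\<forall>j<m. loc_integrable_from a (\<lambda>t. vec_index (f t) j))"


section \<open>Matrices\<close>

definition mat_exp :: "real Matrix.mat \<Rightarrow> real Matrix.mat" where
  "mat_exp M = Matrix.mat (dim_row M) (dim_row M) (\<lambda>(i, j). \<Sum>k. index_mat (M ^\<^sub>m k) (i, j) / fact k)"

text \<open>
  The unique matrix of size \<open>0\<close> satisfies \<open>M ^\<^sub>m 0 = 1\<^sub>m 0 = 0\<^sub>m 0 0\<close>, so its index is \<open>0\<close>, and it is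
  the only nilpotent matrix of index \<open>0\<close>.
\<close>

definition nilpotency_index :: "real Matrix.mat \<Rightarrow> nat \<Rightarrow> bool" where
  "nilpotency_index M l \<longleftrightarrow>
     M ^\<^sub>m l = 0\<^sub>m (dim_row M) (dim_row M) \<and> (\<forall>k<l. M ^\<^sub>m k \<noteq> 0\<^sub>m (dim_row M) (dim_row M))"

definition solvable_pencil :: "real Matrix.mat \<Rightarrow> real Matrix.mat \<Rightarrow> bool" where
  "solvable_pencil E A \<longleftrightarrow>
     (\<exists>s::complex. Determinant.det (map_mat complex_of_real E - s \<cdot>\<^sub>m map_mat complex_of_real A) \<noteq> 0)"

text \<open>
  By nilpotency of \<open>N\<close>, the matrix \<open>E\<close> is nonsingular iff \<open>n2 = 0\<close>, iff \<open>l = 0\<close>. Nonsingularity of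
  \<open>W\<close> is not required.
\<close>

definition weierstrass_form ::
  "nat \<Rightarrow> nat \<Rightarrow> nat \<Rightarrow> nat \<Rightarrow> real Matrix.mat \<Rightarrow> real Matrix.mat \<Rightarrow> real Matrix.mat \<Rightarrow> real Matrix.mat \<Rightarrow>
   real Matrix.mat \<Rightarrow> real Matrix.mat \<Rightarrow> bool" where
  "weierstrass_form n n1 n2 l E A P Q W N \<longleftrightarrow>
     n1 + n2 = n \<and>
     P \<in> carrier_mat n n \<and> invertible_mat P \<and>
     Q \<in> carrier_mat n n \<and> invertible_mat Q \<and>
     W \<in> carrier_mat n1 n1 \<and> N \<in> carrier_mat n2 n2 \<and>
     Q * E * P = four_block_mat (1\<^sub>m n1) (0\<^sub>m n1 n2) (0\<^sub>m n2 n1) N \<and>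
     Q * A * P = four_block_mat W (0\<^sub>m n1 n2) (0\<^sub>m n2 n1) (1\<^sub>m n2) \<and>
     nilpotency_index N l"


section \<open>Solutions\<close>

text \<open>
  Solutions of \<open>E x'(t) = A x(t) + g(t)\<close> on \<open>t \<ge> 0\<close>. The function \<open>xd\<close> plays the role of \<open>x'\<close>: the
  equation holds at every \<open>t \<ge> 0\<close>, and \<open>E xd\<close> is the derivative of \<open>E x\<close> in the Caratheodory sense.
  Only \<open>E x\<close>, not \<open>x\<close>, has to be differentiable, since the algebraic components of \<open>x\<close> are no
  smoother than the data. Every differentiable \<open>x\<close> with \<open>x(0) = x0\<close> that satisfies the equation
  pointwise is a solution with \<open>xd = x'\<close>; conversely, if \<open>x\<close> and \<open>g\<close> are continuous, then \<open>E x\<close> is continuously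
  differentiable with derivative \<open>A x + g\<close>.

  At \<open>t = 0\<close> the integral equation says \<open>E x(0) = E x0\<close>: the initial state \<open>x0\<close> is the state
  immediately before time \<open>0\<close>, and the components of \<open>x\<close> not seen by \<open>E\<close> may jump.
\<close>

definition dae_solution ::
  "nat \<Rightarrow> real Matrix.mat \<Rightarrow> real Matrix.mat \<Rightarrow> (real \<Rightarrow> real Matrix.vec) \<Rightarrow> real Matrix.vec \<Rightarrow>
   (real \<Rightarrow> real Matrix.vec) \<Rightarrow> bool" where
  "dae_solution n E A g x0 x \<longleftrightarrow>
     (\<forall>t\<ge>0. x t \<in> carrier_vec n) \<and>
     (\<exists>xd. (\<forall>t\<ge>0. xd t \<in> carrier_vec n \<and> E *\<^sub>v xd t = A *\<^sub>v x t + g t) \<and>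
           (\<forall>t\<ge>0. has_vec_integral (\<lambda>\<tau>. E *\<^sub>v xd \<tau>) (E *\<^sub>v x t - E *\<^sub>v x0) {0..t}))"

definition delayed_forcing ::
  "real \<Rightarrow> real Matrix.vec \<Rightarrow> real Matrix.vec \<Rightarrow> (real \<Rightarrow> real) \<Rightarrow> (real \<Rightarrow> real Matrix.vec) \<Rightarrow>
   real \<Rightarrow> real Matrix.vec" where
  "delayed_forcing h b d u v t = u t \<cdot>\<^sub>v b + u (t - h) \<cdot>\<^sub>v d + v t"

text \<open>Trajectories in the class \<open>X\<close> exist, and all of them have the output \<open>y\<close>.\<close>

definition unique_output ::
  "real Matrix.vec \<Rightarrow> ((real \<Rightarrow> real Matrix.vec) \<Rightarrow> bool) \<Rightarrow> (real \<Rightarrow> real) \<Rightarrow> bool" where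
  "unique_output c X y \<longleftrightarrow>
     (\<exists>x. X x) \<and> (\<forall>x. X x \<longrightarrow> (\<forall>t\<ge>0. scalar_prod c (x t) = y t))"


section \<open>The explicit formula and admissible initial data\<close>

definition slow_state ::
  "real Matrix.mat \<Rightarrow> real Matrix.vec \<Rightarrow> (real \<Rightarrow> real Matrix.vec) \<Rightarrow> real \<Rightarrow> real Matrix.vec" where
  "slow_state W z f t =
     mat_exp (t \<cdot>\<^sub>m W) *\<^sub>v (z + vec_integral (dim_row W) {0..t} (\<lambda>\<tau>. mat_exp ((- \<tau>) \<cdot>\<^sub>m W) *\<^sub>v f \<tau>))"

definition nilpotent_sum ::
  "real Matrix.mat \<Rightarrow> nat \<Rightarrow> (nat \<Rightarrow> real Matrix.vec) \<Rightarrow> real Matrix.vec" where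
  "nilpotent_sum N l F = finsum_vec TYPE(real) (dim_row N) (\<lambda>i. (N ^\<^sub>m i) *\<^sub>v F i) {..<l}"

text \<open>
  The domain of \<open>u\<close> is \<open>{-h..}\<close>; that of \<open>\<Psi>\<close> and \<open>\<Psi>v\<close> is \<open>{-h..0}\<close>.
\<close>

definition admissible_states ::
  "nat \<Rightarrow> real \<Rightarrow> nat \<Rightarrow> real Matrix.mat \<Rightarrow> real Matrix.vec \<Rightarrow> real Matrix.vec \<Rightarrow> (real \<Rightarrow> real) \<Rightarrow>
   (real \<Rightarrow> real) \<Rightarrow> (real \<Rightarrow> real Matrix.vec) \<Rightarrow> real Matrix.vec set" where
  "admissible_states n1 h l N \<alpha>2 \<beta>2 u \<Psi> \<Psi>v =
     {z1 @\<^sub>v z2 | z1 z2. z1 \<in> carrier_vec n1 \<and>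
        z2 = - nilpotent_sum N l (\<lambda>i. deriv_on {-h..} i u 0 \<cdot>\<^sub>v \<alpha>2 + deriv_on {-h..0} i \<Psi> (-h) \<cdot>\<^sub>v \<beta>2
                                     + vec_deriv_on (dim_row N) {-h..0} i \<Psi>v 0)}"

definition admissible_data ::
  "nat \<Rightarrow> real \<Rightarrow> nat \<Rightarrow> real Matrix.mat \<Rightarrow> real Matrix.vec \<Rightarrow> real Matrix.vec \<Rightarrow> (real \<Rightarrow> real) \<Rightarrow>
   (real \<Rightarrow> real) \<Rightarrow> (real Matrix.vec \<times> (real \<Rightarrow> real) \<times> (real \<Rightarrow> real Matrix.vec)) set" where
  "admissible_data n1 h l N \<alpha>2 \<beta>2 u \<Psi> =
     {(z, \<psi>, \<psi>v). \<psi> = \<Psi> \<and> z \<in> admissible_states n1 h l N \<alpha>2 \<beta>2 u \<psi> \<psi>v \<and>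
        C_on (int l - 1) {-h..0} \<psi> \<and> vec_C_on (dim_row N) (int l - 1) {-h..0} \<psi>v}"

end

theory Submission
  imports Defs
begin

text \<open>
  Substituting \<open>x = P z\<close> and multiplying by \<open>Q\<close> turns the equation \<open>E x' = A x + g\<close> into two uncoupled ones,
  \<open>z1' = W z1 + f1\<close> and \<open>N z2' = z2 + f2\<close> with \<open>Q g = (f1, f2)\<close>, and the output into
  \<open>\<gamma>1 \<bullet> z1 + \<gamma>2 \<bullet> z2\<close> (\<open>decoupled_solution_iff\<close>, \<open>scalar_prod_block_coordinates\<close>). Each equation is solved
  explicitly and shown to have no other solution.

  The slow equation is an ordinary linear one, and its solution is the variation of constants formula
  (\<open>slow_state_solution\<close>). The forcing is merely locally integrable, so the solution is only
  absolutely continuous and the formula is verified in integral form. What makes this work is integration by parts for the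
  product of a smooth function with an indefinite integral (\<open>integration_by_parts_indefinite_integral\<close>), which
  is proved by a second-order estimate of the defect rather than by differentiation. The difference of two solutions
  is continuously differentiable, and the exponential of \<open>- t W\<close> applied to it is constant (\<open>homogeneous_ode_zero\<close>).

  The fast equation is solved by iterating \<open>z2 = - f2 + N z2'\<close>, which ends after \<open>l\<close> steps because
  \<open>N ^\<^sub>m l = 0\<close> (\<open>fast_state_solution\<close>). Conversely, the difference \<open>e\<close> of two solutions satisfies \<open>N e(t) = \<integral> e\<close> over
  \<open>{0..t}\<close>; so if \<open>N ^\<^sub>m Suc p\<close> annihilates a continuous \<open>e\<close>, then \<open>N ^\<^sub>m p\<close> does as well, and descending from
  \<open>N ^\<^sub>m l = 0\<close> gives \<open>e = 0\<close> (\<open>homogeneous_nilpotent_zero\<close>).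

  The integral equation prescribes \<open>z1(0)\<close> and \<open>N z2(0)\<close>. Since \<open>z2\<close> is determined by the data, the second
  condition is a constraint on the initial state, which is what admissibility provides; it is void when
  \<open>N = 0\<close>, that is, for \<open>l \<le> 1\<close>. Finally, on \<open>{0..h}\<close> the delayed input and its derivatives can be read
  off the prehistory, because two functions of class \<open>q\<close> that agree before \<open>0\<close> have the same derivatives up to
  order \<open>q\<close> at \<open>0\<close> (\<open>deriv_on_eq_extension\<close>).
\<close>

section \<open>Iterated derivatives\<close>

lemma C_on_has_derivative:
  assumes "C_on q S f" "int i < q" "t \<in> S"
  shows "(deriv_on S i f has_real_derivative deriv_on S (Suc i) f t) (at t within S)"
  using assms unfolding C_on_def
  by (simp add: vector_derivative_works has_real_derivative_iff_has_vector_derivative)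

lemma C_on_continuous:
  assumes "C_on q S f" "int i \<le> q"
  shows "continuous_on S (deriv_on S i f)"
  using assms unfolding C_on_def by blast

text \<open>
  For \<open>t < b\<close> the filters \<open>at t within {a..}\<close> and \<open>at t within {a..b}\<close> coincide, so each derivative inherits the agreement of the previous one.
\<close>

lemma deriv_on_eq_before:
  assumes "\<forall>t\<in>{a..<b}. f t = g t" and "t \<in> {a..<b}"
  shows "deriv_on {a..} i f t = deriv_on {a..b} i g t"
  using assms(2)
proof (induction i arbitrary: t)
  case 0
  then show ?case using assms(1) by simp
next
  case (Suc i)
  have filter: "at t within {a..} = at t within {a..b}"
    by (rule at_within_nhd[of _ "{..<b}"]) (use Suc.prems in auto)
  have "eventually (\<lambda>s. s < b) (nhds t)"
    using Suc.prems by (intro eventually_nhds_in_open[of "{..<b}", simplified]) auto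
  then have "eventually (\<lambda>s. s \<in> {a..b} \<longrightarrow> deriv_on {a..} i f s = deriv_on {a..b} i g s) (nhds t)"
    by eventually_elim (use Suc.IH in auto)
  then have "vector_derivative (deriv_on {a..} i f) (at t within {a..b})
      = vector_derivative (deriv_on {a..b} i g) (at t within {a..b})"
    by (intro vector_derivative_cong_eq) (use Suc.prems in auto)
  then show ?case by (simp add: filter)
qed

text \<open>
  At \<open>b\<close> the derivative of \<open>f\<close> is two-sided and that of \<open>g\<close> is one-sided, and the values \<open>f b\<close> and \<open>g b\<close>
  are not compared. Both derivatives are nevertheless continuous up to \<open>b\<close>, hence are limits from the left,
  where they agree. This identifies the derivatives of an input with those of its prehistory, the end
  point of the prehistory included.
\<close>

lemma deriv_on_eq_extension:
  assumes f: "C_on q {a..} f" and g: "C_on q {a..b} g" and eq: "\<forall>t\<in>{a..<b}. f t = g t"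
    and "a < b" "int i \<le> q" "t \<in> {a..b}"
  shows "deriv_on {a..} i f t = deriv_on {a..b} i g t"
proof (cases "t = b")
  case False
  then show ?thesis using assms deriv_on_eq_before[OF eq, of t i] by auto
next
  case True
  have left: "at b within {a..b} = at_left b" using \<open>a < b\<close> by (rule at_within_Icc_at_left)
  have "(deriv_on {a..} i f \<longlongrightarrow> deriv_on {a..} i f b) (at b within {a..b})"
    using C_on_continuous[OF f \<open>int i \<le> q\<close>] \<open>a < b\<close>
    by (intro tendsto_within_subset[of _ _ b "{a..}" "{a..b}"]) (auto simp: continuous_on_def)
  then have lim_f: "(deriv_on {a..} i f \<longlongrightarrow> deriv_on {a..} i f b) (at_left b)"
    by (simp add: left)
  have lim_g: "(deriv_on {a..b} i g \<longlongrightarrow> deriv_on {a..b} i g b) (at_left b)"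
    using C_on_continuous[OF g \<open>int i \<le> q\<close>] \<open>a < b\<close> by (auto simp: continuous_on_def simp flip: left)
  have "eventually (\<lambda>s. deriv_on {a..} i f s = deriv_on {a..b} i g s) (at_left b)"
    by (rule eventually_at_leftI[OF _ \<open>a < b\<close>]) (use deriv_on_eq_before[OF eq] in auto)
  then have "(deriv_on {a..b} i g \<longlongrightarrow> deriv_on {a..} i f b) (at_left b)"
    using lim_f tendsto_cong by blast
  from tendsto_unique[OF _ this lim_g] show ?thesis using True by simp
qed

section \<open>Integration by parts against an integrable function\<close>

lemma has_real_derivative_cong_on:
  fixes f g :: "real \<Rightarrow> real"
  assumes "s \<in> S" "(f has_real_derivative D) (at s within S)" "\<And>r. r \<in> S \<Longrightarrow> g r = f r"
  shows "(g has_real_derivative D) (at s within S)"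
  unfolding has_field_derivative_def
  by (rule has_derivative_transform[OF assms(1) _ assms(2)[unfolded has_field_derivative_def]])
    (rule assms(3))

text \<open>
  The difference quotient of \<open>\<Phi>\<close> at \<open>x\<close> is bounded by \<open>\<bar>K * (V y - V x)\<bar>\<close>, which tends to \<open>0\<close> by continuity, so
  \<open>\<Phi>\<close> has derivative \<open>0\<close> everywhere. A bound by \<open>V y - V x\<close> alone would not do: the factor \<open>y - x\<close> is what
  beats the division.
\<close>

lemma constant_if_product_bound:
  fixes \<Phi> V :: "real \<Rightarrow> real"
  assumes cont: "continuous_on {a..b} V"
    and bound: "\<And>x y. a \<le> x \<Longrightarrow> x \<le> y \<Longrightarrow> y \<le> b \<Longrightarrow> \<bar>\<Phi> y - \<Phi> x\<bar> \<le> K * (y - x) * (V y - V x)"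
    and "a \<le> b"
  shows "\<Phi> b = \<Phi> a"
proof -
  have "(\<Phi> has_real_derivative 0) (at x within {a..b})" if x: "x \<in> {a..b}" for x
  proof -
    have bound': "norm ((\<Phi> y - \<Phi> x) / (y - x)) \<le> norm (K * (V y - V x))"
      if "y \<in> {a..b}" "y \<noteq> x" for y
    proof -
      have "\<bar>\<Phi> y - \<Phi> x\<bar> \<le> \<bar>K * (V y - V x)\<bar> * \<bar>y - x\<bar>"
      proof (cases "x \<le> y")
        case True
        then have "\<bar>\<Phi> y - \<Phi> x\<bar> \<le> K * (V y - V x) * (y - x)"
          using bound[of x y] that x by (simp add: mult_ac)
        also have "\<dots> \<le> \<bar>K * (V y - V x) * (y - x)\<bar>" by simp
        finally show ?thesis by (simp add: abs_mult)
      next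
        case False
        then have "\<bar>\<Phi> y - \<Phi> x\<bar> \<le> K * (V x - V y) * (x - y)"
          using bound[of y x] that x by (simp add: mult_ac abs_minus_commute)
        also have "\<dots> \<le> \<bar>K * (V y - V x) * (y - x)\<bar>"
          by (metis abs_ge_self abs_minus_commute abs_mult)
        finally show ?thesis by (simp add: abs_mult)
      qed
      then show ?thesis using that by (simp add: divide_simps abs_mult mult_ac)
    qed
    have "((\<lambda>y. K * (V y - V x)) \<longlongrightarrow> K * (V x - V x)) (at x within {a..b})"
      using cont x by (intro tendsto_intros) (auto simp: continuous_on_def)
    then have "((\<lambda>y. K * (V y - V x)) \<longlongrightarrow> 0) (at x within {a..b})" by simp
    then have "((\<lambda>y. (\<Phi> y - \<Phi> x) / (y - x)) \<longlongrightarrow> 0) (at x within {a..b})"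
      by (rule Lim_null_comparison[rotated, OF tendsto_norm_zero])
        (use bound' in \<open>auto simp: eventually_at_filter\<close>)
    then show ?thesis by (simp add: has_field_derivative_iff)
  qed
  then have "\<exists>c. \<forall>x\<in>{a..b}. \<Phi> x = c"
    by (intro has_field_derivative_zero_constant) auto
  then show ?thesis using \<open>a \<le> b\<close> by auto
qed

text \<open>
  The indefinite integral of \<open>p\<close> need not be differentiable at any given point, so the product rule and the fundamental
  theorem of calculus do not apply to \<open>G s * integral {a..s} p\<close>. Instead, the defect \<open>\<Phi>\<close> of the formula on
  \<open>{a..s}\<close> is of second order: over \<open>{x..y}\<close> it changes by the integral of
  \<open>(G y - G s) * p s + G' s * (P x - P s)\<close>, where \<open>G\<close> varies by \<open>O(y - x)\<close> and \<open>P\<close> by at most the integral of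
  \<open>\<bar>p\<bar>\<close>. Thus \<open>\<Phi>\<close> is constant.
\<close>

lemma integration_by_parts_indefinite_integral:
  fixes G G' p :: "real \<Rightarrow> real"
  assumes "a \<le> b"
    and G: "\<And>s. s \<in> {a..b} \<Longrightarrow> (G has_real_derivative G' s) (at s within {a..b})"
    and G': "continuous_on {a..b} G'" and p: "p absolutely_integrable_on {a..b}"
  shows "((\<lambda>s. G' s * integral {a..s} p + G s * p s) has_integral G b * integral {a..b} p) {a..b}"
proof -
  define P where "P s = integral {a..s} p" for s
  define V where "V s = integral {a..s} (\<lambda>\<tau>. \<bar>p \<tau>\<bar>)" for s
  define q where "q s = G' s * P s + G s * p s" for s
  define \<Phi> where "\<Phi> s = G s * P s - integral {a..s} q" for s
  have p_int: "p integrable_on {a..b}" and abs_int: "(\<lambda>\<tau>. \<bar>p \<tau>\<bar>) integrable_on {a..b}"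
    using p by (auto simp: absolutely_integrable_on_def)
  have contG: "continuous_on {a..b} G"
    using G by (rule DERIV_continuous_on)
  have contP: "continuous_on {a..b} P" and contV: "continuous_on {a..b} V"
    using indefinite_integral_continuous_1 p_int abs_int unfolding P_def V_def by auto
  have Gp: "(\<lambda>s. G s * p s) integrable_on {a..b}"
  proof -
    have "G \<in> borel_measurable (lebesgue_on {a..b})"
      using contG by (intro continuous_imp_measurable_on_sets_lebesgue) auto
    moreover have "bounded (G ` {a..b})"
      using contG by (simp add: compact_continuous_image compact_imp_bounded)
    ultimately have "(\<lambda>s. G s * p s) absolutely_integrable_on {a..b}"
      using p by (intro absolutely_integrable_bounded_measurable_product_real) auto
    then show ?thesis using absolutely_integrable_on_def by blast
  qed
  have G'P: "(\<lambda>s. G' s * P s) integrable_on {a..b}"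
    using G' contP by (intro integrable_continuous_interval continuous_intros)
  have q_int: "q integrable_on {a..b}"
    unfolding q_def using Gp G'P by (intro integrable_add)
  have "bounded (G' ` {a..b})"
    using G' by (simp add: compact_continuous_image compact_imp_bounded)
  then obtain M where "\<forall>v\<in>G' ` {a..b}. norm v \<le> M" unfolding bounded_iff by blast
  then have M: "\<bar>G' s\<bar> \<le> M" if "s \<in> {a..b}" for s using that by simp
  have split: "integral {a..y} k - integral {a..x} k = integral {x..y} k"
    if "k integrable_on {a..b}" "a \<le> x" "x \<le> y" "y \<le> b" for k :: "real \<Rightarrow> real" and x y
    using Henstock_Kurzweil_Integration.integral_combine[of a x y k] that
      integrable_on_subinterval[OF that(1), of a y] by auto
  have "\<bar>\<Phi> y - \<Phi> x\<bar> \<le> (2 * M) * (y - x) * (V y - V x)"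
    if xy: "a \<le> x" "x \<le> y" "y \<le> b" for x y
  proof -
    have sub: "k integrable_on {x..y}" if "k integrable_on {a..b}" for k :: "real \<Rightarrow> real"
      using integrable_on_subinterval[OF that, of x y] xy by auto
    have M0: "0 \<le> M" using M[of x] xy by force
    have MVT: "\<bar>G y - G s\<bar> \<le> M * (y - x)" if s: "s \<in> {x..y}" for s
    proof -
      have "norm (G y - G s) \<le> M * norm (y - s)"
        by (rule field_differentiable_bound[of "{x..y}" G G'])
          (use s xy M in \<open>auto intro!: DERIV_subset[OF G]\<close>)
      also have "\<dots> \<le> M * (y - x)" using s M0 by (intro mult_left_mono) auto
      finally show ?thesis by simp
    qed
    have PV: "\<bar>P x - P s\<bar> \<le> V y - V x" if s: "s \<in> {x..y}" for s
    proof -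
      have "\<bar>P s - P x\<bar> = \<bar>integral {x..s} p\<bar>"
        using split[OF p_int, of x s] s xy by (simp add: P_def)
      also have "\<dots> \<le> integral {x..s} (\<lambda>\<tau>. \<bar>p \<tau>\<bar>)"
        using integral_norm_bound_integral[of p "{x..s}" "\<lambda>\<tau>. \<bar>p \<tau>\<bar>"]
          integrable_on_subinterval[OF p_int, of x s] integrable_on_subinterval[OF abs_int, of x s] s xy
        by auto
      also have "\<dots> \<le> integral {x..y} (\<lambda>\<tau>. \<bar>p \<tau>\<bar>)"
        using integrable_on_subinterval[OF abs_int, of x s] integrable_on_subinterval[OF abs_int, of x y] s xy
        by (intro integral_subset_le) auto
      finally show ?thesis using split[OF abs_int, of x y] xy by (simp add: V_def abs_minus_commute)
    qed
    \<comment> \<open>The increment of \<open>\<Phi>\<close> over \<open>{x..y}\<close> is the integral of \<open>r\<close>, and \<open>r\<close> is small pointwise.\<close>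
    define r where "r s = (G y * p s - G s * p s) + (P x * G' s - G' s * P s)" for s
    have G'_int: "(G' has_integral (G y - G x)) {x..y}"
      using xy by (intro fundamental_theorem_of_calculus)
        (auto simp flip: has_real_derivative_iff_has_vector_derivative intro!: DERIV_subset[OF G])
    have r_int: "(r has_integral
        (G y * integral {x..y} p - integral {x..y} (\<lambda>s. G s * p s))
        + (P x * (G y - G x) - integral {x..y} (\<lambda>s. G' s * P s))) {x..y}"
      unfolding r_def
      by (intro has_integral_add has_integral_diff has_integral_mult_right integrable_integral
          G'_int sub p_int Gp G'P)
    have q_xy: "integral {x..y} q = integral {x..y} (\<lambda>s. G' s * P s) + integral {x..y} (\<lambda>s. G s * p s)"
      unfolding q_def by (intro Henstock_Kurzweil_Integration.integral_add sub Gp G'P)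
    have \<Phi>_xy: "\<Phi> y - \<Phi> x = G y * P y - G x * P x - integral {x..y} q"
      using split[OF q_int xy] by (simp add: \<Phi>_def)
    have p_xy: "integral {x..y} p = P y - P x" using split[OF p_int xy] by (simp add: P_def)
    have "(G y * integral {x..y} p - integral {x..y} (\<lambda>s. G s * p s))
        + (P x * (G y - G x) - integral {x..y} (\<lambda>s. G' s * P s)) = \<Phi> y - \<Phi> x"
      unfolding \<Phi>_xy q_xy p_xy by (simp add: algebra_simps)
    then have r: "(r has_integral (\<Phi> y - \<Phi> x)) {x..y}" using r_int by simp
    have bd: "norm (r s) \<le> M * (y - x) * \<bar>p s\<bar> + M * (V y - V x)" if s: "s \<in> {x..y}" for s
    proof -
      have "r s = (G y - G s) * p s + G' s * (P x - P s)" by (simp add: r_def algebra_simps)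
      then have "norm (r s) \<le> \<bar>G y - G s\<bar> * \<bar>p s\<bar> + \<bar>G' s\<bar> * \<bar>P x - P s\<bar>"
        by (metis abs_mult abs_triangle_ineq real_norm_def)
      also have "\<dots> \<le> M * (y - x) * \<bar>p s\<bar> + M * (V y - V x)"
        using MVT[OF s] PV[OF s] M[of s] s xy M0 by (intro add_mono mult_mono) auto
      finally show ?thesis .
    qed
    have dom: "((\<lambda>s. M * (y - x) * \<bar>p s\<bar> + M * (V y - V x)) has_integral
        M * (y - x) * (V y - V x) + (y - x) * (M * (V y - V x))) {x..y}"
      using has_integral_add[OF has_integral_mult_right[OF integrable_integral[OF sub[OF abs_int]],
            of "M * (y - x)"] has_integral_const_real[of "M * (V y - V x)" x y]]
        split[OF abs_int xy] xy by (simp add: V_def)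
    have "norm (integral {x..y} r) \<le> integral {x..y} (\<lambda>s. M * (y - x) * \<bar>p s\<bar> + M * (V y - V x))"
      using r dom bd by (intro integral_norm_bound_integral) (auto simp: integrable_on_def)
    then show ?thesis
      using integral_unique[OF r] integral_unique[OF dom] by (simp add: algebra_simps)
  qed
  from constant_if_product_bound[OF contV this \<open>a \<le> b\<close>]
  have "\<Phi> b = \<Phi> a" by simp
  then have "integral {a..b} q = G b * P b" by (simp add: \<Phi>_def P_def)
  then show ?thesis
    using integrable_integral[OF q_int] unfolding q_def P_def by simp
qed

lemma absolutely_integrable_shift:
  fixes f :: "real \<Rightarrow> real"
  assumes "f absolutely_integrable_on {a - c..b - c}"
  shows "(\<lambda>t. f (t - c)) absolutely_integrable_on {a..b}"
proof -
  have "(\<lambda>t. k (t - c)) integrable_on {a..b}" if "k integrable_on {a - c..b - c}" for k :: "real \<Rightarrow> real"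
    using integrable_affinity[of k "a - c" "b - c" 1 "- c"] that by (simp add: image_affinity_atLeastAtMost)
  then show ?thesis using assms unfolding absolutely_integrable_on_def by auto
qed



section \<open>Matrices and vectors\<close>

lemma eq_if_minus_zero_vec:
  fixes v w :: "real Matrix.vec"
  assumes "v - w = 0\<^sub>v m" "v \<in> carrier_vec m" "w \<in> carrier_vec m"
  shows "v = w"
proof (rule eq_vecI)
  fix i assume "i < dim_vec w"
  then have "vec_index (v - w) i = vec_index v i - vec_index w i" "i < m" using assms(3) by auto
  then show "vec_index v i = vec_index w i" using assms(1) by simp
qed (use assms in auto)

lemma index_mult_mat_sum:
  assumes "X \<in> carrier_mat r m" "Y \<in> carrier_mat m k" "i < r" "j < k"
  shows "index_mat (X * Y) (i, j) = (\<Sum>q<m. index_mat X (i, q) * index_mat Y (q, j))"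
  using assms by (auto simp: scalar_prod_def lessThan_atLeast0)

lemma index_mult_mat_vec_sum:
  assumes "X \<in> carrier_mat r m" "v \<in> carrier_vec m" "i < r"
  shows "vec_index (X *\<^sub>v v) i = (\<Sum>q<m. index_mat X (i, q) * vec_index v q)"
  using assms by (auto simp: scalar_prod_def lessThan_atLeast0)

lemma pow_mat_Suc_left:
  assumes "M \<in> carrier_mat m m"
  shows "M ^\<^sub>m Suc k = M * M ^\<^sub>m k"
proof (induction k)
  case 0
  then show ?case using assms by simp
next
  case (Suc k)
  have "M ^\<^sub>m Suc (Suc k) = M * M ^\<^sub>m k * M" using Suc by simp
  also have "\<dots> = M * (M ^\<^sub>m k * M)" using assms by (intro assoc_mult_mat) auto
  finally show ?case by simp
qed

lemma smult_pow_mat: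
  fixes M :: "real Matrix.mat"
  assumes "M \<in> carrier_mat m m"
  shows "(t \<cdot>\<^sub>m M) ^\<^sub>m k = t ^ k \<cdot>\<^sub>m M ^\<^sub>m k"
proof (induction k)
  case 0
  then show ?case using assms by (intro eq_matI) auto
next
  case (Suc k)
  have "M ^\<^sub>m k \<in> carrier_mat m m" using assms by simp
  then show ?case using Suc assms
    by (intro eq_matI) (auto simp: mult_ac)
qed

section \<open>The matrix exponential\<close>

text \<open>
  The maximal row sum is a submultiplicative norm; this bounds the entries of the powers of \<open>M\<close>
  geometrically, so that the series of the matrix exponential is dominated by a scalar exponential series.
\<close>

lemma pow_mat_row_sum_bound:
  fixes M :: "real Matrix.mat"
  assumes M: "M \<in> carrier_mat m m"
    and C: "\<And>q. q < m \<Longrightarrow> (\<Sum>j<m. \<bar>index_mat M (q, j)\<bar>) \<le> C" and "0 \<le> C" and "i < m"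
  shows "(\<Sum>j<m. \<bar>index_mat (M ^\<^sub>m k) (i, j)\<bar>) \<le> C ^ k"
proof (induction k)
  case 0
  have "(\<Sum>j<m. \<bar>index_mat (M ^\<^sub>m 0) (i, j)\<bar>) = (\<Sum>j<m. if i = j then 1 else 0)"
    using M \<open>i < m\<close> by (intro sum.cong) auto
  also have "\<dots> = 1" using \<open>i < m\<close> by (subst sum.delta') auto
  finally show ?case by simp
next
  case (Suc k)
  have pow: "M ^\<^sub>m k \<in> carrier_mat m m" using M by simp
  have "(\<Sum>j<m. \<bar>index_mat (M ^\<^sub>m Suc k) (i, j)\<bar>)
      = (\<Sum>j<m. \<bar>\<Sum>q<m. index_mat (M ^\<^sub>m k) (i, q) * index_mat M (q, j)\<bar>)"
    using index_mult_mat_sum[OF pow M \<open>i < m\<close>] by (intro sum.cong) auto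
  also have "\<dots> \<le> (\<Sum>j<m. \<Sum>q<m. \<bar>index_mat (M ^\<^sub>m k) (i, q)\<bar> * \<bar>index_mat M (q, j)\<bar>)"
    by (intro sum_mono order_trans[OF sum_abs]) (simp add: abs_mult)
  also have "\<dots> = (\<Sum>q<m. \<bar>index_mat (M ^\<^sub>m k) (i, q)\<bar> * (\<Sum>j<m. \<bar>index_mat M (q, j)\<bar>))"
    by (subst sum.swap) (simp add: sum_distrib_left)
  also have "\<dots> \<le> (\<Sum>q<m. \<bar>index_mat (M ^\<^sub>m k) (i, q)\<bar> * C)"
    using C by (intro sum_mono mult_left_mono) auto
  also have "\<dots> \<le> C ^ k * C"
    using Suc \<open>0 \<le> C\<close> by (simp add: sum_distrib_right[symmetric] mult_right_mono)
  finally show ?case by (simp add: mult.commute)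
qed

lemma mat_exp_carrier [simp]: "M \<in> carrier_mat m m \<Longrightarrow> mat_exp M \<in> carrier_mat m m"
  by (auto simp: mat_exp_def)

context
  fixes M :: "real Matrix.mat" and m :: nat
  assumes M: "M \<in> carrier_mat m m"
begin

definition exp_coeff :: "nat \<Rightarrow> nat \<Rightarrow> nat \<Rightarrow> real" where
  "exp_coeff i j k = index_mat (M ^\<^sub>m k) (i, j) / fact k"

lemma summable_exp_coeff:
  assumes "i < m" "j < m"
  shows "summable (\<lambda>k. exp_coeff i j k * t ^ k)"
proof -
  \<comment> \<open>The sum of the absolute values of all entries bounds every row sum.\<close>
  define C where "C = (\<Sum>q<m. \<Sum>j<m. \<bar>index_mat M (q, j)\<bar>)"
  have C: "(\<Sum>j<m. \<bar>index_mat M (q, j)\<bar>) \<le> C" if "q < m" for q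
    unfolding C_def using that
    by (intro member_le_sum[of q "{..<m}" "\<lambda>q. \<Sum>j<m. \<bar>index_mat M (q, j)\<bar>"]) (auto intro: sum_nonneg)
  have "0 \<le> C" unfolding C_def by (intro sum_nonneg) auto
  have "summable (\<lambda>k. inverse (fact k) * (C * \<bar>t\<bar>) ^ k)" by (rule summable_exp)
  moreover have "norm (exp_coeff i j k * t ^ k) \<le> inverse (fact k) * (C * \<bar>t\<bar>) ^ k" for k
  proof -
    have "\<bar>index_mat (M ^\<^sub>m k) (i, j)\<bar> \<le> (\<Sum>j<m. \<bar>index_mat (M ^\<^sub>m k) (i, j)\<bar>)"
      using \<open>j < m\<close> by (intro member_le_sum) auto
    also have "\<dots> \<le> C ^ k" using pow_mat_row_sum_bound[OF M C \<open>0 \<le> C\<close> \<open>i < m\<close>] .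
    finally have "\<bar>index_mat (M ^\<^sub>m k) (i, j)\<bar> * \<bar>t\<bar> ^ k \<le> C ^ k * \<bar>t\<bar> ^ k"
      by (intro mult_right_mono) auto
    then show ?thesis
      by (simp add: exp_coeff_def abs_mult power_abs power_mult_distrib divide_simps)
  qed
  ultimately show ?thesis by (rule summable_comparison_test'[of _ 0])
qed

lemma mat_exp_smult_index:
  assumes "i < m" "j < m"
  shows "index_mat (mat_exp (t \<cdot>\<^sub>m M)) (i, j) = (\<Sum>k. exp_coeff i j k * t ^ k)"
proof -
  have "index_mat ((t \<cdot>\<^sub>m M) ^\<^sub>m k) (i, j) / fact k = exp_coeff i j k * t ^ k" for k
    using M assms by (simp add: smult_pow_mat exp_coeff_def)
  then show ?thesis using M assms by (simp add: mat_exp_def)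
qed

lemma mat_exp_0: "mat_exp (0 \<cdot>\<^sub>m M) = 1\<^sub>m m"
proof (rule eq_matI)
  fix i j assume "i < dim_row (1\<^sub>m m)" "j < dim_col (1\<^sub>m m)"
  then have ij: "i < m" "j < m" by auto
  have "(\<Sum>k. exp_coeff i j k * 0 ^ k) = exp_coeff i j 0" by (rule powser_zero)
  then show "index_mat (mat_exp (0 \<cdot>\<^sub>m M)) (i, j) = index_mat (1\<^sub>m m) (i, j)"
    using M mat_exp_smult_index[OF ij] by (simp add: exp_coeff_def)
qed (use M in \<open>auto simp: mat_exp_def\<close>)

lemma DERIV_mat_exp_index:
  assumes "i < m" "j < m"
  shows "((\<lambda>t. index_mat (mat_exp (t \<cdot>\<^sub>m M)) (i, j)) has_real_derivative
      (\<Sum>k. (index_mat (M ^\<^sub>m Suc k) (i, j) / fact k) * t ^ k)) (at t)"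
proof -
  have "diffs (exp_coeff i j) k = index_mat (M ^\<^sub>m Suc k) (i, j) / fact k" for k
    by (simp add: diffs_def exp_coeff_def divide_simps)
  then show ?thesis
    using termdiffs_strong_converges_everywhere[OF summable_exp_coeff[OF assms], of t]
      mat_exp_smult_index[OF assms] by (simp add: fun_eq_iff)
qed

text \<open>
  Termwise differentiation shifts the powers of \<open>M\<close> by one. The extra factor can be split off on the left
  or on the right; having both forms avoids a separate proof that \<open>M\<close> commutes with its exponential.
\<close>

lemma mat_exp_derivative_left:
  assumes "i < m" "j < m"
  shows "((\<lambda>t. index_mat (mat_exp (t \<cdot>\<^sub>m M)) (i, j)) has_real_derivative
      index_mat (M * mat_exp (t \<cdot>\<^sub>m M)) (i, j)) (at t)"
proof -
  have "(\<lambda>k. (index_mat (M ^\<^sub>m Suc k) (i, j) / fact k) * t ^ k)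
      sums (\<Sum>q<m. index_mat M (i, q) * index_mat (mat_exp (t \<cdot>\<^sub>m M)) (q, j))"
  proof -
    have "(\<lambda>k. \<Sum>q<m. index_mat M (i, q) * (exp_coeff q j k * t ^ k))
        sums (\<Sum>q<m. index_mat M (i, q) * index_mat (mat_exp (t \<cdot>\<^sub>m M)) (q, j))"
      by (intro sums_sum sums_mult)
        (use assms summable_exp_coeff in \<open>auto simp: mat_exp_smult_index summable_sums\<close>)
    moreover have "(\<Sum>q<m. index_mat M (i, q) * (exp_coeff q j k * t ^ k))
        = index_mat (M ^\<^sub>m Suc k) (i, j) / fact k * t ^ k" for k
      unfolding pow_mat_Suc_left[OF M]
      using index_mult_mat_sum[OF M, of "M ^\<^sub>m k" m i j] M assms
      by (simp add: exp_coeff_def sum_distrib_left sum_divide_distrib mult_ac del: index_mult_mat)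
    ultimately show ?thesis by simp
  qed
  then show ?thesis
    using DERIV_mat_exp_index[OF assms, of t] index_mult_mat_sum[OF M, of "mat_exp (t \<cdot>\<^sub>m M)" m i j]
      M assms by (simp add: sums_iff del: index_mult_mat)
qed

lemma mat_exp_derivative_right:
  assumes "i < m" "j < m"
  shows "((\<lambda>t. index_mat (mat_exp (t \<cdot>\<^sub>m M)) (i, j)) has_real_derivative
      index_mat (mat_exp (t \<cdot>\<^sub>m M) * M) (i, j)) (at t)"
proof -
  have "(\<lambda>k. (index_mat (M ^\<^sub>m Suc k) (i, j) / fact k) * t ^ k)
      sums (\<Sum>q<m. index_mat (mat_exp (t \<cdot>\<^sub>m M)) (i, q) * index_mat M (q, j))"
  proof -
    have "(\<lambda>k. \<Sum>q<m. (exp_coeff i q k * t ^ k) * index_mat M (q, j))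
        sums (\<Sum>q<m. index_mat (mat_exp (t \<cdot>\<^sub>m M)) (i, q) * index_mat M (q, j))"
      by (intro sums_sum sums_mult2)
        (use assms summable_exp_coeff in \<open>auto simp: mat_exp_smult_index summable_sums\<close>)
    moreover have "(\<Sum>q<m. (exp_coeff i q k * t ^ k) * index_mat M (q, j))
        = index_mat (M ^\<^sub>m Suc k) (i, j) / fact k * t ^ k" for k
      using index_mult_mat_sum[of "M ^\<^sub>m k" m m M m i j] M assms
      by (simp add: exp_coeff_def sum_distrib_left sum_divide_distrib mult_ac del: index_mult_mat)
    ultimately show ?thesis by simp
  qed
  then show ?thesis
    using DERIV_mat_exp_index[OF assms, of t] index_mult_mat_sum[of "mat_exp (t \<cdot>\<^sub>m M)" m m M m i j]
      M assms by (simp add: sums_iff del: index_mult_mat)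
qed

lemma mat_exp_derivative_reflected:
  assumes "i < m" "j < m"
  shows "((\<lambda>t. index_mat (mat_exp ((- t) \<cdot>\<^sub>m M)) (i, j)) has_real_derivative
      - index_mat (M * mat_exp ((- t) \<cdot>\<^sub>m M)) (i, j)) (at t)"
    and "((\<lambda>t. index_mat (mat_exp ((- t) \<cdot>\<^sub>m M)) (i, j)) has_real_derivative
      - index_mat (mat_exp ((- t) \<cdot>\<^sub>m M) * M) (i, j)) (at t)"
  using DERIV_chain2[OF mat_exp_derivative_left[OF assms, of "- t"] DERIV_minus[OF DERIV_ident]]
    DERIV_chain2[OF mat_exp_derivative_right[OF assms, of "- t"] DERIV_minus[OF DERIV_ident]]
  by simp_all

lemma continuous_on_mat_exp_index:
  assumes "i < m" "j < m"
  shows "continuous_on S (\<lambda>t. index_mat (mat_exp (t \<cdot>\<^sub>m M)) (i, j))"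
  using DERIV_isCont[OF mat_exp_derivative_left[OF assms]]
  by (intro continuous_at_imp_continuous_on) auto

text \<open>
  Differentiating the first factor produces \<open>M\<close> on its right, differentiating the second produces \<open>- M\<close>
  on its left. The two contributions cancel, so the product keeps its value at \<open>t = 0\<close>.
\<close>

lemma mat_exp_times_reflected: "mat_exp (t \<cdot>\<^sub>m M) * mat_exp ((- t) \<cdot>\<^sub>m M) = 1\<^sub>m m"
proof (rule eq_matI)
  fix i j assume "i < dim_row (1\<^sub>m m)" "j < dim_col (1\<^sub>m m)"
  then have ij: "i < m" "j < m" by auto
  define \<phi> where "\<phi> t = index_mat (mat_exp (t \<cdot>\<^sub>m M) * mat_exp ((- t) \<cdot>\<^sub>m M)) (i, j)" for t
  have E: "mat_exp (s \<cdot>\<^sub>m M) \<in> carrier_mat m m" for s using M by simp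
  have \<phi>: "\<phi> = (\<lambda>t. \<Sum>q<m. index_mat (mat_exp (t \<cdot>\<^sub>m M)) (i, q) * index_mat (mat_exp ((- t) \<cdot>\<^sub>m M)) (q, j))"
    unfolding \<phi>_def using index_mult_mat_sum[OF E E ij] by (intro ext)
  have "(\<phi> has_real_derivative 0) (at t)" for t
  proof -
    let ?E = "mat_exp (t \<cdot>\<^sub>m M)" and ?F = "mat_exp ((- t) \<cdot>\<^sub>m M)"
    have "(\<phi> has_real_derivative (\<Sum>q<m. index_mat ?E (i, q) * - index_mat (M * ?F) (q, j)
        + index_mat (?E * M) (i, q) * index_mat ?F (q, j))) (at t)"
      unfolding \<phi>
      by (intro DERIV_sum DERIV_mult' mat_exp_derivative_right mat_exp_derivative_reflected(1))
        (use ij in auto)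
    moreover have "(\<Sum>q<m. index_mat ?E (i, q) * - index_mat (M * ?F) (q, j)
        + index_mat (?E * M) (i, q) * index_mat ?F (q, j))
        = index_mat (?E * M * ?F) (i, j) - index_mat (?E * (M * ?F)) (i, j)"
      using index_mult_mat_sum[of "?E * M" m m ?F m i j] index_mult_mat_sum[of ?E m m "M * ?F" m i j]
        mult_carrier_mat[OF E M, of t] mult_carrier_mat[OF M E, of "- t"] E ij
      by (simp add: sum_subtractf del: index_mult_mat)
    moreover have "?E * M * ?F = ?E * (M * ?F)"
      by (rule assoc_mult_mat[OF E M E])
    ultimately show ?thesis by simp
  qed
  then have "\<phi> t = \<phi> 0" using DERIV_isconst_all by blast
  moreover have "\<phi> 0 = index_mat (1\<^sub>m m) (i, j)"
    using mat_exp_0 by (simp add: \<phi>_def)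
  ultimately show "index_mat (mat_exp (t \<cdot>\<^sub>m M) * mat_exp ((- t) \<cdot>\<^sub>m M)) (i, j) = index_mat (1\<^sub>m m) (i, j)"
    by (simp add: \<phi>_def)
qed (use M in \<open>auto simp: mat_exp_def\<close>)

end

section \<open>Solutions of linear systems\<close>

lemma has_vec_integral_cong:
  assumes "\<And>\<tau>. \<tau> \<in> S \<Longrightarrow> f \<tau> = g \<tau>"
  shows "has_vec_integral f v S \<longleftrightarrow> has_vec_integral g v S"
  unfolding has_vec_integral_def using assms by (intro all_cong has_integral_cong) auto

text \<open>
  The auxiliary derivative disappears: \<open>E *\<^sub>v xd t\<close> is determined by the equation, and all that remains of
  \<open>xd\<close> is that the right-hand side lies in the range of \<open>E\<close>.
\<close>

lemma dae_solution_iff: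
  "dae_solution n E A g x0 x \<longleftrightarrow>
     (\<forall>t\<ge>0. x t \<in> carrier_vec n) \<and>
     (\<forall>t\<ge>0. \<exists>w\<in>carrier_vec n. E *\<^sub>v w = A *\<^sub>v x t + g t) \<and>
     (\<forall>t\<ge>0. has_vec_integral (\<lambda>\<tau>. A *\<^sub>v x \<tau> + g \<tau>) (E *\<^sub>v x t - E *\<^sub>v x0) {0..t})"
  (is "_ \<longleftrightarrow> ?X \<and> ?R \<and> ?I")
proof
  assume "dae_solution n E A g x0 x"
  then obtain xd where "?X"
    and xd: "\<forall>t\<ge>0. xd t \<in> carrier_vec n \<and> E *\<^sub>v xd t = A *\<^sub>v x t + g t"
    and "\<forall>t\<ge>0. has_vec_integral (\<lambda>\<tau>. E *\<^sub>v xd \<tau>) (E *\<^sub>v x t - E *\<^sub>v x0) {0..t}"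
    unfolding dae_solution_def by blast
  moreover have "has_vec_integral (\<lambda>\<tau>. E *\<^sub>v xd \<tau>) v {0..t}
      \<longleftrightarrow> has_vec_integral (\<lambda>\<tau>. A *\<^sub>v x \<tau> + g \<tau>) v {0..t}" for v t
    using xd by (intro has_vec_integral_cong) auto
  ultimately show "?X \<and> ?R \<and> ?I" by blast
next
  assume rhs: "?X \<and> ?R \<and> ?I"
  then obtain xd where xd: "\<forall>t\<ge>0. xd t \<in> carrier_vec n \<and> E *\<^sub>v xd t = A *\<^sub>v x t + g t" by metis
  moreover have "has_vec_integral (\<lambda>\<tau>. E *\<^sub>v xd \<tau>) v {0..t}
      \<longleftrightarrow> has_vec_integral (\<lambda>\<tau>. A *\<^sub>v x \<tau> + g \<tau>) v {0..t}" for v t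
    using xd by (intro has_vec_integral_cong) auto
  ultimately show "dae_solution n E A g x0 x"
    unfolding dae_solution_def using rhs by blast
qed

lemma dae_solutionD:
  assumes "dae_solution n E A g x0 x" "t \<ge> 0"
  shows "x t \<in> carrier_vec n" "\<exists>w\<in>carrier_vec n. E *\<^sub>v w = A *\<^sub>v x t + g t"
    and "has_vec_integral (\<lambda>\<tau>. A *\<^sub>v x \<tau> + g \<tau>) (E *\<^sub>v x t - E *\<^sub>v x0) {0..t}"
  using assms unfolding dae_solution_iff by blast+

lemma dae_solution_cong:
  assumes "\<forall>t\<ge>0. x t = x' t" "\<forall>t\<ge>0. g t = g' t"
  shows "dae_solution n E A g x0 x \<longleftrightarrow> dae_solution n E A g' x0 x'"
proof -
  have "has_vec_integral (\<lambda>\<tau>. A *\<^sub>v x \<tau> + g \<tau>) v {0..t}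
      \<longleftrightarrow> has_vec_integral (\<lambda>\<tau>. A *\<^sub>v x' \<tau> + g' \<tau>) v {0..t}" for v t
    using assms by (intro has_vec_integral_cong) auto
  then show ?thesis unfolding dae_solution_iff using assms by auto
qed

lemma has_vec_integral_diff:
  assumes "has_vec_integral f v S" "has_vec_integral g w S"
    and "v \<in> carrier_vec m" "w \<in> carrier_vec m"
    and "\<And>\<tau>. \<tau> \<in> S \<Longrightarrow> f \<tau> \<in> carrier_vec m" "\<And>\<tau>. \<tau> \<in> S \<Longrightarrow> g \<tau> \<in> carrier_vec m"
  shows "has_vec_integral (\<lambda>\<tau>. f \<tau> - g \<tau>) (v - w) S"
  unfolding has_vec_integral_def
proof (intro allI impI)
  fix j assume "j < dim_vec (v - w)"
  then have j: "j < m" using assms by auto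
  have "((\<lambda>\<tau>. vec_index (f \<tau>) j - vec_index (g \<tau>) j) has_integral (vec_index v j - vec_index w j)) S"
    using assms j unfolding has_vec_integral_def by (intro has_integral_diff) auto
  moreover have "vec_index (f \<tau> - g \<tau>) j = vec_index (f \<tau>) j - vec_index (g \<tau>) j" if "\<tau> \<in> S" for \<tau>
    using assms(5,6)[OF that] j by auto
  ultimately have "((\<lambda>\<tau>. vec_index (f \<tau> - g \<tau>) j) has_integral (vec_index v j - vec_index w j)) S"
    by (subst has_integral_cong[of S _ "\<lambda>\<tau>. vec_index (f \<tau>) j - vec_index (g \<tau>) j"]) auto
  then show "((\<lambda>\<tau>. vec_index (f \<tau> - g \<tau>) j) has_integral vec_index (v - w) j) S"
    using j assms(3,4) by simp
qed

lemma has_vec_integral_mult_mat: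
  assumes int: "has_vec_integral f v S"
    and T: "T \<in> carrier_mat k m" and v: "v \<in> carrier_vec m"
    and f: "\<And>\<tau>. \<tau> \<in> S \<Longrightarrow> f \<tau> \<in> carrier_vec m"
  shows "has_vec_integral (\<lambda>\<tau>. T *\<^sub>v f \<tau>) (T *\<^sub>v v) S"
  unfolding has_vec_integral_def
proof (intro allI impI)
  fix j assume "j < dim_vec (T *\<^sub>v v)"
  then have j: "j < k" using T by simp
  have "((\<lambda>\<tau>. \<Sum>q<m. index_mat T (j, q) * vec_index (f \<tau>) q) has_integral
      (\<Sum>q<m. index_mat T (j, q) * vec_index v q)) S"
    using int v unfolding has_vec_integral_def
    by (intro has_integral_sum has_integral_mult_right) auto
  then show "((\<lambda>\<tau>. vec_index (T *\<^sub>v f \<tau>) j) has_integral vec_index (T *\<^sub>v v) j) S"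
    using index_mult_mat_vec_sum[OF T v j] index_mult_mat_vec_sum[OF T f j]
    by (subst has_integral_cong[of S _ "\<lambda>\<tau>. \<Sum>q<m. index_mat T (j, q) * vec_index (f \<tau>) q"]) auto
qed

text \<open>
  By linearity, uniqueness for any forcing reduces to the homogeneous system with zero initial state.
\<close>

lemma dae_solution_difference:
  assumes E: "E \<in> carrier_mat n n" and A: "A \<in> carrier_mat n n"
    and x0: "x0 \<in> carrier_vec n" and g: "\<forall>t\<ge>0. g t \<in> carrier_vec n"
    and x: "dae_solution n E A g x0 x" and y: "dae_solution n E A g x0 y"
  shows "dae_solution n E A (\<lambda>_. 0\<^sub>v n) (0\<^sub>v n) (\<lambda>t. x t - y t)"
proof -
  have carr: "x t \<in> carrier_vec n" "y t \<in> carrier_vec n" "g t \<in> carrier_vec n" if "t \<ge> 0" for t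
    using dae_solutionD(1)[OF x that] dae_solutionD(1)[OF y that] g that by auto
  have lin: "(A *\<^sub>v x t + g t) - (A *\<^sub>v y t + g t) = A *\<^sub>v (x t - y t) + 0\<^sub>v n" if "t \<ge> 0" for t
    using A carr[OF that] by (simp add: mult_minus_distrib_mat_vec[of _ n n]) auto
  have range: "\<exists>w\<in>carrier_vec n. E *\<^sub>v w = A *\<^sub>v (x t - y t) + 0\<^sub>v n" if t: "t \<ge> 0" for t
  proof -
    obtain w w' where w: "w \<in> carrier_vec n" "E *\<^sub>v w = A *\<^sub>v x t + g t"
      and w': "w' \<in> carrier_vec n" "E *\<^sub>v w' = A *\<^sub>v y t + g t"
      using dae_solutionD(2)[OF x t] dae_solutionD(2)[OF y t] by blast
    have "E *\<^sub>v (w - w') = A *\<^sub>v (x t - y t) + 0\<^sub>v n"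
      using mult_minus_distrib_mat_vec[OF E w(1) w'(1)] w w' lin[OF t] by simp
    then show ?thesis using w w' by (intro bexI[of _ "w - w'"]) auto
  qed
  have "has_vec_integral (\<lambda>\<tau>. A *\<^sub>v (x \<tau> - y \<tau>) + 0\<^sub>v n)
      (E *\<^sub>v (x t - y t) - E *\<^sub>v 0\<^sub>v n) {0..t}" if t: "t \<ge> 0" for t
  proof -
    have int: "has_vec_integral (\<lambda>\<tau>. (A *\<^sub>v x \<tau> + g \<tau>) - (A *\<^sub>v y \<tau> + g \<tau>))
        ((E *\<^sub>v x t - E *\<^sub>v x0) - (E *\<^sub>v y t - E *\<^sub>v x0)) {0..t}"
      using dae_solutionD(3)[OF x t] dae_solutionD(3)[OF y t] A E x0 carr t
      by (intro has_vec_integral_diff[of _ _ _ _ _ n]) auto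
    have eq: "(E *\<^sub>v x t - E *\<^sub>v x0) - (E *\<^sub>v y t - E *\<^sub>v x0) = E *\<^sub>v (x t - y t) - E *\<^sub>v 0\<^sub>v n"
      using E carr[OF t] x0 by (intro eq_vecI) (auto simp: mult_minus_distrib_mat_vec[of _ n n])
    show ?thesis
      by (rule has_vec_integral_cong[THEN iffD1, OF _ int[unfolded eq]]) (rule lin, simp)
  qed
  then show ?thesis unfolding dae_solution_iff using carr range by auto
qed

section \<open>The slow subsystem\<close>

lemma absolutely_integrable_continuous_mult:
  fixes f g :: "real \<Rightarrow> real"
  assumes "continuous_on {a..b} g" "f absolutely_integrable_on {a..b}"
  shows "(\<lambda>t. g t * f t) absolutely_integrable_on {a..b}"
  using assms
  by (intro absolutely_integrable_bounded_measurable_product_real)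
    (auto intro!: continuous_imp_measurable_on_sets_lebesgue compact_imp_bounded compact_continuous_image)

context
  fixes W :: "real Matrix.mat" and m :: nat and z :: "real Matrix.vec" and f :: "real \<Rightarrow> real Matrix.vec"
  assumes W: "W \<in> carrier_mat m m" and z: "z \<in> carrier_vec m"
    and f: "\<forall>t\<ge>0. f t \<in> carrier_vec m" and f_int: "vec_loc_integrable_from m 0 f"
begin

lemma slow_state_carrier: "slow_state W z f t \<in> carrier_vec m"
proof -
  have "z + vec_integral (dim_row W) {0..t} k \<in> carrier_vec m" for k
    using W z by (intro carrier_vecI) (simp add: vec_integral_def)
  then show ?thesis
    unfolding slow_state_def using W by (intro mult_mat_vec_carrier[of _ m m]) auto
qed

lemma slow_state_0: "slow_state W z f 0 = z"
proof -
  have "z + vec_integral m {0..0} k = z" for k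
    using z by (intro eq_vecI) (auto simp: vec_integral_def)
  then show ?thesis using W z by (simp add: slow_state_def mat_exp_0[OF W])
qed

text \<open>
  Variation of constants. With \<open>X t\<close> the exponential of \<open>t \<cdot>\<^sub>m W\<close> and \<open>p \<tau> = X (- \<tau>) *\<^sub>v f \<tau>\<close>, the product rule
  would give \<open>(X y)' = W X y + X p = W (X y) + f\<close>. As \<open>f\<close> is only locally integrable, this
  is carried out in integrated form, entry by entry, with integration by parts.
\<close>

lemma slow_state_solution: "dae_solution m (1\<^sub>m m) W f z (slow_state W z f)"
proof -
  define X where "X t = mat_exp (t \<cdot>\<^sub>m W)" for t
  define p where "p \<tau> = X (- \<tau>) *\<^sub>v f \<tau>" for \<tau>
  define y where "y t = z + vec_integral m {0..t} p" for t
  have X: "X t \<in> carrier_mat m m" for t using W by (simp add: X_def)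
  have y: "y t \<in> carrier_vec m" for t using z by (simp add: y_def vec_integral_def)
  have slow: "slow_state W z f t = X t *\<^sub>v y t" for t
    unfolding slow_state_def X_def y_def p_def using W by simp
  have contX: "continuous_on S (\<lambda>t. index_mat (X t) (i, j))" if "i < m" "j < m" for i j S
    using continuous_on_mat_exp_index[OF W that] by (simp add: X_def)
  have p: "p \<tau> \<in> carrier_vec m" if "\<tau> \<ge> 0" for \<tau>
    using X f that by (auto simp: p_def intro!: mult_mat_vec_carrier[of _ m m])
  have Xp: "X \<tau> *\<^sub>v p \<tau> = f \<tau>" if "\<tau> \<ge> 0" for \<tau>
  proof -
    have "X \<tau> *\<^sub>v p \<tau> = (X \<tau> * X (- \<tau>)) *\<^sub>v f \<tau>"
      unfolding p_def using f that by (intro assoc_mult_mat_vec[symmetric, OF X X]) auto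
    then show ?thesis using mat_exp_times_reflected[OF W, of \<tau>] f that by (simp add: X_def)
  qed
  have p_int: "(\<lambda>\<tau>. vec_index (p \<tau>) k) absolutely_integrable_on {0..T}" if "k < m" "T \<ge> 0" for k T
  proof -
    have "(\<lambda>\<tau>. \<Sum>q<m. index_mat (X (- \<tau>)) (k, q) * vec_index (f \<tau>) q) absolutely_integrable_on {0..T}"
    proof (intro absolutely_integrable_sum finite_lessThan absolutely_integrable_continuous_mult)
      fix q assume "q \<in> {..<m}"
      then have "q < m" by simp
      show "continuous_on {0..T} (\<lambda>\<tau>. index_mat (X (- \<tau>)) (k, q))"
        using continuous_on_compose[OF continuous_on_minus[OF continuous_on_id] contX[OF \<open>k < m\<close> \<open>q < m\<close>], of "{0..T}"]
        by (simp add: o_def)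
      show "(\<lambda>t. vec_index (f t) q) absolutely_integrable_on {0..T}"
        using f_int \<open>q < m\<close> \<open>T \<ge> 0\<close>
        unfolding vec_loc_integrable_from_def loc_integrable_from_def by auto
    qed
    moreover have "vec_index (p \<tau>) k = (\<Sum>q<m. index_mat (X (- \<tau>)) (k, q) * vec_index (f \<tau>) q)"
      if "\<tau> \<in> {0..T}" for \<tau>
      unfolding p_def using f that \<open>k < m\<close> by (intro index_mult_mat_vec_sum[OF X]) auto
    ultimately show ?thesis
      by (subst set_integrable_cong[OF refl refl]) auto
  qed
  have "has_vec_integral (\<lambda>\<tau>. W *\<^sub>v slow_state W z f \<tau> + f \<tau>)
      (1\<^sub>m m *\<^sub>v slow_state W z f t - 1\<^sub>m m *\<^sub>v z) {0..t}" if t: "t \<ge> 0" for t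
    unfolding has_vec_integral_def
  proof (intro allI impI)
    fix i assume "i < dim_vec (1\<^sub>m m *\<^sub>v slow_state W z f t - 1\<^sub>m m *\<^sub>v z)"
    then have i: "i < m" using z by simp
    have D: "((\<lambda>s. index_mat (X s) (i, k)) has_real_derivative index_mat (W * X s) (i, k)) (at s within S)"
      if "k < m" for s k S
      using has_field_derivative_at_within[OF mat_exp_derivative_left[OF W i that]] by (simp add: X_def)
    have contD: "continuous_on S (\<lambda>s. index_mat (W * X s) (i, k))" if "k < m" for k S
      using index_mult_mat_sum[OF W X i that] contX that
      by (auto simp del: index_mult_mat intro!: continuous_intros)
    have "((\<lambda>s. \<Sum>k<m. index_mat (W * X s) (i, k) * vec_index (y s) k + index_mat (X s) (i, k) * vec_index (p s) k)
        has_integral (\<Sum>k<m. index_mat (X t) (i, k) * vec_index (y t) k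
          - index_mat (X 0) (i, k) * vec_index z k)) {0..t}"
    proof (intro has_integral_sum)
      fix k assume "k \<in> {..<m}"
      then have k: "k < m" by simp
      have "((\<lambda>s. index_mat (W * X s) (i, k) * integral {0..s} (\<lambda>\<tau>. vec_index (p \<tau>) k)
            + index_mat (X s) (i, k) * vec_index (p s) k)
          has_integral index_mat (X t) (i, k) * integral {0..t} (\<lambda>\<tau>. vec_index (p \<tau>) k)) {0..t}"
        by (intro integration_by_parts_indefinite_integral t D contD k p_int)
      moreover have "((\<lambda>s. index_mat (W * X s) (i, k) * vec_index z k) has_integral
          (index_mat (X t) (i, k) - index_mat (X 0) (i, k)) * vec_index z k) {0..t}"
        using D[OF k] t
        by (intro has_integral_mult_left fundamental_theorem_of_calculus)
          (auto simp flip: has_real_derivative_iff_has_vector_derivative)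
      moreover have "vec_index (y s) k = integral {0..s} (\<lambda>\<tau>. vec_index (p \<tau>) k) + vec_index z k" for s
        using k z by (simp add: y_def vec_integral_def)
      ultimately show "((\<lambda>s. index_mat (W * X s) (i, k) * vec_index (y s) k + index_mat (X s) (i, k) * vec_index (p s) k)
        has_integral (index_mat (X t) (i, k) * vec_index (y t) k
          - index_mat (X 0) (i, k) * vec_index z k)) {0..t}"
        by (auto dest: has_integral_add simp: algebra_simps)
    qed simp
    moreover have "(\<Sum>k<m. index_mat (X t) (i, k) * vec_index (y t) k
          - index_mat (X 0) (i, k) * vec_index z k)
        = vec_index (1\<^sub>m m *\<^sub>v slow_state W z f t - 1\<^sub>m m *\<^sub>v z) i"
    proof -
      have "X 0 *\<^sub>v z = z" using mat_exp_0[OF W] z by (simp add: X_def)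
      then have "(\<Sum>k<m. index_mat (X 0) (i, k) * vec_index z k) = vec_index z i"
        using index_mult_mat_vec_sum[OF X z i, of 0] by simp
      moreover have "(\<Sum>k<m. index_mat (X t) (i, k) * vec_index (y t) k) = vec_index (slow_state W z f t) i"
        using index_mult_mat_vec_sum[OF X y i, of t t] by (simp add: slow)
      ultimately show ?thesis
        using i z slow_state_carrier[of t] by (simp add: sum_subtractf)
    qed
    moreover have "vec_index (W *\<^sub>v slow_state W z f s + f s) i
        = (\<Sum>k<m. index_mat (W * X s) (i, k) * vec_index (y s) k + index_mat (X s) (i, k) * vec_index (p s) k)"
      if s: "s \<in> {0..t}" for s
    proof -
      have "W *\<^sub>v slow_state W z f s = (W * X s) *\<^sub>v y s"
        unfolding slow by (rule assoc_mult_mat_vec[symmetric, OF W X y])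
      moreover have "vec_index ((W * X s) *\<^sub>v y s) i = (\<Sum>k<m. index_mat (W * X s) (i, k) * vec_index (y s) k)"
        by (rule index_mult_mat_vec_sum[OF mult_carrier_mat[OF W X] y i])
      moreover have "vec_index (f s) i = (\<Sum>k<m. index_mat (X s) (i, k) * vec_index (p s) k)"
        using index_mult_mat_vec_sum[OF X p i, of s s] Xp[of s] s by simp
      moreover have "f s \<in> carrier_vec m" using f s by simp
      ultimately show ?thesis
        using i by (simp add: sum.distrib del: index_mult_mat index_mult_mat_vec)
    qed
    ultimately show "((\<lambda>\<tau>. vec_index (W *\<^sub>v slow_state W z f \<tau> + f \<tau>) i) has_integral
        vec_index (1\<^sub>m m *\<^sub>v slow_state W z f t - 1\<^sub>m m *\<^sub>v z) i) {0..t}"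
      by (subst has_integral_cong[of _ _ "\<lambda>s. \<Sum>k<m. index_mat (W * X s) (i, k) * vec_index (y s) k
          + index_mat (X s) (i, k) * vec_index (p s) k"]) simp_all
  qed
  moreover have "\<exists>w\<in>carrier_vec m. 1\<^sub>m m *\<^sub>v w = W *\<^sub>v slow_state W z f t + f t" if "t \<ge> 0" for t
  proof -
    have "W *\<^sub>v slow_state W z f t \<in> carrier_vec m"
      using W slow_state_carrier by (rule mult_mat_vec_carrier)
    then have "W *\<^sub>v slow_state W z f t + f t \<in> carrier_vec m" using f that by simp
    then show ?thesis using one_mult_mat_vec by blast
  qed
  ultimately show ?thesis
    unfolding dae_solution_iff using slow_state_carrier by blast
qed

end

text \<open>
  The components of a solution are indefinite integrals. This holds for every Caratheodory
  solution, so continuity is available both for the explicit state and for an unknown competitor.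
\<close>

lemma ode_solution_continuous:
  assumes W: "W \<in> carrier_mat m m" and sol: "dae_solution m (1\<^sub>m m) W f z x"
    and z: "z \<in> carrier_vec m"
  shows "vec_continuous_on m {0..} x"
  unfolding vec_continuous_on_def
proof (intro allI impI)
  fix i assume i: "i < m"
  define k where "k = (\<lambda>\<tau>. vec_index (W *\<^sub>v x \<tau> + f \<tau>) i)"
  have x: "x t \<in> carrier_vec m" if "t \<ge> 0" for t using dae_solutionD(1)[OF sol that] .
  have int: "(k has_integral (vec_index (x t) i - vec_index z i)) {0..t}" if t: "t \<ge> 0" for t
  proof -
    have "has_vec_integral (\<lambda>\<tau>. W *\<^sub>v x \<tau> + f \<tau>) (1\<^sub>m m *\<^sub>v x t - 1\<^sub>m m *\<^sub>v z) {0..t}"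
      using dae_solutionD(3)[OF sol t] .
    then show ?thesis using i z x[OF t] by (auto simp: has_vec_integral_def k_def)
  qed
  have "continuous_on {0..T} (\<lambda>t. vec_index (x t) i)" if "T \<ge> 0" for T
  proof -
    have "continuous_on {0..T} (\<lambda>t. vec_index z i + integral {0..t} k)"
      using int[OF that] by (intro continuous_intros indefinite_integral_continuous_1) auto
    moreover have "vec_index z i + integral {0..t} k = vec_index (x t) i" if "t \<in> {0..T}" for t
      using integral_unique[OF int[of t]] that by simp
    ultimately show ?thesis by (rule continuous_on_eq)
  qed
  then have "continuous (at t within {0..}) (\<lambda>t. vec_index (x t) i)" if "t \<ge> 0" for t
  proof -
    have "at t within {0..} = at t within {0..t + 1}"
      by (rule at_within_nhd[of _ "{..<t + 1}"]) (use that in auto)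
    moreover have "continuous (at t within {0..t + 1}) (\<lambda>t. vec_index (x t) i)"
      using \<open>\<And>T. T \<ge> 0 \<Longrightarrow> continuous_on {0..T} _\<close>[of "t + 1"] that
      by (auto simp: continuous_on_eq_continuous_within)
    ultimately show ?thesis by simp
  qed
  then show "continuous_on {0..} (\<lambda>t. vec_index (x t) i)"
    by (auto simp: continuous_on_eq_continuous_within)
qed

text \<open>
  A solution \<open>e\<close> of the homogeneous equation is continuous, hence its integrand is, hence it is continuously
  differentiable; then \<open>X (- t) *\<^sub>v e t\<close> has derivative \<open>0\<close> and stays at its initial value \<open>0\<close>.
\<close>

lemma homogeneous_ode_zero:
  assumes W: "W \<in> carrier_mat m m" and sol: "dae_solution m (1\<^sub>m m) W (\<lambda>_. 0\<^sub>v m) (0\<^sub>v m) e"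
    and "t \<ge> 0"
  shows "e t = 0\<^sub>v m"
proof -
  define X where "X t = mat_exp (t \<cdot>\<^sub>m W)" for t
  have X: "X t \<in> carrier_mat m m" for t using W by (simp add: X_def)
  have e: "e s \<in> carrier_vec m" if "s \<ge> 0" for s using dae_solutionD(1)[OF sol that] .
  have We: "W *\<^sub>v e s \<in> carrier_vec m" if "s \<ge> 0" for s
    using W e[OF that] by (rule mult_mat_vec_carrier)
  have int: "((\<lambda>\<tau>. vec_index (W *\<^sub>v e \<tau>) i) has_integral vec_index (e s) i) {0..s}"
    if s: "s \<ge> 0" and i: "i < m" for s i
  proof -
    have "has_vec_integral (\<lambda>\<tau>. W *\<^sub>v e \<tau> + 0\<^sub>v m) (1\<^sub>m m *\<^sub>v e s - 1\<^sub>m m *\<^sub>v 0\<^sub>v m) {0..s}"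
      using dae_solutionD(3)[OF sol s] .
    moreover have "has_vec_integral (\<lambda>\<tau>. W *\<^sub>v e \<tau> + 0\<^sub>v m) v {0..s} \<longleftrightarrow> has_vec_integral (\<lambda>\<tau>. W *\<^sub>v e \<tau>) v {0..s}" for v
      using We by (intro has_vec_integral_cong) auto
    moreover have "1\<^sub>m m *\<^sub>v e s - 1\<^sub>m m *\<^sub>v 0\<^sub>v m = e s"
      using e[OF s] by (intro eq_vecI) auto
    ultimately show ?thesis using i e[OF s] by (auto simp: has_vec_integral_def)
  qed
  have cont: "continuous_on {0..t} (\<lambda>s. vec_index (e s) i)" if "i < m" for i
    using ode_solution_continuous[OF W sol] that
    by (auto simp: vec_continuous_on_def intro: continuous_on_subset)
  have D: "((\<lambda>s. vec_index (e s) i) has_real_derivative vec_index (W *\<^sub>v e s) i) (at s within {0..t})"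
    if i: "i < m" and s: "s \<in> {0..t}" for i s
  proof -
    have "continuous_on {0..t} (\<lambda>s. \<Sum>q<m. index_mat W (i, q) * vec_index (e s) q)"
      using cont by (intro continuous_intros) auto
    then have "continuous_on {0..t} (\<lambda>s. vec_index (W *\<^sub>v e s) i)"
      using index_mult_mat_vec_sum[OF W e i] by (subst continuous_on_cong[OF refl]) auto
    then have "((\<lambda>s. integral {0..s} (\<lambda>\<tau>. vec_index (W *\<^sub>v e \<tau>) i)) has_real_derivative
        vec_index (W *\<^sub>v e s) i) (at s within {0..t})"
      using s by (rule integral_has_real_derivative)
    then show ?thesis
      by (rule has_real_derivative_cong_on[OF s]) (use int[THEN integral_unique, OF _ i] in auto)
  qed
  have "X (- t) *\<^sub>v e t = 0\<^sub>v m"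
  proof (rule eq_vecI)
    fix k assume "k < dim_vec (0\<^sub>v m)"
    then have k: "k < m" by simp
    define \<psi> where "\<psi> s = vec_index (X (- s) *\<^sub>v e s) k" for s
    have \<psi>: "\<psi> s = (\<Sum>i<m. index_mat (X (- s)) (k, i) * vec_index (e s) i)" if "s \<in> {0..t}" for s
      unfolding \<psi>_def using e that by (intro index_mult_mat_vec_sum[OF X _ k]) auto
    have "(\<psi> has_real_derivative 0) (at s within {0..t})" if s: "s \<in> {0..t}" for s
    proof -
      have "((\<lambda>s. \<Sum>i<m. index_mat (X (- s)) (k, i) * vec_index (e s) i) has_real_derivative
          (\<Sum>i<m. index_mat (X (- s)) (k, i) * vec_index (W *\<^sub>v e s) i
            + (- index_mat (X (- s) * W) (k, i)) * vec_index (e s) i)) (at s within {0..t})"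
        unfolding X_def
        by (intro DERIV_sum DERIV_mult' D[OF _ s]
            has_field_derivative_at_within[OF mat_exp_derivative_reflected(2)[OF W k]]) auto
      moreover have "(\<Sum>i<m. index_mat (X (- s)) (k, i) * vec_index (W *\<^sub>v e s) i
            + (- index_mat (X (- s) * W) (k, i)) * vec_index (e s) i)
          = vec_index (X (- s) *\<^sub>v (W *\<^sub>v e s)) k - vec_index ((X (- s) * W) *\<^sub>v e s) k"
        using index_mult_mat_vec_sum[OF X We k, of s "- s"]
          index_mult_mat_vec_sum[OF mult_carrier_mat[OF X W] e k, of s "- s"] s
        by (simp add: sum_subtractf del: index_mult_mat index_mult_mat_vec)
      moreover have "(X (- s) * W) *\<^sub>v e s = X (- s) *\<^sub>v (W *\<^sub>v e s)"
        using e s by (intro assoc_mult_mat_vec[OF X W]) auto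
      ultimately have "((\<lambda>s. \<Sum>i<m. index_mat (X (- s)) (k, i) * vec_index (e s) i)
          has_real_derivative 0) (at s within {0..t})" by simp
      then show ?thesis by (rule has_real_derivative_cong_on[OF s]) (use \<psi> in auto)
    qed
    then have "\<exists>c. \<forall>s\<in>{0..t}. \<psi> s = c"
      by (intro has_field_derivative_zero_constant) auto
    then have "\<psi> t = \<psi> 0" using \<open>t \<ge> 0\<close> by auto
    also have "\<dots> = (\<Sum>i<m. index_mat (X (- 0)) (k, i) * vec_index (e 0) i)"
      using \<psi> \<open>t \<ge> 0\<close> by simp
    also have "\<dots> = 0"
    proof (rule sum.neutral, intro ballI)
      fix i assume "i \<in> {..<m}"
      then have "vec_index (e 0) i = 0"
        using int[of 0 i] has_integral_refl(1)[of "\<lambda>\<tau>. vec_index (W *\<^sub>v e \<tau>) i" 0]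
        by (auto dest: has_integral_unique simp del: index_mult_mat_vec)
      then show "index_mat (X (- 0)) (k, i) * vec_index (e 0) i = 0" by simp
    qed
    finally show "vec_index (X (- t) *\<^sub>v e t) k = vec_index (0\<^sub>v m) k" using k by (simp add: \<psi>_def)
  qed (use X in auto)
  moreover have "X t *\<^sub>v (X (- t) *\<^sub>v e t) = e t"
    using assoc_mult_mat_vec[OF X X e[OF \<open>t \<ge> 0\<close>], of t "- t"] mat_exp_times_reflected[OF W, of t]
      e[OF \<open>t \<ge> 0\<close>] by (simp add: X_def)
  moreover have "X t *\<^sub>v 0\<^sub>v m = 0\<^sub>v m" using X[of t] by (intro eq_vecI) auto
  ultimately show ?thesis by simp
qed

lemma slow_state_unique:
  assumes W: "W \<in> carrier_mat m m" and z: "z \<in> carrier_vec m"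
    and f: "\<forall>t\<ge>0. f t \<in> carrier_vec m" and f_int: "vec_loc_integrable_from m 0 f"
    and sol: "dae_solution m (1\<^sub>m m) W f z x" and "t \<ge> 0"
  shows "x t = slow_state W z f t"
proof -
  have "x t - slow_state W z f t = 0\<^sub>v m"
    by (rule homogeneous_ode_zero[OF W dae_solution_difference[OF _ W z f sol
        slow_state_solution[OF W z f f_int]] \<open>t \<ge> 0\<close>]) simp
  then show ?thesis
    using eq_if_minus_zero_vec dae_solutionD(1)[OF sol \<open>t \<ge> 0\<close>] slow_state_carrier[OF W z f f_int]
    by blast
qed



section \<open>The fast subsystem\<close>

lemma zero_mat_mult_vec:
  fixes v :: "real Matrix.vec"
  assumes "v \<in> carrier_vec m"
  shows "0\<^sub>m k m *\<^sub>v v = 0\<^sub>v k"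
  using assms by (intro eq_vecI) auto

lemma nilpotent_sum_carrier:
  assumes N: "N \<in> carrier_mat m m" and F: "\<forall>i<l. F i \<in> carrier_vec m"
  shows "nilpotent_sum N l F \<in> carrier_vec m"
proof -
  have "(\<lambda>i. (N ^\<^sub>m i) *\<^sub>v F i) \<in> {..<l} \<rightarrow> carrier_vec m"
    using N F by (auto intro!: mult_mat_vec_carrier[of _ m m])
  then show ?thesis using N unfolding nilpotent_sum_def by (simp add: finsum_vec_closed)
qed

lemma nilpotent_sum_index:
  assumes N: "N \<in> carrier_mat m m" and F: "\<forall>i<l. F i \<in> carrier_vec m" and "j < m"
  shows "vec_index (nilpotent_sum N l F) j = (\<Sum>i<l. vec_index ((N ^\<^sub>m i) *\<^sub>v F i) j)"
proof -
  have "(\<lambda>i. (N ^\<^sub>m i) *\<^sub>v F i) \<in> {..<l} \<rightarrow> carrier_vec m"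
    using N F by (auto intro!: mult_mat_vec_carrier[of _ m m])
  then show ?thesis using N \<open>j < m\<close> unfolding nilpotent_sum_def
    by (subst index_finsum_vec) auto
qed

lemma nilpotent_sum_cong:
  assumes N: "N \<in> carrier_mat m m" and F: "\<forall>i<l. F i \<in> carrier_vec m" and eq: "\<forall>i<l. F i = F' i"
  shows "nilpotent_sum N l F = nilpotent_sum N l F'"
proof (rule eq_vecI)
  have F': "\<forall>i<l. F' i \<in> carrier_vec m" using F eq by simp
  show "dim_vec (nilpotent_sum N l F) = dim_vec (nilpotent_sum N l F')"
    using nilpotent_sum_carrier[OF N F] nilpotent_sum_carrier[OF N F'] by simp
  fix j assume "j < dim_vec (nilpotent_sum N l F')"
  then have j: "j < m" using nilpotent_sum_carrier[OF N F'] by simp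
  show "vec_index (nilpotent_sum N l F) j = vec_index (nilpotent_sum N l F') j"
    unfolding nilpotent_sum_index[OF N F j] nilpotent_sum_index[OF N F' j]
    using eq by (intro sum.cong) auto
qed

lemma mult_nilpotent_sum_index:
  assumes N: "N \<in> carrier_mat m m" and F: "\<forall>i<l. F i \<in> carrier_vec m" and "j < m"
  shows "vec_index (N *\<^sub>v nilpotent_sum N l F) j = (\<Sum>i<l. vec_index ((N ^\<^sub>m Suc i) *\<^sub>v F i) j)"
proof -
  have pow: "N ^\<^sub>m i \<in> carrier_mat m m" for i using N by simp
  have NF: "N ^\<^sub>m i *\<^sub>v F i \<in> carrier_vec m" if "i < l" for i
    using F that by (intro mult_mat_vec_carrier[OF pow]) auto
  have "vec_index (N *\<^sub>v nilpotent_sum N l F) j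
      = (\<Sum>q<m. index_mat N (j, q) * (\<Sum>i<l. vec_index ((N ^\<^sub>m i) *\<^sub>v F i) q))"
    using index_mult_mat_vec_sum[OF N nilpotent_sum_carrier[OF N F] \<open>j < m\<close>]
      nilpotent_sum_index[OF N F] by (simp del: index_mult_mat_vec)
  also have "\<dots> = (\<Sum>i<l. \<Sum>q<m. index_mat N (j, q) * vec_index ((N ^\<^sub>m i) *\<^sub>v F i) q)"
    unfolding sum_distrib_left by (rule sum.swap)
  also have "\<dots> = (\<Sum>i<l. vec_index ((N ^\<^sub>m Suc i) *\<^sub>v F i) j)"
  proof (rule sum.cong[OF refl])
    fix i assume "i \<in> {..<l}"
    then have i: "i < l" by simp
    have "(N ^\<^sub>m Suc i) *\<^sub>v F i = N *\<^sub>v (N ^\<^sub>m i *\<^sub>v F i)"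
      unfolding pow_mat_Suc_left[OF N] using F i by (intro assoc_mult_mat_vec[OF N pow]) auto
    then show "(\<Sum>q<m. index_mat N (j, q) * vec_index ((N ^\<^sub>m i) *\<^sub>v F i) q)
        = vec_index ((N ^\<^sub>m Suc i) *\<^sub>v F i) j"
      using index_mult_mat_vec_sum[OF N NF[OF i] \<open>j < m\<close>] by simp
  qed
  finally show ?thesis .
qed

text \<open>
  Horner's rule. For \<open>z = - nilpotent_sum N l F\<close> with \<open>F i\<close> the \<open>i\<close>-th derivative of the forcing it reads
  \<open>z + F 0 = N z'\<close>, the fast equation, up to a term that \<open>N ^\<^sub>m l = 0\<close> removes.
\<close>

lemma nilpotent_sum_Suc:
  assumes N: "N \<in> carrier_mat m m" and F: "\<forall>i<Suc p. F i \<in> carrier_vec m"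
  shows "nilpotent_sum N (Suc p) F = F 0 + N *\<^sub>v nilpotent_sum N p (\<lambda>i. F (Suc i))"
proof (rule eq_vecI)
  have F': "\<forall>i<p. F (Suc i) \<in> carrier_vec m" and F0: "F 0 \<in> carrier_vec m" using F by auto
  show "dim_vec (nilpotent_sum N (Suc p) F) = dim_vec (F 0 + N *\<^sub>v nilpotent_sum N p (\<lambda>i. F (Suc i)))"
    using nilpotent_sum_carrier[OF N F] N by simp
  fix j assume "j < dim_vec (F 0 + N *\<^sub>v nilpotent_sum N p (\<lambda>i. F (Suc i)))"
  then have j: "j < m" using N by simp
  have "vec_index (nilpotent_sum N (Suc p) F) j
      = vec_index ((N ^\<^sub>m 0) *\<^sub>v F 0) j + (\<Sum>i<p. vec_index ((N ^\<^sub>m Suc i) *\<^sub>v F (Suc i)) j)"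
    unfolding nilpotent_sum_index[OF N F j] by (rule sum.lessThan_Suc_shift)
  also have "\<dots> = vec_index (F 0) j + vec_index (N *\<^sub>v nilpotent_sum N p (\<lambda>i. F (Suc i))) j"
    unfolding mult_nilpotent_sum_index[OF N F' j] using N F0 by simp
  finally show "vec_index (nilpotent_sum N (Suc p) F) j
      = vec_index (F 0 + N *\<^sub>v nilpotent_sum N p (\<lambda>i. F (Suc i))) j"
    using N j by simp
qed

text \<open>
  Multiplication by \<open>N\<close> kills the term with the highest derivative. This is why \<open>N z\<close> is
  differentiable although \<open>z\<close> itself uses up all the derivatives that the forcing has.
\<close>

lemma mult_nilpotent_sum_drop_last:
  assumes N: "N \<in> carrier_mat m m" and F: "\<forall>i<Suc p. F i \<in> carrier_vec m"
    and nil: "N ^\<^sub>m Suc p = 0\<^sub>m m m" and "j < m"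
  shows "vec_index (N *\<^sub>v nilpotent_sum N (Suc p) F) j = (\<Sum>i<p. vec_index ((N ^\<^sub>m Suc i) *\<^sub>v F i) j)"
proof -
  have "vec_index ((N ^\<^sub>m Suc p) *\<^sub>v F p) j = 0"
    unfolding nil using F \<open>j < m\<close> by (subst zero_mat_mult_vec) auto
  then show ?thesis
    unfolding mult_nilpotent_sum_index[OF N F \<open>j < m\<close>] by simp
qed

text \<open>
  The zeroth power is the identity matrix, which vanishes only in dimension \<open>0\<close>.
\<close>

lemma nilpotency_exponent_zero:
  fixes N :: "real Matrix.mat"
  assumes "N \<in> carrier_mat m m" "N ^\<^sub>m 0 = 0\<^sub>m m m"
  shows "m = 0"
proof (rule ccontr)
  assume "m \<noteq> 0"
  then have "index_mat (1\<^sub>m m :: real Matrix.mat) (0, 0) \<noteq> index_mat (0\<^sub>m m m) (0, 0)" by simp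
  then show False using assms by simp
qed

lemma nilpotency_exponent_le_1:
  fixes N :: "real Matrix.mat"
  assumes N: "N \<in> carrier_mat m m" and nil: "N ^\<^sub>m l = 0\<^sub>m m m" and "l \<le> 1"
  shows "N = 0\<^sub>m m m"
proof (cases "l = 0")
  case True
  then have "m = 0" using nilpotency_exponent_zero[OF N] nil by simp
  then show ?thesis using N by (intro eq_matI) auto
next
  case False
  then have "N ^\<^sub>m 1 = 0\<^sub>m m m" using nil \<open>l \<le> 1\<close> by (cases l) auto
  then show ?thesis using N by simp
qed

lemma nilpotent_sum_one:
  assumes N: "N \<in> carrier_mat m m" and F: "F 0 \<in> carrier_vec m"
  shows "nilpotent_sum N 1 F = F 0"
proof (rule eq_vecI)
  have F': "\<forall>i<1. F i \<in> carrier_vec m" using F by simp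
  show "dim_vec (nilpotent_sum N 1 F) = dim_vec (F 0)"
    using nilpotent_sum_carrier[OF N F'] F by simp
  fix j assume "j < dim_vec (F 0)"
  then show "vec_index (nilpotent_sum N 1 F) j = vec_index (F 0) j"
    using nilpotent_sum_index[OF N F', of j] N F by simp
qed

text \<open>
  The Neumann series of \<open>N z' = z + g\<close>: solving for \<open>z = - g + N z'\<close> and substituting repeatedly gives
  \<open>z = - (g + N g' + N\<^sup>2 g'' + \<dots>)\<close>, and the series stops because \<open>N ^\<^sub>m l = 0\<close>. Only \<open>N z0\<close> enters, because the
  integral equation does not see the components of the initial state that \<open>N\<close> annihilates.
\<close>

lemma fast_state_solution:
  assumes N: "N \<in> carrier_mat m m" and nil: "N ^\<^sub>m l = 0\<^sub>m m m"
    and g: "\<forall>t\<ge>0. g t \<in> carrier_vec m"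
    and G: "\<forall>t\<ge>0. \<forall>i<l. G t i \<in> carrier_vec m" and G0: "\<forall>t\<ge>0. 0 < l \<longrightarrow> G t 0 = g t"
    and D: "\<And>i j t. Suc i < l \<Longrightarrow> j < m \<Longrightarrow> t \<ge> 0 \<Longrightarrow>
      ((\<lambda>t. vec_index (G t i) j) has_real_derivative vec_index (G t (Suc i)) j) (at t within {0..})"
    and z0: "N *\<^sub>v z0 = N *\<^sub>v (- nilpotent_sum N l (G 0))"
  shows "dae_solution m N (1\<^sub>m m) g z0 (\<lambda>t. - nilpotent_sum N l (G t))"
proof (cases l)
  case 0
  then have m: "m = 0" using nilpotency_exponent_zero[OF N] nil by simp
  have S: "nilpotent_sum N l (G t) \<in> carrier_vec 0" if "t \<ge> 0" for t
    using nilpotent_sum_carrier[OF N] G that m by simp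
  have empty: "v \<in> carrier_vec 0 \<Longrightarrow> v = 0\<^sub>v 0" for v :: "real Matrix.vec" by (intro eq_vecI) auto
  show ?thesis
    unfolding dae_solution_iff m
  proof (intro conjI allI impI)
    fix t :: real assume t: "t \<ge> 0"
    show "- nilpotent_sum N l (G t) \<in> carrier_vec 0" using S[OF t] by simp
    have "N *\<^sub>v 0\<^sub>v 0 = 0\<^sub>v 0" using N m by (intro eq_vecI) auto
    moreover have "1\<^sub>m 0 *\<^sub>v - nilpotent_sum N l (G t) + g t = 0\<^sub>v 0"
      using carrier_vecD[OF g[rule_format, OF t]] m by (intro empty carrier_vecI) simp
    ultimately show "\<exists>w\<in>carrier_vec 0. N *\<^sub>v w = 1\<^sub>m 0 *\<^sub>v - nilpotent_sum N l (G t) + g t"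
      by (intro bexI[of _ "0\<^sub>v 0"]) auto
    show "has_vec_integral (\<lambda>\<tau>. 1\<^sub>m 0 *\<^sub>v - nilpotent_sum N l (G \<tau>) + g \<tau>)
        (N *\<^sub>v - nilpotent_sum N l (G t) - N *\<^sub>v z0) {0..t}"
      using N m by (simp add: has_vec_integral_def)
  qed
next
  case (Suc p)
  define S where "S t = nilpotent_sum N l (G t)" for t
  define S' where "S' t = nilpotent_sum N p (\<lambda>i. G t (Suc i))" for t
  have Gl: "\<forall>i<Suc p. G t i \<in> carrier_vec m" and Gs: "\<forall>i<p. G t (Suc i) \<in> carrier_vec m"
    if "t \<ge> 0" for t
    using G that Suc by auto
  have Sc: "S t \<in> carrier_vec m" and S'c: "S' t \<in> carrier_vec m" if "t \<ge> 0" for t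
    using nilpotent_sum_carrier[OF N Gl[OF that]] nilpotent_sum_carrier[OF N Gs[OF that]] Suc
    by (auto simp: S_def S'_def)
  have alg: "1\<^sub>m m *\<^sub>v - S t + g t = N *\<^sub>v (- S' t)" if t: "t \<ge> 0" for t
  proof -
    have "S t = g t + N *\<^sub>v S' t"
      using nilpotent_sum_Suc[OF N Gl[OF t]] G0 t Suc by (simp add: S_def S'_def)
    moreover have "1\<^sub>m m *\<^sub>v - S t = - S t" using Sc[OF t] by simp
    moreover have "N *\<^sub>v (- S' t) = - (N *\<^sub>v S' t)"
      using N S'c[OF t] by (intro eq_vecI) auto
    ultimately show ?thesis using g t N by (intro eq_vecI) auto
  qed
  have int: "has_vec_integral (\<lambda>\<tau>. 1\<^sub>m m *\<^sub>v - S \<tau> + g \<tau>) (N *\<^sub>v - S t - N *\<^sub>v z0) {0..t}"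
    if t: "t \<ge> 0" for t
    unfolding has_vec_integral_def
  proof (intro allI impI)
    fix j assume "j < dim_vec (N *\<^sub>v - S t - N *\<^sub>v z0)"
    then have j: "j < m" using N by simp
    have NS: "vec_index (N *\<^sub>v - S s) j = - (\<Sum>i<p. vec_index ((N ^\<^sub>m Suc i) *\<^sub>v G s i) j)" if "s \<ge> 0" for s
      using mult_nilpotent_sum_drop_last[OF N Gl[OF that] nil[unfolded Suc] j] Sc[OF that] N j Suc
      by (simp add: S_def)
    have NS': "vec_index (N *\<^sub>v - S' s) j = - (\<Sum>i<p. vec_index ((N ^\<^sub>m Suc i) *\<^sub>v G s (Suc i)) j)"
      if "s \<ge> 0" for s
      using mult_nilpotent_sum_index[OF N Gs[OF that] j] S'c[OF that] N j by (simp add: S'_def)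
    have pow: "N ^\<^sub>m i \<in> carrier_mat m m" for i using N by simp
    have "((\<lambda>s. vec_index (N *\<^sub>v - S s) j) has_real_derivative vec_index (N *\<^sub>v - S' s) j) (at s within {0..t})"
      if s: "s \<in> {0..t}" for s
    proof -
      have "((\<lambda>s. vec_index ((N ^\<^sub>m Suc i) *\<^sub>v G s i) j) has_real_derivative
          vec_index ((N ^\<^sub>m Suc i) *\<^sub>v G s (Suc i)) j) (at s within {0..t})" if i: "i < p" for i
      proof -
        have idx: "vec_index ((N ^\<^sub>m Suc i) *\<^sub>v G r k) j = (\<Sum>q<m. index_mat (N ^\<^sub>m Suc i) (j, q) * vec_index (G r k) q)"
          if "r \<in> {0..t}" "k < Suc p" for r k
          using Gl that by (intro index_mult_mat_vec_sum[OF pow _ j]) auto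
        have D_sum: "((\<lambda>s. \<Sum>q<m. index_mat (N ^\<^sub>m Suc i) (j, q) * vec_index (G s i) q) has_real_derivative
            (\<Sum>q<m. index_mat (N ^\<^sub>m Suc i) (j, q) * vec_index (G s (Suc i)) q)) (at s within {0..t})"
          using i s Suc by (intro DERIV_sum DERIV_cmult DERIV_subset[OF D]) auto
        have "vec_index ((N ^\<^sub>m Suc i) *\<^sub>v G s (Suc i)) j
            = (\<Sum>q<m. index_mat (N ^\<^sub>m Suc i) (j, q) * vec_index (G s (Suc i)) q)"
          by (rule idx[OF s]) (use i in simp)
        moreover have "((\<lambda>s. vec_index ((N ^\<^sub>m Suc i) *\<^sub>v G s i) j) has_real_derivative
            (\<Sum>q<m. index_mat (N ^\<^sub>m Suc i) (j, q) * vec_index (G s (Suc i)) q)) (at s within {0..t})"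
          by (rule has_real_derivative_cong_on[OF s D_sum], rule idx) (use i in simp_all)
        ultimately show ?thesis by (simp only:)
      qed
      then have "((\<lambda>s. - (\<Sum>i<p. vec_index ((N ^\<^sub>m Suc i) *\<^sub>v G s i) j)) has_real_derivative
          - (\<Sum>i<p. vec_index ((N ^\<^sub>m Suc i) *\<^sub>v G s (Suc i)) j)) (at s within {0..t})"
        by (intro DERIV_minus DERIV_sum) auto
      then show ?thesis
        unfolding NS'[of s, OF atLeastAtMost_iff[THEN iffD1, OF s, THEN conjunct1]]
        by (rule has_real_derivative_cong_on[OF s]) (use NS in auto)
    qed
    then have "((\<lambda>s. vec_index (N *\<^sub>v - S' s) j) has_integral
        vec_index (N *\<^sub>v - S t) j - vec_index (N *\<^sub>v - S 0) j) {0..t}"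
      using t by (intro fundamental_theorem_of_calculus)
        (auto simp flip: has_real_derivative_iff_has_vector_derivative)
    moreover have "vec_index (N *\<^sub>v - S t - N *\<^sub>v z0) j = vec_index (N *\<^sub>v - S t) j - vec_index (N *\<^sub>v - S 0) j"
      using z0 N j by (simp add: S_def)
    ultimately have "((\<lambda>s. vec_index (N *\<^sub>v - S' s) j) has_integral vec_index (N *\<^sub>v - S t - N *\<^sub>v z0) j) {0..t}"
      by (simp only:)
    then show "((\<lambda>\<tau>. vec_index (1\<^sub>m m *\<^sub>v - S \<tau> + g \<tau>) j) has_integral
        vec_index (N *\<^sub>v - S t - N *\<^sub>v z0) j) {0..t}"
      by (rule has_integral_eq[rotated]) (simp only: alg atLeastAtMost_iff)
  qed
  \<comment> \<open>The witness is the formal derivative of \<open>- S\<close> without its last term, whose coefficient \<open>N ^\<^sub>m p\<close> is annihilated by \<open>N\<close>.\<close>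
  have "\<exists>w\<in>carrier_vec m. N *\<^sub>v w = 1\<^sub>m m *\<^sub>v - S t + g t" if "t \<ge> 0" for t
    using alg[OF that] S'c[OF that] by (intro bexI[of _ "- S' t"]) auto
  moreover have "- S t \<in> carrier_vec m" if "t \<ge> 0" for t
    using Sc[OF that] by simp
  ultimately show ?thesis
    unfolding dae_solution_iff using int unfolding S_def by blast
qed

lemma algebraic_state_solution:
  assumes N: "N \<in> carrier_mat m m" and N0: "N = 0\<^sub>m m m" and z0: "z0 \<in> carrier_vec m"
    and f: "\<forall>t\<ge>0. f t \<in> carrier_vec m"
  shows "dae_solution m N (1\<^sub>m m) f z0 (\<lambda>t. - f t)"
proof -
  have S: "nilpotent_sum N 1 (\<lambda>_. f t) = f t" if "t \<ge> 0" for t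
    using f that by (intro nilpotent_sum_one[OF N]) simp
  have "dae_solution m N (1\<^sub>m m) f z0 (\<lambda>t. - nilpotent_sum N 1 (\<lambda>_. f t))"
  proof (rule fast_state_solution[OF N _ f])
    show "N *\<^sub>v z0 = N *\<^sub>v (- nilpotent_sum N 1 (\<lambda>_. f 0))"
      using f z0 S[of 0] by (simp add: N0 zero_mat_mult_vec)
  qed (use f N N0 in auto)
  then show ?thesis by (rule dae_solution_cong[THEN iffD1, rotated 2]) (use S in auto)
qed

text \<open>
  The integrand is the derivative of its indefinite integral. The interval is extended to \<open>t + 1\<close> so that this
  also makes sense at \<open>t = 0\<close>.
\<close>

lemma zero_if_indefinite_integral_zero:
  fixes \<phi> :: "real \<Rightarrow> real"
  assumes cont: "continuous_on {0..} \<phi>" and int: "\<And>t. t \<ge> 0 \<Longrightarrow> (\<phi> has_integral 0) {0..t}" and "t \<ge> 0"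
  shows "\<phi> t = 0"
proof -
  have t: "t \<in> {0..t + 1}" using \<open>t \<ge> 0\<close> by simp
  have "((\<lambda>s. integral {0..s} \<phi>) has_vector_derivative \<phi> t) (at t within {0..t + 1})"
    using cont by (intro integral_has_vector_derivative t) (auto intro: continuous_on_subset)
  moreover have "((\<lambda>s. integral {0..s} \<phi>) has_vector_derivative 0) (at t within {0..t + 1})"
    by (rule has_vector_derivative_transform[OF t _ has_vector_derivative_const[of 0]])
      (use int in \<open>auto intro: integral_unique\<close>)
  ultimately show ?thesis
    using \<open>t \<ge> 0\<close> by (intro vector_derivative_unique_within_closed_interval[of 0 "t + 1" t]) auto
qed

lemma vec_continuous_on_mult_mat:
  assumes T: "T \<in> carrier_mat k m" and f: "\<And>t. t \<in> S \<Longrightarrow> f t \<in> carrier_vec m"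
    and cont: "vec_continuous_on m S f"
  shows "vec_continuous_on k S (\<lambda>t. T *\<^sub>v f t)"
  unfolding vec_continuous_on_def
proof (intro allI impI)
  fix j assume j: "j < k"
  have "continuous_on S (\<lambda>t. \<Sum>q<m. index_mat T (j, q) * vec_index (f t) q)"
    using cont unfolding vec_continuous_on_def by (intro continuous_intros) auto
  then show "continuous_on S (\<lambda>t. vec_index (T *\<^sub>v f t) j)"
    using index_mult_mat_vec_sum[OF T f j] by (subst continuous_on_cong[OF refl]) auto
qed

text \<open>
  The integral equation says that the integral of \<open>e\<close> over \<open>{0..t}\<close> is \<open>N *\<^sub>v e t\<close>. Apply \<open>N ^\<^sub>m p\<close>: if \<open>N ^\<^sub>m Suc p\<close>
  annihilates \<open>e\<close>, then \<open>N ^\<^sub>m p *\<^sub>v e\<close> has integral \<open>0\<close> over every \<open>{0..t}\<close> and vanishes by continuity. Starting at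
  \<open>N ^\<^sub>m l = 0\<close>, the exponent descends to \<open>0\<close>. When \<open>N = 0\<close> the equation is algebraic and
  gives \<open>e t = 0\<close> pointwise; this alternative serves trajectories that are not continuous.
\<close>

lemma homogeneous_nilpotent_zero:
  assumes N: "N \<in> carrier_mat m m" and nil: "N ^\<^sub>m l = 0\<^sub>m m m"
    and sol: "dae_solution m N (1\<^sub>m m) (\<lambda>_. 0\<^sub>v m) (0\<^sub>v m) e"
    and regular: "N = 0\<^sub>m m m \<or> vec_continuous_on m {0..} e" and "t \<ge> 0"
  shows "e t = 0\<^sub>v m"
  using regular
proof
  assume "N = 0\<^sub>m m m"
  moreover obtain w where "w \<in> carrier_vec m" "N *\<^sub>v w = 1\<^sub>m m *\<^sub>v e t + 0\<^sub>v m"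
    using dae_solutionD(2)[OF sol \<open>t \<ge> 0\<close>] by blast
  ultimately have "0\<^sub>v m = 1\<^sub>m m *\<^sub>v e t + 0\<^sub>v m" using zero_mat_mult_vec by metis
  then show ?thesis using dae_solutionD(1)[OF sol \<open>t \<ge> 0\<close>] by simp
next
  assume cont: "vec_continuous_on m {0..} e"
  have e: "e s \<in> carrier_vec m" if "s \<ge> 0" for s using dae_solutionD(1)[OF sol that] .
  have pow: "N ^\<^sub>m k \<in> carrier_mat m m" for k using N by simp
  have int: "has_vec_integral e (N *\<^sub>v e s) {0..s}" if s: "s \<ge> 0" for s
  proof -
    have "N *\<^sub>v e s - N *\<^sub>v 0\<^sub>v m = N *\<^sub>v e s" using N by (intro eq_vecI) auto
    then show ?thesis
      using dae_solutionD(3)[OF sol s] e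
        has_vec_integral_cong[of "{0..s}" e "\<lambda>\<tau>. 1\<^sub>m m *\<^sub>v e \<tau> + 0\<^sub>v m"] by auto
  qed
  have "\<forall>s\<ge>0. N ^\<^sub>m (l - k) *\<^sub>v e s = 0\<^sub>v m" if "k \<le> l" for k
    using that
  proof (induction k)
    case 0
    show ?case using nil zero_mat_mult_vec[OF e] by simp
  next
    case (Suc k)
    define p where "p = l - Suc k"
    have lk: "l - k = Suc p" using Suc.prems by (simp add: p_def)
    have zero: "(N ^\<^sub>m p) *\<^sub>v (N *\<^sub>v e s) = 0\<^sub>v m" if "s \<ge> 0" for s
      using Suc.IH Suc.prems that assoc_mult_mat_vec[OF pow N e[OF that], of p] by (simp add: lk)
    have "N ^\<^sub>m p *\<^sub>v e s = 0\<^sub>v m" if s: "s \<ge> 0" for s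
    proof (rule eq_vecI)
      fix j assume "j < dim_vec (0\<^sub>v m)"
      then have j: "j < m" by simp
      have "vec_index (N ^\<^sub>m p *\<^sub>v e s) j = 0"
      proof (rule zero_if_indefinite_integral_zero[OF _ _ s])
        show "continuous_on {0..} (\<lambda>s. vec_index (N ^\<^sub>m p *\<^sub>v e s) j)"
          using vec_continuous_on_mult_mat[OF pow _ cont] e j unfolding vec_continuous_on_def by auto
        show "((\<lambda>s. vec_index (N ^\<^sub>m p *\<^sub>v e s) j) has_integral 0) {0..r}" if r: "r \<ge> 0" for r
          using has_vec_integral_mult_mat[OF int[OF r] pow, of p] N e r zero[OF r] j
          unfolding has_vec_integral_def by (auto simp del: index_mult_mat_vec)
      qed
      then show "vec_index (N ^\<^sub>m p *\<^sub>v e s) j = vec_index (0\<^sub>v m) j" using j by simp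
    qed (use N in simp)
    then show ?case by (simp add: p_def)
  qed
  from this[of l, OF order_refl, THEN spec, THEN mp, OF \<open>t \<ge> 0\<close>]
  show ?thesis using N e[OF \<open>t \<ge> 0\<close>] by simp
qed

lemma fast_state_unique:
  assumes N: "N \<in> carrier_mat m m" and nil: "N ^\<^sub>m l = 0\<^sub>m m m"
    and z0: "z0 \<in> carrier_vec m" and g: "\<forall>t\<ge>0. g t \<in> carrier_vec m"
    and x: "dae_solution m N (1\<^sub>m m) g z0 x" and y: "dae_solution m N (1\<^sub>m m) g z0 y"
    and regular: "N = 0\<^sub>m m m \<or> vec_continuous_on m {0..} x \<and> vec_continuous_on m {0..} y" and "t \<ge> 0"
  shows "x t = y t"
proof -
  have xc: "x s \<in> carrier_vec m" and yc: "y s \<in> carrier_vec m" if "s \<ge> 0" for s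
    using dae_solutionD(1)[OF x that] dae_solutionD(1)[OF y that] by auto
  have "vec_continuous_on m {0..} (\<lambda>s. x s - y s)"
    if "vec_continuous_on m {0..} x" "vec_continuous_on m {0..} y"
    unfolding vec_continuous_on_def
  proof (intro allI impI)
    fix j assume j: "j < m"
    have "continuous_on {0..} (\<lambda>s. vec_index (x s) j - vec_index (y s) j)"
      using that j unfolding vec_continuous_on_def by (intro continuous_intros) auto
    then show "continuous_on {0..} (\<lambda>s. vec_index (x s - y s) j)"
      by (rule continuous_on_eq) (use yc[THEN carrier_vecD] j in auto)
  qed
  then have "x t - y t = 0\<^sub>v m"
    using regular homogeneous_nilpotent_zero[OF N nil dae_solution_difference[OF N _ z0 g x y] _ \<open>t \<ge> 0\<close>]
    by auto
  then show ?thesis using xc[OF \<open>t \<ge> 0\<close>] yc[OF \<open>t \<ge> 0\<close>]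
    by (rule eq_if_minus_zero_vec)
qed

section \<open>Change of coordinates\<close>

lemma dae_solution_mult_left:
  assumes E: "E \<in> carrier_mat n n" and A: "A \<in> carrier_mat n n" and T: "T \<in> carrier_mat n n"
    and g: "\<forall>t\<ge>0. g t \<in> carrier_vec n" and x0: "x0 \<in> carrier_vec n"
    and sol: "dae_solution n E A g x0 x"
  shows "dae_solution n (T * E) (T * A) (\<lambda>t. T *\<^sub>v g t) x0 x"
proof -
  note x = dae_solutionD(1)[OF sol]
  have Ex: "E *\<^sub>v v \<in> carrier_vec n" and Ax: "A *\<^sub>v v \<in> carrier_vec n" if "v \<in> carrier_vec n" for v
    using E A that by (auto intro: mult_mat_vec_carrier)
  have TE: "(T * E) *\<^sub>v v = T *\<^sub>v (E *\<^sub>v v)" and TA: "(T * A) *\<^sub>v v = T *\<^sub>v (A *\<^sub>v v)"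
    if "v \<in> carrier_vec n" for v
    using assoc_mult_mat_vec[OF T E that] assoc_mult_mat_vec[OF T A that] .
  have rhs: "(T * A) *\<^sub>v x t + T *\<^sub>v g t = T *\<^sub>v (A *\<^sub>v x t + g t)" if "t \<ge> 0" for t
    using g that Ax[OF x[OF that]] by (simp add: TA[OF x[OF that]] mult_add_distrib_mat_vec[OF T])
  show ?thesis
    unfolding dae_solution_iff
  proof (intro conjI allI impI)
    fix t :: real assume t: "t \<ge> 0"
    show "x t \<in> carrier_vec n" by (rule x[OF t])
    obtain w where w: "w \<in> carrier_vec n" "E *\<^sub>v w = A *\<^sub>v x t + g t"
      using dae_solutionD(2)[OF sol t] by blast
    then have "(T * E) *\<^sub>v w = (T * A) *\<^sub>v x t + T *\<^sub>v g t" by (simp only: TE rhs[OF t])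
    then show "\<exists>w\<in>carrier_vec n. (T * E) *\<^sub>v w = (T * A) *\<^sub>v x t + T *\<^sub>v g t" using w(1) by blast
    have diff: "T *\<^sub>v (E *\<^sub>v x t - E *\<^sub>v x0) = (T * E) *\<^sub>v x t - (T * E) *\<^sub>v x0"
      unfolding TE[OF x[OF t]] TE[OF x0]
      by (rule mult_minus_distrib_mat_vec[OF T Ex[OF x[OF t]] Ex[OF x0]])
    have "has_vec_integral (\<lambda>\<tau>. T *\<^sub>v (A *\<^sub>v x \<tau> + g \<tau>)) (T *\<^sub>v (E *\<^sub>v x t - E *\<^sub>v x0)) {0..t}"
      by (rule has_vec_integral_mult_mat[OF dae_solutionD(3)[OF sol t] T])
        (use Ex Ax x x0 g t in auto)
    then show "has_vec_integral (\<lambda>\<tau>. (T * A) *\<^sub>v x \<tau> + T *\<^sub>v g \<tau>) ((T * E) *\<^sub>v x t - (T * E) *\<^sub>v x0) {0..t}"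
      unfolding diff by (rule has_vec_integral_cong[THEN iffD1, rotated]) (rule rhs[symmetric], simp)
  qed
qed

text \<open>
  Applied to the inverse of \<open>P\<close>, with \<open>E * P\<close> and \<open>A * P\<close> in the place of \<open>E\<close> and \<open>A\<close>, this is its own converse.
\<close>

lemma dae_solution_change_variable:
  assumes E: "E \<in> carrier_mat n n" and A: "A \<in> carrier_mat n n" and P: "P \<in> carrier_mat n n"
    and z0: "z0 \<in> carrier_vec n" and sol: "dae_solution n (E * P) (A * P) g z0 z"
  shows "dae_solution n E A g (P *\<^sub>v z0) (\<lambda>t. P *\<^sub>v z t)"
proof -
  note z = dae_solutionD(1)[OF sol]
  have EP: "(E * P) *\<^sub>v v = E *\<^sub>v (P *\<^sub>v v)" and AP: "(A * P) *\<^sub>v v = A *\<^sub>v (P *\<^sub>v v)"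
    if "v \<in> carrier_vec n" for v
    using assoc_mult_mat_vec[OF E P that] assoc_mult_mat_vec[OF A P that] .
  have Pv: "P *\<^sub>v v \<in> carrier_vec n" if "v \<in> carrier_vec n" for v
    using P that by (rule mult_mat_vec_carrier)
  show ?thesis
    unfolding dae_solution_iff
  proof (intro conjI allI impI)
    fix t :: real assume t: "t \<ge> 0"
    show "P *\<^sub>v z t \<in> carrier_vec n" by (rule Pv[OF z[OF t]])
    obtain w where w: "w \<in> carrier_vec n" "(E * P) *\<^sub>v w = (A * P) *\<^sub>v z t + g t"
      using dae_solutionD(2)[OF sol t] by blast
    then have "E *\<^sub>v (P *\<^sub>v w) = A *\<^sub>v (P *\<^sub>v z t) + g t" by (simp only: EP AP[OF z[OF t]])
    then show "\<exists>w\<in>carrier_vec n. E *\<^sub>v w = A *\<^sub>v (P *\<^sub>v z t) + g t" using Pv[OF w(1)] by blast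
    show "has_vec_integral (\<lambda>\<tau>. A *\<^sub>v (P *\<^sub>v z \<tau>) + g \<tau>) (E *\<^sub>v (P *\<^sub>v z t) - E *\<^sub>v (P *\<^sub>v z0)) {0..t}"
      by (rule has_vec_integral_cong[THEN iffD1, OF _ dae_solutionD(3)[OF sol t, unfolded EP[OF z[OF t]] EP[OF z0]]])
        (simp add: AP z)
  qed
qed

lemma has_vec_integral_append:
  assumes "\<And>\<tau>. \<tau> \<in> S \<Longrightarrow> f \<tau> \<in> carrier_vec n1 \<and> g \<tau> \<in> carrier_vec n2"
    and v: "v \<in> carrier_vec n1" and w: "w \<in> carrier_vec n2"
  shows "has_vec_integral (\<lambda>\<tau>. f \<tau> @\<^sub>v g \<tau>) (v @\<^sub>v w) S
    \<longleftrightarrow> has_vec_integral f v S \<and> has_vec_integral g w S"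
proof -
  have dims: "dim_vec (f \<tau>) = n1" "dim_vec (g \<tau>) = n2" if "\<tau> \<in> S" for \<tau>
    using assms(1)[OF that] by auto
  have 1: "((\<lambda>\<tau>. vec_index (f \<tau> @\<^sub>v g \<tau>) j) has_integral vec_index (v @\<^sub>v w) j) S
      \<longleftrightarrow> ((\<lambda>\<tau>. vec_index (f \<tau>) j) has_integral vec_index v j) S" if "j < n1" for j
    using v w that by (subst has_integral_cong[of S _ "\<lambda>\<tau>. vec_index (f \<tau>) j"]) (auto simp: dims)
  have 2: "((\<lambda>\<tau>. vec_index (f \<tau> @\<^sub>v g \<tau>) (n1 + j)) has_integral vec_index (v @\<^sub>v w) (n1 + j)) S
      \<longleftrightarrow> ((\<lambda>\<tau>. vec_index (g \<tau>) j) has_integral vec_index w j) S" if "j < n2" for j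
    using v w that by (subst has_integral_cong[of S _ "\<lambda>\<tau>. vec_index (g \<tau>) j"]) (auto simp: dims)
  have "(\<forall>j<n1 + n2. R j) \<longleftrightarrow> (\<forall>j<n1. R j) \<and> (\<forall>j<n2. R (n1 + j))" (is "?L \<longleftrightarrow> ?R") for R
  proof
    assume R: ?R
    have "R j" if "j < n1 + n2" for j
      using R[THEN conjunct1, rule_format, of j] R[THEN conjunct2, rule_format, of "j - n1"] that
      by (cases "j < n1") auto
    then show ?L by blast
  qed auto
  then show ?thesis
    unfolding has_vec_integral_def using v w 1 2 by simp
qed

lemma vec_continuous_on_append:
  assumes "\<And>\<tau>. \<tau> \<in> S \<Longrightarrow> f \<tau> \<in> carrier_vec n1 \<and> g \<tau> \<in> carrier_vec n2"
    and "vec_continuous_on n1 S f" "vec_continuous_on n2 S g"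
  shows "vec_continuous_on (n1 + n2) S (\<lambda>\<tau>. f \<tau> @\<^sub>v g \<tau>)"
  unfolding vec_continuous_on_def
proof (intro allI impI)
  have dims: "dim_vec (f \<tau>) = n1" "dim_vec (g \<tau>) = n2" if "\<tau> \<in> S" for \<tau>
    using assms(1)[OF that] by auto
  fix j assume j: "j < n1 + n2"
  show "continuous_on S (\<lambda>\<tau>. vec_index (f \<tau> @\<^sub>v g \<tau>) j)"
  proof (cases "j < n1")
    case True
    then have "continuous_on S (\<lambda>\<tau>. vec_index (f \<tau>) j)" using assms(2) by (simp add: vec_continuous_on_def)
    then show ?thesis by (rule continuous_on_eq) (use True dims in simp)
  next
    case False
    then have "continuous_on S (\<lambda>\<tau>. vec_index (g \<tau>) (j - n1))"
      using assms(3) j by (simp add: vec_continuous_on_def)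
    then show ?thesis by (rule continuous_on_eq) (use False j dims in simp)
  qed
qed

lemma dae_solution_block_diagonal:
  assumes E1: "E1 \<in> carrier_mat n1 n1" and A1: "A1 \<in> carrier_mat n1 n1"
    and E2: "E2 \<in> carrier_mat n2 n2" and A2: "A2 \<in> carrier_mat n2 n2"
    and z: "\<forall>t\<ge>0. z1 t \<in> carrier_vec n1 \<and> z2 t \<in> carrier_vec n2"
    and g: "\<forall>t\<ge>0. g1 t \<in> carrier_vec n1 \<and> g2 t \<in> carrier_vec n2"
    and z10: "z10 \<in> carrier_vec n1" and z20: "z20 \<in> carrier_vec n2"
  shows "dae_solution (n1 + n2) (four_block_mat E1 (0\<^sub>m n1 n2) (0\<^sub>m n2 n1) E2)
      (four_block_mat A1 (0\<^sub>m n1 n2) (0\<^sub>m n2 n1) A2) (\<lambda>t. g1 t @\<^sub>v g2 t) (z10 @\<^sub>v z20) (\<lambda>t. z1 t @\<^sub>v z2 t)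
    \<longleftrightarrow> dae_solution n1 E1 A1 g1 z10 z1 \<and> dae_solution n2 E2 A2 g2 z20 z2"
    (is "dae_solution _ ?E ?A ?g ?init ?z \<longleftrightarrow> _")
proof -
  have Ev: "?E *\<^sub>v (a @\<^sub>v b) = (E1 *\<^sub>v a) @\<^sub>v (E2 *\<^sub>v b)"
    if "a \<in> carrier_vec n1" "b \<in> carrier_vec n2" for a b
    using mult_mat_vec_split[OF E1 E2 that] .
  have rhs: "?A *\<^sub>v ?z t + ?g t = (A1 *\<^sub>v z1 t + g1 t) @\<^sub>v (A2 *\<^sub>v z2 t + g2 t)" if "t \<ge> 0" for t
    using mult_mat_vec_split[OF A1 A2, of "z1 t" "z2 t"] z g that A1 A2
    by (subst append_vec_add[symmetric, of _ n1 _ _ n2]) auto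
  have diff: "?E *\<^sub>v ?z t - ?E *\<^sub>v ?init = (E1 *\<^sub>v z1 t - E1 *\<^sub>v z10) @\<^sub>v (E2 *\<^sub>v z2 t - E2 *\<^sub>v z20)" if "t \<ge> 0" for t
    using z that E1 E2 by (simp add: Ev z10 z20) (intro eq_vecI, auto)
  have int: "has_vec_integral (\<lambda>\<tau>. ?A *\<^sub>v ?z \<tau> + ?g \<tau>) (?E *\<^sub>v ?z t - ?E *\<^sub>v ?init) {0..t} \<longleftrightarrow>
      has_vec_integral (\<lambda>\<tau>. A1 *\<^sub>v z1 \<tau> + g1 \<tau>) (E1 *\<^sub>v z1 t - E1 *\<^sub>v z10) {0..t} \<and>
      has_vec_integral (\<lambda>\<tau>. A2 *\<^sub>v z2 \<tau> + g2 \<tau>) (E2 *\<^sub>v z2 t - E2 *\<^sub>v z20) {0..t}" if t: "t \<ge> 0" for t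
  proof -
    have "has_vec_integral (\<lambda>\<tau>. ?A *\<^sub>v ?z \<tau> + ?g \<tau>) (?E *\<^sub>v ?z t - ?E *\<^sub>v ?init) {0..t} \<longleftrightarrow>
        has_vec_integral (\<lambda>\<tau>. (A1 *\<^sub>v z1 \<tau> + g1 \<tau>) @\<^sub>v (A2 *\<^sub>v z2 \<tau> + g2 \<tau>))
          ((E1 *\<^sub>v z1 t - E1 *\<^sub>v z10) @\<^sub>v (E2 *\<^sub>v z2 t - E2 *\<^sub>v z20)) {0..t}"
      unfolding diff[OF t] by (rule has_vec_integral_cong) (rule rhs, simp)
    also have "\<dots> \<longleftrightarrow> has_vec_integral (\<lambda>\<tau>. A1 *\<^sub>v z1 \<tau> + g1 \<tau>) (E1 *\<^sub>v z1 t - E1 *\<^sub>v z10) {0..t} \<and>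
        has_vec_integral (\<lambda>\<tau>. A2 *\<^sub>v z2 \<tau> + g2 \<tau>) (E2 *\<^sub>v z2 t - E2 *\<^sub>v z20) {0..t}"
    proof (rule has_vec_integral_append)
      show "A1 *\<^sub>v z1 \<tau> + g1 \<tau> \<in> carrier_vec n1 \<and> A2 *\<^sub>v z2 \<tau> + g2 \<tau> \<in> carrier_vec n2"
        if "\<tau> \<in> {0..t}" for \<tau>
        using g that by (auto intro!: carrier_vecI)
    qed (use E1 E2 in \<open>auto intro!: carrier_vecI\<close>)
    finally show ?thesis .
  qed
  have range: "(\<exists>w\<in>carrier_vec (n1 + n2). ?E *\<^sub>v w = ?A *\<^sub>v ?z t + ?g t) \<longleftrightarrow>
      (\<exists>w\<in>carrier_vec n1. E1 *\<^sub>v w = A1 *\<^sub>v z1 t + g1 t) \<and>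
      (\<exists>w\<in>carrier_vec n2. E2 *\<^sub>v w = A2 *\<^sub>v z2 t + g2 t)" if t: "t \<ge> 0" for t
  proof -
    have split: "?E *\<^sub>v (a @\<^sub>v b) = ?A *\<^sub>v ?z t + ?g t \<longleftrightarrow>
        E1 *\<^sub>v a = A1 *\<^sub>v z1 t + g1 t \<and> E2 *\<^sub>v b = A2 *\<^sub>v z2 t + g2 t"
      if "a \<in> carrier_vec n1" "b \<in> carrier_vec n2" for a b
      unfolding Ev[OF that] rhs[OF t]
      by (rule append_vec_eq[of _ n1]) (use E1 g t in \<open>auto intro!: carrier_vecI\<close>)
    show ?thesis
    proof
      assume "\<exists>w\<in>carrier_vec (n1 + n2). ?E *\<^sub>v w = ?A *\<^sub>v ?z t + ?g t"
      then obtain w where w: "w \<in> carrier_vec (n1 + n2)" "?E *\<^sub>v w = ?A *\<^sub>v ?z t + ?g t" by blast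
      moreover have "w = vec_first w n1 @\<^sub>v vec_last w n2" using w by simp
      ultimately show "(\<exists>w\<in>carrier_vec n1. E1 *\<^sub>v w = A1 *\<^sub>v z1 t + g1 t) \<and>
          (\<exists>w\<in>carrier_vec n2. E2 *\<^sub>v w = A2 *\<^sub>v z2 t + g2 t)"
        using split[of "vec_first w n1" "vec_last w n2"] by (metis vec_first_carrier vec_last_carrier)
    next
      assume "(\<exists>w\<in>carrier_vec n1. E1 *\<^sub>v w = A1 *\<^sub>v z1 t + g1 t) \<and>
          (\<exists>w\<in>carrier_vec n2. E2 *\<^sub>v w = A2 *\<^sub>v z2 t + g2 t)"
      then show "\<exists>w\<in>carrier_vec (n1 + n2). ?E *\<^sub>v w = ?A *\<^sub>v ?z t + ?g t"
        using split by (metis append_carrier_vec)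
    qed
  qed
  show ?thesis
  proof
    assume sol: "dae_solution (n1 + n2) ?E ?A ?g ?init ?z"
    have "z1 t \<in> carrier_vec n1 \<and> z2 t \<in> carrier_vec n2" if "t \<ge> 0" for t using z that by blast
    moreover note range[THEN iffD1, OF _ dae_solutionD(2)[OF sol]] int[THEN iffD1, OF _ dae_solutionD(3)[OF sol]]
    ultimately show "dae_solution n1 E1 A1 g1 z10 z1 \<and> dae_solution n2 E2 A2 g2 z20 z2"
      unfolding dae_solution_iff by blast
  next
    assume sol: "dae_solution n1 E1 A1 g1 z10 z1 \<and> dae_solution n2 E2 A2 g2 z20 z2"
    note sol1 = conjunct1[OF sol] and sol2 = conjunct2[OF sol]
    show "dae_solution (n1 + n2) ?E ?A ?g ?init ?z"
      unfolding dae_solution_iff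
    proof (intro conjI allI impI)
      fix t :: real assume t: "t \<ge> 0"
      show "?z t \<in> carrier_vec (n1 + n2)" using z t by simp
      show "\<exists>w\<in>carrier_vec (n1 + n2). ?E *\<^sub>v w = ?A *\<^sub>v ?z t + ?g t"
        by (rule range[OF t, THEN iffD2, OF conjI[OF dae_solutionD(2)[OF sol1 t] dae_solutionD(2)[OF sol2 t]]])
      show "has_vec_integral (\<lambda>\<tau>. ?A *\<^sub>v ?z \<tau> + ?g \<tau>) (?E *\<^sub>v ?z t - ?E *\<^sub>v ?init) {0..t}"
        by (rule int[OF t, THEN iffD2, OF conjI[OF dae_solutionD(3)[OF sol1 t] dae_solutionD(3)[OF sol2 t]]])
    qed
  qed
qed



section \<open>The Weierstrass form decouples the system\<close>

lemma invertible_mat_obtain_inverse: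
  fixes P :: "real Matrix.mat"
  assumes "invertible_mat P" and P: "P \<in> carrier_mat n n"
  obtains R where "R \<in> carrier_mat n n" "P * R = 1\<^sub>m n" "R * P = 1\<^sub>m n"
proof -
  obtain R where R: "P * R = 1\<^sub>m n" "R * P = 1\<^sub>m (dim_row R)"
    using assms unfolding invertible_mat_def inverts_mat_def by auto
  have "dim_col R = n" using arg_cong[OF R(1), of dim_col] by simp
  moreover have "dim_row R = n" using arg_cong[OF R(2), of dim_col] P by simp
  ultimately show thesis using that[of R] R by auto
qed

lemma weierstrass_formD:
  assumes "weierstrass_form n n1 n2 l E A P Q W N"
  shows "n = n1 + n2" "P \<in> carrier_mat n n" "invertible_mat P" "Q \<in> carrier_mat n n" "invertible_mat Q"
    "W \<in> carrier_mat n1 n1" "N \<in> carrier_mat n2 n2"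
    "Q * E * P = four_block_mat (1\<^sub>m n1) (0\<^sub>m n1 n2) (0\<^sub>m n2 n1) N"
    "Q * A * P = four_block_mat W (0\<^sub>m n1 n2) (0\<^sub>m n2 n1) (1\<^sub>m n2)"
    "N ^\<^sub>m l = 0\<^sub>m n2 n2"
  using assms unfolding weierstrass_form_def nilpotency_index_def by auto

text \<open>
  Multiplying the equation by \<open>Q\<close> and substituting \<open>x = P z\<close> are reversible since both matrices are invertible, and
  the resulting pencil is block diagonal.
\<close>

lemma decoupled_solution_iff:
  assumes E: "E \<in> carrier_mat n n" and A: "A \<in> carrier_mat n n"
    and form: "weierstrass_form n n1 n2 l E A P Q W N"
    and g: "\<forall>t\<ge>0. g t \<in> carrier_vec n"
    and f: "\<forall>t\<ge>0. Q *\<^sub>v g t = f1 t @\<^sub>v f2 t \<and> f1 t \<in> carrier_vec n1 \<and> f2 t \<in> carrier_vec n2"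
    and z10: "z10 \<in> carrier_vec n1" and z20: "z20 \<in> carrier_vec n2"
    and z: "\<forall>t\<ge>0. z1 t \<in> carrier_vec n1 \<and> z2 t \<in> carrier_vec n2"
  shows "dae_solution n E A g (P *\<^sub>v (z10 @\<^sub>v z20)) (\<lambda>t. P *\<^sub>v (z1 t @\<^sub>v z2 t)) \<longleftrightarrow>
    dae_solution n1 (1\<^sub>m n1) W f1 z10 z1 \<and> dae_solution n2 N (1\<^sub>m n2) f2 z20 z2"
proof -
  note D = weierstrass_formD[OF form]
  note P = D(2) and Q = D(4)
  let ?z = "\<lambda>t. z1 t @\<^sub>v z2 t" and ?init = "z10 @\<^sub>v z20"
  obtain R where R: "R \<in> carrier_mat n n" "P * R = 1\<^sub>m n" "R * P = 1\<^sub>m n"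
    using invertible_mat_obtain_inverse[OF D(3) P] .
  obtain T where T: "T \<in> carrier_mat n n" "Q * T = 1\<^sub>m n" "T * Q = 1\<^sub>m n"
    using invertible_mat_obtain_inverse[OF D(5) Q] .
  have init: "?init \<in> carrier_vec n" using z10 z20 D(1) by simp
  have zc: "?z t \<in> carrier_vec n" if "t \<ge> 0" for t using z that D(1) by auto
  have Qg: "Q *\<^sub>v g t \<in> carrier_vec n" if "t \<ge> 0" for t
    using g that by (intro mult_mat_vec_carrier[OF Q]) auto
  have QE: "Q * E \<in> carrier_mat n n" and QA: "Q * A \<in> carrier_mat n n" using Q E A by auto
  have Pinit: "P *\<^sub>v ?init \<in> carrier_vec n" using P init by (rule mult_mat_vec_carrier)
  have RP: "R *\<^sub>v (P *\<^sub>v v) = v" if "v \<in> carrier_vec n" for v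
    using assoc_mult_mat_vec[OF R(1) P that] R(3) that by simp
  have TQ: "T *\<^sub>v (Q *\<^sub>v v) = v" if "v \<in> carrier_vec n" for v
    using assoc_mult_mat_vec[OF T(1) Q that] T(3) that by simp
  have cancelR: "X * P * R = X" if "X \<in> carrier_mat n n" for X
    using assoc_mult_mat[OF that P R(1)] R(2) that by simp
  have cancelT: "T * (Q * X) = X" if "X \<in> carrier_mat n n" for X
    using assoc_mult_mat[OF T(1) Q that] T(3) that by simp
  have "dae_solution n E A g (P *\<^sub>v ?init) (\<lambda>t. P *\<^sub>v ?z t) \<longleftrightarrow>
      dae_solution n (Q * E) (Q * A) (\<lambda>t. Q *\<^sub>v g t) (P *\<^sub>v ?init) (\<lambda>t. P *\<^sub>v ?z t)"
  proof
    assume "dae_solution n E A g (P *\<^sub>v ?init) (\<lambda>t. P *\<^sub>v ?z t)"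
    from dae_solution_mult_left[OF E A Q g Pinit this]
    show "dae_solution n (Q * E) (Q * A) (\<lambda>t. Q *\<^sub>v g t) (P *\<^sub>v ?init) (\<lambda>t. P *\<^sub>v ?z t)" .
  next
    assume "dae_solution n (Q * E) (Q * A) (\<lambda>t. Q *\<^sub>v g t) (P *\<^sub>v ?init) (\<lambda>t. P *\<^sub>v ?z t)"
    from dae_solution_mult_left[OF QE QA T(1) _ Pinit this] Qg
    have "dae_solution n E A (\<lambda>t. T *\<^sub>v (Q *\<^sub>v g t)) (P *\<^sub>v ?init) (\<lambda>t. P *\<^sub>v ?z t)"
      by (simp add: cancelT E A)
    then show "dae_solution n E A g (P *\<^sub>v ?init) (\<lambda>t. P *\<^sub>v ?z t)"
      by (rule dae_solution_cong[THEN iffD1, rotated 2]) (use TQ g in auto)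
  qed
  also have "\<dots> \<longleftrightarrow> dae_solution n (Q * E * P) (Q * A * P) (\<lambda>t. Q *\<^sub>v g t) ?init ?z"
  proof
    assume "dae_solution n (Q * E) (Q * A) (\<lambda>t. Q *\<^sub>v g t) (P *\<^sub>v ?init) (\<lambda>t. P *\<^sub>v ?z t)"
    then have "dae_solution n (Q * E * P * R) (Q * A * P * R) (\<lambda>t. Q *\<^sub>v g t) (P *\<^sub>v ?init) (\<lambda>t. P *\<^sub>v ?z t)"
      by (simp only: cancelR[OF QE] cancelR[OF QA])
    from dae_solution_change_variable[OF _ _ R(1) Pinit this]
    have "dae_solution n (Q * E * P) (Q * A * P) (\<lambda>t. Q *\<^sub>v g t) ?init (\<lambda>t. R *\<^sub>v (P *\<^sub>v ?z t))"
      using QE QA P by (simp add: RP[OF init])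
    then show "dae_solution n (Q * E * P) (Q * A * P) (\<lambda>t. Q *\<^sub>v g t) ?init ?z"
      by (rule dae_solution_cong[THEN iffD1, rotated 2]) (use RP zc in auto)
  next
    assume "dae_solution n (Q * E * P) (Q * A * P) (\<lambda>t. Q *\<^sub>v g t) ?init ?z"
    then show "dae_solution n (Q * E) (Q * A) (\<lambda>t. Q *\<^sub>v g t) (P *\<^sub>v ?init) (\<lambda>t. P *\<^sub>v ?z t)"
      by (rule dae_solution_change_variable[OF QE QA P init])
  qed
  also have "\<dots> \<longleftrightarrow> dae_solution n (Q * E * P) (Q * A * P) (\<lambda>t. f1 t @\<^sub>v f2 t) ?init ?z"
    using f by (intro dae_solution_cong) auto
  also have "\<dots> \<longleftrightarrow> dae_solution n1 (1\<^sub>m n1) W f1 z10 z1 \<and> dae_solution n2 N (1\<^sub>m n2) f2 z20 z2"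
    unfolding D(8,9) unfolding D(1) using f
    by (intro dae_solution_block_diagonal[OF _ D(6) D(7) _ z _ z10 z20]) auto
  finally show ?thesis .
qed

lemma scalar_prod_block_coordinates:
  fixes P :: "real Matrix.mat"
  assumes P: "P \<in> carrier_mat (n1 + n2) (n1 + n2)" and blocks: "split_block P n1 n1 = (P11, P12, P21, P22)"
    and c: "c1 \<in> carrier_vec n1" "c2 \<in> carrier_vec n2" and a: "a \<in> carrier_vec n1" "b \<in> carrier_vec n2"
  shows "scalar_prod (c1 @\<^sub>v c2) (P *\<^sub>v (a @\<^sub>v b))
    = scalar_prod (transpose_mat P11 *\<^sub>v c1 + transpose_mat P21 *\<^sub>v c2) a
      + scalar_prod (transpose_mat P12 *\<^sub>v c1 + transpose_mat P22 *\<^sub>v c2) b"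
proof -
  note B = split_block[OF blocks, of n2 n2]
  have B1: "P11 \<in> carrier_mat n1 n1" and B2: "P12 \<in> carrier_mat n1 n2" and B3: "P21 \<in> carrier_mat n2 n1"
    and B4: "P22 \<in> carrier_mat n2 n2" and PB: "P = four_block_mat P11 P12 P21 P22"
    using B P by auto
  have Pv: "P *\<^sub>v (a @\<^sub>v b) = (P11 *\<^sub>v a + P12 *\<^sub>v b) @\<^sub>v (P21 *\<^sub>v a + P22 *\<^sub>v b)"
    unfolding PB by (rule four_block_mat_mult_vec[OF B1 B2 B3 B4 a])
  have car: "P11 *\<^sub>v a \<in> carrier_vec n1" "P12 *\<^sub>v b \<in> carrier_vec n1" "P21 *\<^sub>v a \<in> carrier_vec n2" "P22 *\<^sub>v b \<in> carrier_vec n2"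
    using B1 B2 B3 B4 a by (auto intro: mult_mat_vec_carrier)
  have carT: "transpose_mat P11 *\<^sub>v c1 \<in> carrier_vec n1" "transpose_mat P21 *\<^sub>v c2 \<in> carrier_vec n1"
    "transpose_mat P12 *\<^sub>v c1 \<in> carrier_vec n2" "transpose_mat P22 *\<^sub>v c2 \<in> carrier_vec n2"
    using B1 B2 B3 B4 c by (auto intro!: mult_mat_vec_carrier)
  have "scalar_prod (c1 @\<^sub>v c2) (P *\<^sub>v (a @\<^sub>v b))
      = scalar_prod c1 (P11 *\<^sub>v a + P12 *\<^sub>v b) + scalar_prod c2 (P21 *\<^sub>v a + P22 *\<^sub>v b)"
    unfolding Pv using c car by (intro scalar_prod_append) auto
  also have "\<dots> = scalar_prod c1 (P11 *\<^sub>v a) + scalar_prod c1 (P12 *\<^sub>v b)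
      + (scalar_prod c2 (P21 *\<^sub>v a) + scalar_prod c2 (P22 *\<^sub>v b))"
    using scalar_prod_add_distrib[OF c(1) car(1,2)] scalar_prod_add_distrib[OF c(2) car(3,4)] by simp
  finally show ?thesis
    using add_scalar_prod_distrib[OF carT(1,2) a(1)] add_scalar_prod_distrib[OF carT(3,4) a(2)]
      transpose_vec_mult_scalar[OF B1 a(1) c(1)] transpose_vec_mult_scalar[OF B2 a(2) c(1)]
      transpose_vec_mult_scalar[OF B3 a(1) c(2)] transpose_vec_mult_scalar[OF B4 a(2) c(2)] by simp
qed

text \<open>
  The output formula for an arbitrary class \<open>X\<close> of trajectories. The class has to be small enough that the fast
  part is unique (\<open>X_solution\<close>: solutions, continuous ones unless \<open>N = 0\<close>) and large
  enough to contain the trajectory built from the variation of constants formula and a given fast solution \<open>\<zeta>\<close>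
  (\<open>X_member\<close>). In \<open>X_member\<close> the premises are properties of that trajectory which a class may
  demand: continuity, inherited from \<open>\<zeta>\<close>, and the initial value \<open>P *\<^sub>v (z10 @\<^sub>v z20)\<close>, attained if \<open>\<zeta> 0 = z20\<close>.
\<close>

lemma unique_output_decoupled:
  assumes E: "E \<in> carrier_mat n n" and A: "A \<in> carrier_mat n n"
    and form: "weierstrass_form n n1 n2 l E A P Q W N"
    and blocks: "split_block P n1 n1 = (P11, P12, P21, P22)"
    and c: "c1 \<in> carrier_vec n1" "c2 \<in> carrier_vec n2"
    and g: "\<forall>t\<ge>0. g t \<in> carrier_vec n"
    and f: "\<forall>t\<ge>0. Q *\<^sub>v g t = f1 t @\<^sub>v f2 t \<and> f1 t \<in> carrier_vec n1 \<and> f2 t \<in> carrier_vec n2"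
    and f1_int: "vec_loc_integrable_from n1 0 f1"
    and z10: "z10 \<in> carrier_vec n1" and z20: "z20 \<in> carrier_vec n2"
    and fast: "dae_solution n2 N (1\<^sub>m n2) f2 z20 \<zeta>"
    and regular: "N = 0\<^sub>m n2 n2 \<or> vec_continuous_on n2 {0..} \<zeta>"
    and X_solution: "\<And>x. X x \<Longrightarrow> dae_solution n E A g (P *\<^sub>v (z10 @\<^sub>v z20)) x
        \<and> (N = 0\<^sub>m n2 n2 \<or> vec_continuous_on n {0..} x)"
    and X_member: "\<And>x. dae_solution n E A g (P *\<^sub>v (z10 @\<^sub>v z20)) x \<Longrightarrow>
        (vec_continuous_on n2 {0..} \<zeta> \<longrightarrow> vec_continuous_on n {0..} x) \<Longrightarrow>
        (\<zeta> 0 = z20 \<longrightarrow> x 0 = P *\<^sub>v (z10 @\<^sub>v z20)) \<Longrightarrow> X x"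
  shows "unique_output (c1 @\<^sub>v c2) X
    (\<lambda>t. scalar_prod (transpose_mat P11 *\<^sub>v c1 + transpose_mat P21 *\<^sub>v c2) (slow_state W z10 f1 t)
       + scalar_prod (transpose_mat P12 *\<^sub>v c1 + transpose_mat P22 *\<^sub>v c2) (\<zeta> t))"
  unfolding unique_output_def
proof (intro conjI allI impI)
  note D = weierstrass_formD[OF form]
  note P = D(2) and W = D(6) and N = D(7) and nil = D(10)
  have f1: "\<forall>t\<ge>0. f1 t \<in> carrier_vec n1" and f2: "\<forall>t\<ge>0. f2 t \<in> carrier_vec n2" using f by auto
  let ?\<sigma> = "slow_state W z10 f1"
  note slow = slow_state_solution[OF W z10 f1 f1_int]
  note slow_carrier = slow_state_carrier[OF W z10 f1 f1_int]
  have fast_carrier: "\<zeta> t \<in> carrier_vec n2" if "t \<ge> 0" for t using dae_solutionD(1)[OF fast that] .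
  show "\<exists>x. X x"
  proof
    show "X (\<lambda>t. P *\<^sub>v (?\<sigma> t @\<^sub>v \<zeta> t))"
    proof (rule X_member)
      show "dae_solution n E A g (P *\<^sub>v (z10 @\<^sub>v z20)) (\<lambda>t. P *\<^sub>v (?\<sigma> t @\<^sub>v \<zeta> t))"
        using slow fast slow_carrier fast_carrier
        by (subst decoupled_solution_iff[OF E A form g f z10 z20]) auto
      show "vec_continuous_on n2 {0..} \<zeta> \<longrightarrow> vec_continuous_on n {0..} (\<lambda>t. P *\<^sub>v (?\<sigma> t @\<^sub>v \<zeta> t))"
      proof
        assume "vec_continuous_on n2 {0..} \<zeta>"
        then have "vec_continuous_on n {0..} (\<lambda>t. ?\<sigma> t @\<^sub>v \<zeta> t)"
          unfolding D(1) using ode_solution_continuous[OF W slow z10] slow_carrier fast_carrier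
          by (intro vec_continuous_on_append) auto
        then show "vec_continuous_on n {0..} (\<lambda>t. P *\<^sub>v (?\<sigma> t @\<^sub>v \<zeta> t))"
          using slow_carrier fast_carrier D(1) by (intro vec_continuous_on_mult_mat[OF P]) auto
      qed
      show "\<zeta> 0 = z20 \<longrightarrow> P *\<^sub>v (?\<sigma> 0 @\<^sub>v \<zeta> 0) = P *\<^sub>v (z10 @\<^sub>v z20)"
        using slow_state_0[OF W z10 f1 f1_int] by simp
    qed
  qed
  fix x and t :: real
  assume "X x" and t: "t \<ge> 0"
  then have sol: "dae_solution n E A g (P *\<^sub>v (z10 @\<^sub>v z20)) x"
    and cont: "N = 0\<^sub>m n2 n2 \<or> vec_continuous_on n {0..} x"
    using X_solution by auto
  note x = dae_solutionD(1)[OF sol]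
  obtain R where R: "R \<in> carrier_mat n n" "P * R = 1\<^sub>m n" "R * P = 1\<^sub>m n"
    using invertible_mat_obtain_inverse[OF D(3) P] .
  define z where "z s = R *\<^sub>v x s" for s
  define z1 where "z1 s = vec_first (z s) n1" for s
  define z2 where "z2 s = vec_last (z s) n2" for s
  have z: "z s \<in> carrier_vec n" if "s \<ge> 0" for s
    unfolding z_def using R(1) x[OF that] by (rule mult_mat_vec_carrier)
  have split: "z s = z1 s @\<^sub>v z2 s" if "s \<ge> 0" for s
    using z[OF that] D(1) by (simp add: z1_def z2_def)
  have x_eq: "x s = P *\<^sub>v (z1 s @\<^sub>v z2 s)" if "s \<ge> 0" for s
    using assoc_mult_mat_vec[OF P R(1) x[OF that]] R(2) x[OF that] split[OF that] by (simp add: z_def)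
  have carr: "\<forall>s\<ge>0. z1 s \<in> carrier_vec n1 \<and> z2 s \<in> carrier_vec n2" by (simp add: z1_def z2_def)
  have "dae_solution n E A g (P *\<^sub>v (z10 @\<^sub>v z20)) (\<lambda>s. P *\<^sub>v (z1 s @\<^sub>v z2 s))"
    using sol by (rule dae_solution_cong[THEN iffD1, rotated 2]) (use x_eq in auto)
  then have z1_sol: "dae_solution n1 (1\<^sub>m n1) W f1 z10 z1" and z2_sol: "dae_solution n2 N (1\<^sub>m n2) f2 z20 z2"
    using decoupled_solution_iff[OF E A form g f z10 z20 carr] by auto
  have "vec_continuous_on n2 {0..} z2" if "vec_continuous_on n {0..} x"
    unfolding vec_continuous_on_def
  proof (intro allI impI)
    fix j assume j: "j < n2"
    have "vec_continuous_on n {0..} z"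
      unfolding z_def by (rule vec_continuous_on_mult_mat[OF R(1) _ that]) (use x in auto)
    then have "continuous_on {0..} (\<lambda>s. vec_index (z s) (n1 + j))"
      using j D(1) by (simp add: vec_continuous_on_def)
    then show "continuous_on {0..} (\<lambda>s. vec_index (z2 s) j)"
      by (rule continuous_on_eq) (use split carr j in auto)
  qed
  then have "z2 t = \<zeta> t"
    using cont regular by (intro fast_state_unique[OF N nil z20 f2 z2_sol fast _ t]) auto
  moreover have "z1 t = ?\<sigma> t" by (rule slow_state_unique[OF W z10 f1 f1_int z1_sol t])
  ultimately have "x t = P *\<^sub>v (?\<sigma> t @\<^sub>v \<zeta> t)" using x_eq[OF t] by simp
  then show "scalar_prod (c1 @\<^sub>v c2) (x t)
      = scalar_prod (transpose_mat P11 *\<^sub>v c1 + transpose_mat P21 *\<^sub>v c2) (?\<sigma> t)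
        + scalar_prod (transpose_mat P12 *\<^sub>v c1 + transpose_mat P22 *\<^sub>v c2) (\<zeta> t)"
    using scalar_prod_block_coordinates[OF _ blocks c slow_carrier fast_carrier[OF t]] P D(1) by simp
qed



section \<open>Delayed forcing\<close>

lemma slow_state_cong:
  assumes "\<And>\<tau>. \<tau> \<in> {0..t} \<Longrightarrow> f \<tau> = g \<tau>"
  shows "slow_state W z f t = slow_state W z g t"
proof -
  have "vec_integral (dim_row W) {0..t} (\<lambda>\<tau>. mat_exp ((- \<tau>) \<cdot>\<^sub>m W) *\<^sub>v f \<tau>)
      = vec_integral (dim_row W) {0..t} (\<lambda>\<tau>. mat_exp ((- \<tau>) \<cdot>\<^sub>m W) *\<^sub>v g \<tau>)"
    unfolding vec_integral_def
    by (rule arg_cong[of _ _ "Matrix.vec (dim_row W)"], rule ext, rule integral_cong) (simp add: assms)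
  then show ?thesis by (simp add: slow_state_def)
qed

lemma unique_output_cong:
  assumes "unique_output c X y" "\<And>t. t \<ge> 0 \<Longrightarrow> y t = y' t"
  shows "unique_output c X y'"
  using assms unfolding unique_output_def by auto

lemma delayed_forcing_transformed:
  fixes u :: "real \<Rightarrow> real"
  assumes Q: "Q \<in> carrier_mat n n" and b: "b \<in> carrier_vec n" and d: "d \<in> carrier_vec n" and v: "v t \<in> carrier_vec n"
    and Qb: "Q *\<^sub>v b = \<alpha>1 @\<^sub>v \<alpha>2" and Qd: "Q *\<^sub>v d = \<beta>1 @\<^sub>v \<beta>2" and Qv: "Q *\<^sub>v v t = \<eta>1 t @\<^sub>v \<eta>2 t"
    and c1: "\<alpha>1 \<in> carrier_vec n1" "\<beta>1 \<in> carrier_vec n1" "\<eta>1 t \<in> carrier_vec n1"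
    and c2: "\<alpha>2 \<in> carrier_vec n2" "\<beta>2 \<in> carrier_vec n2" "\<eta>2 t \<in> carrier_vec n2"
  shows "Q *\<^sub>v delayed_forcing h b d u v t
    = (u t \<cdot>\<^sub>v \<alpha>1 + u (t - h) \<cdot>\<^sub>v \<beta>1 + \<eta>1 t) @\<^sub>v (u t \<cdot>\<^sub>v \<alpha>2 + u (t - h) \<cdot>\<^sub>v \<beta>2 + \<eta>2 t)"
proof -
  have "Q *\<^sub>v delayed_forcing h b d u v t = u t \<cdot>\<^sub>v (\<alpha>1 @\<^sub>v \<alpha>2) + u (t - h) \<cdot>\<^sub>v (\<beta>1 @\<^sub>v \<beta>2) + (\<eta>1 t @\<^sub>v \<eta>2 t)"
  proof -
    have ub: "u t \<cdot>\<^sub>v b \<in> carrier_vec n" and ud: "u (t - h) \<cdot>\<^sub>v d \<in> carrier_vec n" using b d by simp_all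
    show ?thesis
      unfolding delayed_forcing_def mult_add_distrib_mat_vec[OF Q add_carrier_vec[OF ub ud] v]
        mult_add_distrib_mat_vec[OF Q ub ud] mult_mat_vec[OF Q b] mult_mat_vec[OF Q d] Qb Qd Qv ..
  qed
  also have "\<dots> = (u t \<cdot>\<^sub>v \<alpha>1 + u (t - h) \<cdot>\<^sub>v \<beta>1 + \<eta>1 t) @\<^sub>v (u t \<cdot>\<^sub>v \<alpha>2 + u (t - h) \<cdot>\<^sub>v \<beta>2 + \<eta>2 t)"
    using c1 c2 by (intro eq_vecI) (auto simp: carrier_vecD)
  finally show ?thesis .
qed

lemma delayed_forcing_integrable:
  assumes "h \<ge> 0" and u: "loc_integrable_from (- h) u" and \<eta>: "vec_loc_integrable_from m 0 \<eta>"
    and carrier: "\<alpha> \<in> carrier_vec m" "\<beta> \<in> carrier_vec m" "\<And>t. t \<ge> 0 \<Longrightarrow> \<eta> t \<in> carrier_vec m"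
  shows "vec_loc_integrable_from m 0 (\<lambda>t. u t \<cdot>\<^sub>v \<alpha> + u (t - h) \<cdot>\<^sub>v \<beta> + \<eta> t)"
  unfolding vec_loc_integrable_from_def loc_integrable_from_def
proof (intro allI impI)
  fix j and T :: real assume j: "j < m" and T: "T \<ge> 0"
  have u': "u absolutely_integrable_on {- h..T}" if "T \<ge> - h" for T
    using u that by (auto simp: loc_integrable_from_def)
  have 1: "u absolutely_integrable_on {0..T}"
    using \<open>h \<ge> 0\<close> T by (intro absolutely_integrable_on_subinterval[OF u'[of T]]) auto
  have 2: "(\<lambda>t. u (t - h)) absolutely_integrable_on {0..T}"
    using u'[of "T - h"] T by (intro absolutely_integrable_shift) simp
  have 3: "(\<lambda>t. vec_index (\<eta> t) j) absolutely_integrable_on {0..T}"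
    using \<eta> j T by (auto simp: vec_loc_integrable_from_def loc_integrable_from_def)
  have "(\<lambda>t. vec_index \<alpha> j * u t + vec_index \<beta> j * u (t - h) + vec_index (\<eta> t) j) absolutely_integrable_on {0..T}"
    by (intro set_integral_add absolutely_integrable_continuous_mult continuous_on_const 1 2 3)
  moreover have "vec_index (u t \<cdot>\<^sub>v \<alpha> + u (t - h) \<cdot>\<^sub>v \<beta> + \<eta> t) j
      = vec_index \<alpha> j * u t + vec_index \<beta> j * u (t - h) + vec_index (\<eta> t) j" if "t \<in> {0..T}" for t
    using carrier(1,2) carrier(3)[of t] that j by simp
  ultimately show "(\<lambda>t. vec_index (u t \<cdot>\<^sub>v \<alpha> + u (t - h) \<cdot>\<^sub>v \<beta> + \<eta> t) j) absolutely_integrable_on {0..T}"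
    by (subst set_integrable_cong[OF refl refl]) auto
qed

text \<open>
  The \<open>i\<close>-th derivative of the fast component of the forcing. In the delayed term the derivative is
  taken on \<open>{-h..}\<close> before shifting, so it is one-sided at \<open>t = 0\<close> and two-sided for \<open>t > 0\<close>.
\<close>

definition delayed_forcing_deriv ::
  "nat \<Rightarrow> real \<Rightarrow> real Matrix.vec \<Rightarrow> real Matrix.vec \<Rightarrow> (real \<Rightarrow> real) \<Rightarrow> (real \<Rightarrow> real Matrix.vec) \<Rightarrow>
   real \<Rightarrow> nat \<Rightarrow> real Matrix.vec" where
  "delayed_forcing_deriv m h \<alpha> \<beta> u \<eta> t i =
     deriv_on {-h..} i u t \<cdot>\<^sub>v \<alpha> + deriv_on {-h..} i u (t - h) \<cdot>\<^sub>v \<beta> + vec_deriv_on m {-h..} i \<eta> t"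

context
  fixes m :: nat and h :: real and \<alpha> \<beta> :: "real Matrix.vec" and u :: "real \<Rightarrow> real"
    and \<eta> :: "real \<Rightarrow> real Matrix.vec" and q :: int
  assumes carrier: "\<alpha> \<in> carrier_vec m" "\<beta> \<in> carrier_vec m"
    and h: "h \<ge> 0" and u: "C_on q {-h..} u" and \<eta>: "vec_C_on m q {-h..} \<eta>"
begin

lemma delayed_forcing_deriv_carrier: "delayed_forcing_deriv m h \<alpha> \<beta> u \<eta> t i \<in> carrier_vec m"
  using carrier by (simp add: delayed_forcing_deriv_def vec_deriv_on_def)

lemma delayed_forcing_deriv_index:
  assumes "j < m"
  shows "vec_index (delayed_forcing_deriv m h \<alpha> \<beta> u \<eta> t i) j =
    deriv_on {-h..} i u t * vec_index \<alpha> j + deriv_on {-h..} i u (t - h) * vec_index \<beta> j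
    + deriv_on {-h..} i (\<lambda>s. vec_index (\<eta> s) j) t"
  using carrier assms by (simp add: delayed_forcing_deriv_def vec_deriv_on_def)

lemma delayed_forcing_deriv_0:
  assumes "t \<ge> 0"
  shows "delayed_forcing_deriv m h \<alpha> \<beta> u \<eta> t 0 = u t \<cdot>\<^sub>v \<alpha> + u (t - h) \<cdot>\<^sub>v \<beta> + \<eta> t"
proof -
  have "\<eta> t \<in> carrier_vec m" using \<eta> h assms by (simp add: vec_C_on_def)
  then have "vec_deriv_on m {-h..} 0 \<eta> t = \<eta> t" by (intro eq_vecI) (auto simp: vec_deriv_on_def)
  then show ?thesis by (simp add: delayed_forcing_deriv_def)
qed

lemma delayed_forcing_deriv_has_derivative:
  assumes i: "int i < q" and j: "j < m" and t: "t \<ge> 0"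
  shows "((\<lambda>t. vec_index (delayed_forcing_deriv m h \<alpha> \<beta> u \<eta> t i) j) has_real_derivative
    vec_index (delayed_forcing_deriv m h \<alpha> \<beta> u \<eta> t (Suc i)) j) (at t within {0..})"
proof -
  have "C_on q {-h..} (\<lambda>s. vec_index (\<eta> s) j)" using \<eta> j by (simp add: vec_C_on_def)
  from C_on_has_derivative[OF this i, of t] t h
  have D\<eta>: "(deriv_on {-h..} i (\<lambda>s. vec_index (\<eta> s) j) has_real_derivative
      deriv_on {-h..} (Suc i) (\<lambda>s. vec_index (\<eta> s) j) t) (at t within {0..})"
    by (auto intro: DERIV_subset simp del: deriv_on.simps)
  from C_on_has_derivative[OF u i, of t] t h
  have Du: "(deriv_on {-h..} i u has_real_derivative deriv_on {-h..} (Suc i) u t) (at t within {0..})"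
    by (auto intro: DERIV_subset simp del: deriv_on.simps)
  have "(deriv_on {-h..} i u has_real_derivative deriv_on {-h..} (Suc i) u (t - h))
      (at (t - h) within (\<lambda>s. s - h) ` {0..})"
    using C_on_has_derivative[OF u i, of "t - h"] t by (rule_tac DERIV_subset) auto
  moreover have "((\<lambda>s. s - h) has_real_derivative 1) (at t within {0..})"
    by (auto intro!: derivative_eq_intros)
  ultimately have Du_shift: "((\<lambda>s. deriv_on {-h..} i u (s - h)) has_real_derivative
      deriv_on {-h..} (Suc i) u (t - h)) (at t within {0..})"
    by (auto dest: DERIV_image_chain simp: o_def simp del: deriv_on.simps)
  show ?thesis
    unfolding delayed_forcing_deriv_index[OF j]
    by (intro DERIV_add DERIV_cmult_right Du Du_shift D\<eta>)
qed

lemma delayed_forcing_deriv_continuous: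
  assumes i: "int i \<le> q" and j: "j < m"
  shows "continuous_on {0..} (\<lambda>t. vec_index (delayed_forcing_deriv m h \<alpha> \<beta> u \<eta> t i) j)"
proof -
  have cu: "continuous_on {-h..} (deriv_on {-h..} i u)" by (rule C_on_continuous[OF u i])
  have c\<eta>: "continuous_on {-h..} (deriv_on {-h..} i (\<lambda>s. vec_index (\<eta> s) j))"
    using C_on_continuous[OF _ i] \<eta> j by (simp add: vec_C_on_def)
  have "continuous_on {0..} (\<lambda>t. deriv_on {-h..} i u (t - h))"
    by (rule continuous_on_compose2[OF cu]) (auto intro!: continuous_intros)
  moreover have "continuous_on {0..} (deriv_on {-h..} i u)"
    "continuous_on {0..} (deriv_on {-h..} i (\<lambda>s. vec_index (\<eta> s) j))"
    using cu c\<eta> h by (auto intro: continuous_on_subset)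
  ultimately show ?thesis
    unfolding delayed_forcing_deriv_index[OF j] by (intro continuous_intros)
qed

lemma fast_state_continuous:
  assumes N: "N \<in> carrier_mat m m" and "int l - 1 \<le> q"
  shows "vec_continuous_on m {0..} (\<lambda>t. - nilpotent_sum N l (delayed_forcing_deriv m h \<alpha> \<beta> u \<eta> t))"
  unfolding vec_continuous_on_def
proof (intro allI impI)
  fix j assume j: "j < m"
  let ?G = "delayed_forcing_deriv m h \<alpha> \<beta> u \<eta>"
  have G: "\<forall>i<l. ?G t i \<in> carrier_vec m" for t using delayed_forcing_deriv_carrier by blast
  have pow: "N ^\<^sub>m i \<in> carrier_mat m m" for i using N by simp
  have "continuous_on {0..} (\<lambda>t. - (\<Sum>i<l. \<Sum>k<m. index_mat (N ^\<^sub>m i) (j, k) * vec_index (?G t i) k))"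
    using \<open>int l - 1 \<le> q\<close> by (intro continuous_intros delayed_forcing_deriv_continuous) auto
  moreover have "- (\<Sum>i<l. \<Sum>k<m. index_mat (N ^\<^sub>m i) (j, k) * vec_index (?G t i) k)
      = vec_index (- nilpotent_sum N l (?G t)) j" for t
    using nilpotent_sum_index[OF N G j] carrier_vecD[OF nilpotent_sum_carrier[OF N G]] j
      index_mult_mat_vec_sum[OF pow delayed_forcing_deriv_carrier j]
    by (simp del: index_mult_mat_vec)
  ultimately show "continuous_on {0..} (\<lambda>t. vec_index (- nilpotent_sum N l (?G t)) j)" by simp
qed

lemma delayed_fast_state_solution:
  assumes N: "N \<in> carrier_mat m m" and nil: "N ^\<^sub>m l = 0\<^sub>m m m" and "int l - 1 \<le> q"
    and z0: "N *\<^sub>v z0 = N *\<^sub>v (- nilpotent_sum N l (delayed_forcing_deriv m h \<alpha> \<beta> u \<eta> 0))"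
  shows "dae_solution m N (1\<^sub>m m) (\<lambda>t. u t \<cdot>\<^sub>v \<alpha> + u (t - h) \<cdot>\<^sub>v \<beta> + \<eta> t) z0
    (\<lambda>t. - nilpotent_sum N l (delayed_forcing_deriv m h \<alpha> \<beta> u \<eta> t))"
proof (rule fast_state_solution[where G = "delayed_forcing_deriv m h \<alpha> \<beta> u \<eta>", OF N nil])
  show "\<forall>t\<ge>0. u t \<cdot>\<^sub>v \<alpha> + u (t - h) \<cdot>\<^sub>v \<beta> + \<eta> t \<in> carrier_vec m"
    using carrier \<eta> h by (auto simp: vec_C_on_def)
  show "N *\<^sub>v z0 = N *\<^sub>v (- nilpotent_sum N l (delayed_forcing_deriv m h \<alpha> \<beta> u \<eta> 0))" by (rule z0)
qed (use \<open>int l - 1 \<le> q\<close> delayed_forcing_deriv_carrier delayed_forcing_deriv_0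
    delayed_forcing_deriv_has_derivative in auto)

end

lemma vec_deriv_on_eq_extension:
  assumes f: "vec_C_on m q {a..} f" and g: "vec_C_on m q {a..b} g" and eq: "\<forall>t\<in>{a..<b}. f t = g t"
    and "a < b" "int i \<le> q" "t \<in> {a..b}"
  shows "vec_deriv_on m {a..} i f t = vec_deriv_on m {a..b} i g t"
proof (rule eq_vecI)
  fix j assume "j < dim_vec (vec_deriv_on m {a..b} i g t)"
  then have j: "j < m" by (simp add: vec_deriv_on_def)
  then have "deriv_on {a..} i (\<lambda>s. vec_index (f s) j) t = deriv_on {a..b} i (\<lambda>s. vec_index (g s) j) t"
    using f g eq by (intro deriv_on_eq_extension[where q = q] assms) (auto simp: vec_C_on_def)
  then show "vec_index (vec_deriv_on m {a..} i f t) j = vec_index (vec_deriv_on m {a..b} i g t) j"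
    using j by (simp add: vec_deriv_on_def)
qed (simp add: vec_deriv_on_def)

text \<open>
  Without a fast block \<open>Q * E * P\<close> is the identity, so \<open>E\<close> is nonsingular and \<open>s = 0\<close> is a witness.
\<close>

lemma solvable_pencil_without_fast_block:
  assumes E: "E \<in> carrier_mat n n" and A: "A \<in> carrier_mat n n"
    and form: "weierstrass_form n n1 0 l E A P Q W N"
  shows "solvable_pencil E A"
proof -
  note D = weierstrass_formD[OF form]
  have "N = 1\<^sub>m 0" using D(7) by (intro eq_matI) auto
  then have "Q * E * P = 1\<^sub>m n" using D(1,8) four_block_one_mat[of n1 0] by simp
  then have "Determinant.det Q * Determinant.det E * Determinant.det P = 1"
    using Determinant.det_mult[OF mult_carrier_mat[OF D(4) E] D(2)] Determinant.det_mult[OF D(4) E] by simp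
  then have "Determinant.det E \<noteq> 0" by auto
  then have "Determinant.det (map_mat complex_of_real E) \<noteq> 0" by (simp add: of_real_hom.hom_det)
  moreover have "map_mat complex_of_real E - 0 \<cdot>\<^sub>m map_mat complex_of_real A = map_mat complex_of_real E"
    using E A by (intro eq_matI) auto
  ultimately show ?thesis unfolding solvable_pencil_def by (intro exI[of _ 0]) simp
qed

section \<open>The output trajectory\<close>

text \<open>
  The three parts are instances of the decoupled output formula. In the first, the fast solution is the Neumann series
  and the trajectories are continuous. In the other two, \<open>N = 0\<close> and the fast
  solution is the negative of the fast forcing. For a class with the initial condition
  \<open>x 0 = x0\<close> the fast solution has to start at the fast component of \<open>z0\<close>: admissibility of the data says so,
  and for \<open>l = 0\<close> there is no such component.
\<close>

theorem theorem2:
  fixes n n1 n2 l :: nat and h :: real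
    and E A P Q W N P11 P12 P21 P22 Q11 Q12 Q21 Q22 :: "real Matrix.mat"
    and b d c b1 b2 d1 d2 c1 c2 x0 z0 z10 \<alpha>1 \<alpha>2 \<beta>1 \<beta>2 \<gamma>1 \<gamma>2 :: "real Matrix.vec"
    and u \<Psi> :: "real \<Rightarrow> real"
    and v0 v01 v02 \<eta>1 \<eta>2 \<Psi>v :: "real \<Rightarrow> real Matrix.vec"
  assumes h: "h > 0"
    and E: "E \<in> carrier_mat n n" and A: "A \<in> carrier_mat n n"
    and solvable: "l \<noteq> 0 \<longrightarrow> solvable_pencil E A"
    and form: "weierstrass_form n n1 n2 l E A P Q W N"
    and P_blocks: "split_block P n1 n1 = (P11, P12, P21, P22)"
    and Q_blocks: "split_block Q n1 n1 = (Q11, Q12, Q21, Q22)"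
    and b: "b = b1 @\<^sub>v b2" "b1 \<in> carrier_vec n1" "b2 \<in> carrier_vec n2"
    and d: "d = d1 @\<^sub>v d2" "d1 \<in> carrier_vec n1" "d2 \<in> carrier_vec n2"
    and c: "c = c1 @\<^sub>v c2" "c1 \<in> carrier_vec n1" "c2 \<in> carrier_vec n2"
    and v0: "\<forall>t\<ge>-h. v0 t = v01 t @\<^sub>v v02 t \<and> v01 t \<in> carrier_vec n1 \<and> v02 t \<in> carrier_vec n2"
    and \<alpha>: "\<alpha>1 = Q11 *\<^sub>v b1 + Q12 *\<^sub>v b2" "\<alpha>2 = Q21 *\<^sub>v b1 + Q22 *\<^sub>v b2"
    and \<beta>: "\<beta>1 = Q11 *\<^sub>v d1 + Q12 *\<^sub>v d2" "\<beta>2 = Q21 *\<^sub>v d1 + Q22 *\<^sub>v d2"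
    and \<gamma>: "\<gamma>1 = transpose_mat P11 *\<^sub>v c1 + transpose_mat P21 *\<^sub>v c2"
           "\<gamma>2 = transpose_mat P12 *\<^sub>v c1 + transpose_mat P22 *\<^sub>v c2"
    and \<eta>: "\<forall>t\<ge>-h. \<eta>1 t = Q11 *\<^sub>v v01 t + Q12 *\<^sub>v v02 t"
           "\<forall>t\<ge>-h. \<eta>2 t = Q21 *\<^sub>v v01 t + Q22 *\<^sub>v v02 t"
    and z0: "z0 \<in> carrier_vec n" "x0 = P *\<^sub>v z0" "z10 = vec_first z0 n1"
    and u_initial: "\<forall>t\<in>{-h..0}. u t = \<Psi> t"
    and \<eta>2_initial: "\<forall>t\<in>{-h..<0}. \<eta>2 t = \<Psi>v t"
    and \<Psi>v_dim: "\<forall>t\<in>{-h..0}. \<Psi>v t \<in> carrier_vec n2"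
    and integrable: "loc_integrable_from (-h) u" "vec_loc_integrable_from n1 0 \<eta>1"
  shows
    "(C_on (int l - 1) ({0..} \<union> {-h..<0}) u \<and> vec_C_on n2 (int l - 1) ({0..} \<union> {-h..<0}) \<eta>2 \<and>
      C_on (int l - 1) {-h..0} \<Psi> \<and> vec_C_on n2 (int l - 1) {-h..0} \<Psi>v \<longrightarrow>
      (let X = (\<lambda>x. dae_solution n E A (delayed_forcing h b d u v0) x0 x \<and> vec_continuous_on n {0..} x);
           y = (\<lambda>t. if t > h then
               scalar_prod \<gamma>1 (slow_state W z10 (\<lambda>\<tau>. u \<tau> \<cdot>\<^sub>v \<alpha>1 + u (\<tau> - h) \<cdot>\<^sub>v \<beta>1 + \<eta>1 \<tau>) t)
               - scalar_prod \<gamma>2 (nilpotent_sum N l (\<lambda>i. deriv_on {-h..} i u t \<cdot>\<^sub>v \<alpha>2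
                   + deriv_on {-h..} i u (t - h) \<cdot>\<^sub>v \<beta>2 + vec_deriv_on n2 {-h..} i \<eta>2 t))
             else
               scalar_prod \<gamma>1 (slow_state W z10 (\<lambda>\<tau>. u \<tau> \<cdot>\<^sub>v \<alpha>1 + \<Psi> (\<tau> - h) \<cdot>\<^sub>v \<beta>1 + \<eta>1 \<tau>) t)
               - scalar_prod \<gamma>2 (nilpotent_sum N l (\<lambda>i. deriv_on {-h..} i u t \<cdot>\<^sub>v \<alpha>2
                   + deriv_on {-h..0} i \<Psi> (t - h) \<cdot>\<^sub>v \<beta>2 + vec_deriv_on n2 {-h..} i \<eta>2 t)))
       in (l = 0 \<or> l = 1 \<or> (z0, \<Psi>, \<Psi>v) \<in> admissible_data n1 h l N \<alpha>2 \<beta>2 u \<Psi> \<longrightarrow>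
             unique_output c X y) \<and>
          ((z0, \<Psi>, \<Psi>v) \<in> admissible_data n1 h l N \<alpha>2 \<beta>2 u \<Psi> \<longrightarrow>
             unique_output c (\<lambda>x. X x \<and> x 0 = x0) y)))
   \<and> (l = 1 \<longrightarrow>
      (let X = dae_solution n E A (delayed_forcing h b d u v0) x0;
           y = (\<lambda>t. if t > h then
               scalar_prod \<gamma>1 (slow_state W z10 (\<lambda>\<tau>. u \<tau> \<cdot>\<^sub>v \<alpha>1 + u (\<tau> - h) \<cdot>\<^sub>v \<beta>1 + \<eta>1 \<tau>) t)
               - scalar_prod \<gamma>2 (u t \<cdot>\<^sub>v \<alpha>2 + u (t - h) \<cdot>\<^sub>v \<beta>2 + \<eta>2 t)
             else
               scalar_prod \<gamma>1 (slow_state W z10 (\<lambda>\<tau>. u \<tau> \<cdot>\<^sub>v \<alpha>1 + \<Psi> (\<tau> - h) \<cdot>\<^sub>v \<beta>1 + \<eta>1 \<tau>) t)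
               - scalar_prod \<gamma>2 (u t \<cdot>\<^sub>v \<alpha>2 + \<Psi> (t - h) \<cdot>\<^sub>v \<beta>2 + \<eta>2 t))
       in N = 0\<^sub>m n2 n2 \<and>
          unique_output c X y \<and>
          (z0 \<in> admissible_states n1 h l N \<alpha>2 \<beta>2 u \<Psi> \<Psi>v \<and> \<eta>2 0 = \<Psi>v 0 \<longrightarrow>
             unique_output c (\<lambda>x. X x \<and> x 0 = x0) y)))
   \<and> (l = 0 \<longrightarrow>
      solvable_pencil E A \<and>
      unique_output c (\<lambda>x. dae_solution n E A (delayed_forcing h b d u v0) x0 x \<and> x 0 = x0)
        (\<lambda>t. if t > h then
            scalar_prod \<gamma>1 (slow_state W z10 (\<lambda>\<tau>. u \<tau> \<cdot>\<^sub>v \<alpha>1 + u (\<tau> - h) \<cdot>\<^sub>v \<beta>1 + \<eta>1 \<tau>) t)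
          else
            scalar_prod \<gamma>1 (slow_state W z10 (\<lambda>\<tau>. u \<tau> \<cdot>\<^sub>v \<alpha>1 + \<Psi> (\<tau> - h) \<cdot>\<^sub>v \<beta>1 + \<eta>1 \<tau>) t)))"
proof -
  note D = weierstrass_formD[OF form]
  note P = D(2) and Q = D(4) and W = D(6) and N = D(7) and nil = D(10)
  note QB = split_block[OF Q_blocks, of n2 n2]
  have Q11: "Q11 \<in> carrier_mat n1 n1" and Q12: "Q12 \<in> carrier_mat n1 n2" and Q21: "Q21 \<in> carrier_mat n2 n1"
    and Q22: "Q22 \<in> carrier_mat n2 n2" and Q_eq: "Q = four_block_mat Q11 Q12 Q21 Q22"
    using QB Q D(1) by auto
  have Qv: "Q *\<^sub>v (v @\<^sub>v w) = (Q11 *\<^sub>v v + Q12 *\<^sub>v w) @\<^sub>v (Q21 *\<^sub>v v + Q22 *\<^sub>v w)"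
    and Qv1: "Q11 *\<^sub>v v + Q12 *\<^sub>v w \<in> carrier_vec n1" and Qv2: "Q21 *\<^sub>v v + Q22 *\<^sub>v w \<in> carrier_vec n2"
    if "v \<in> carrier_vec n1" "w \<in> carrier_vec n2" for v w
  proof -
    show "Q *\<^sub>v (v @\<^sub>v w) = (Q11 *\<^sub>v v + Q12 *\<^sub>v w) @\<^sub>v (Q21 *\<^sub>v v + Q22 *\<^sub>v w)"
      unfolding Q_eq by (rule four_block_mat_mult_vec[OF Q11 Q12 Q21 Q22 that])
    show "Q11 *\<^sub>v v + Q12 *\<^sub>v w \<in> carrier_vec n1" "Q21 *\<^sub>v v + Q22 *\<^sub>v w \<in> carrier_vec n2"
      using Q12 Q22 by (auto intro!: carrier_vecI)
  qed
  have \<alpha>1: "\<alpha>1 \<in> carrier_vec n1" and \<alpha>2: "\<alpha>2 \<in> carrier_vec n2"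
    unfolding \<alpha> using Qv1[OF b(2,3)] Qv2[OF b(2,3)] .
  have \<beta>1: "\<beta>1 \<in> carrier_vec n1" and \<beta>2: "\<beta>2 \<in> carrier_vec n2"
    unfolding \<beta> using Qv1[OF d(2,3)] Qv2[OF d(2,3)] .
  have \<eta>1: "\<eta>1 t \<in> carrier_vec n1" and \<eta>2: "\<eta>2 t \<in> carrier_vec n2" if "t \<ge> - h" for t
    using \<eta> v0 that Qv1[of "v01 t" "v02 t"] Qv2[of "v01 t" "v02 t"] by auto
  have \<gamma>1: "\<gamma>1 \<in> carrier_vec n1" and \<gamma>2: "\<gamma>2 \<in> carrier_vec n2"
    using split_block[OF P_blocks, of n2 n2] P D(1) unfolding \<gamma> by (auto intro!: carrier_vecI)

  define g where "g = delayed_forcing h b d u v0"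
  define f1 where "f1 = (\<lambda>t. u t \<cdot>\<^sub>v \<alpha>1 + u (t - h) \<cdot>\<^sub>v \<beta>1 + \<eta>1 t)"
  define f2 where "f2 = (\<lambda>t. u t \<cdot>\<^sub>v \<alpha>2 + u (t - h) \<cdot>\<^sub>v \<beta>2 + \<eta>2 t)"
  define z20 where "z20 = vec_last z0 n2"
  have z10: "z10 \<in> carrier_vec n1" and z20: "z20 \<in> carrier_vec n2" by (simp_all add: z0(3) z20_def)
  have z0_split: "z0 = z10 @\<^sub>v z20" using z0(1) D(1) by (simp add: z0(3) z20_def)
  have x0: "x0 = P *\<^sub>v (z10 @\<^sub>v z20)" using z0(2) z0_split by simp
  have bn: "b \<in> carrier_vec n" and dn: "d \<in> carrier_vec n" using b d D(1) by auto
  have vn: "v0 t \<in> carrier_vec n" if "t \<ge> - h" for t using v0 that D(1) by auto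
  have g: "\<forall>t\<ge>0. g t \<in> carrier_vec n"
    unfolding g_def delayed_forcing_def using bn dn vn h by auto
  have f1_carrier: "f1 t \<in> carrier_vec n1" and f2_carrier: "f2 t \<in> carrier_vec n2" if "t \<ge> 0" for t
    using \<alpha>1 \<beta>1 \<eta>1[of t] \<alpha>2 \<beta>2 \<eta>2[of t] that h by (auto simp: f1_def f2_def)
  have f: "\<forall>t\<ge>0. Q *\<^sub>v g t = f1 t @\<^sub>v f2 t \<and> f1 t \<in> carrier_vec n1 \<and> f2 t \<in> carrier_vec n2"
  proof (intro allI impI conjI f1_carrier f2_carrier)
    fix t :: real assume "t \<ge> 0"
    then have t: "t \<ge> - h" using h by simp
    have Qb: "Q *\<^sub>v b = \<alpha>1 @\<^sub>v \<alpha>2" unfolding \<alpha> b(1) by (rule Qv[OF b(2,3)])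
    have Qd: "Q *\<^sub>v d = \<beta>1 @\<^sub>v \<beta>2" unfolding \<beta> d(1) by (rule Qv[OF d(2,3)])
    have Qv0: "Q *\<^sub>v v0 t = \<eta>1 t @\<^sub>v \<eta>2 t" using Qv v0 \<eta> t by simp
    show "Q *\<^sub>v g t = f1 t @\<^sub>v f2 t"
      unfolding g_def f1_def f2_def
      by (rule delayed_forcing_transformed[where v = v0 and t = t and ?\<eta>1.0 = \<eta>1 and ?\<eta>2.0 = \<eta>2,
            OF Q bn dn vn[OF t] Qb Qd Qv0 \<alpha>1 \<beta>1 \<eta>1[OF t] \<alpha>2 \<beta>2 \<eta>2[OF t]])
  qed
  have f1_int: "vec_loc_integrable_from n1 0 f1"
    unfolding f1_def by (rule delayed_forcing_integrable[OF _ integrable \<alpha>1 \<beta>1 \<eta>1]) (use h in auto)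
  note decoupled = unique_output_decoupled[OF E A form P_blocks c(2,3) g f f1_int z10 z20,
      folded \<gamma> x0 c(1)]

  have slow_\<Psi>: "slow_state W z10 (\<lambda>\<tau>. u \<tau> \<cdot>\<^sub>v \<alpha>1 + \<Psi> (\<tau> - h) \<cdot>\<^sub>v \<beta>1 + \<eta>1 \<tau>) t = slow_state W z10 f1 t"
    if "t \<le> h" for t
    unfolding f1_def by (rule slow_state_cong) (use u_initial that in auto)

  show ?thesis
  proof (intro conjI impI)
    assume reg: "C_on (int l - 1) ({0..} \<union> {-h..<0}) u \<and> vec_C_on n2 (int l - 1) ({0..} \<union> {-h..<0}) \<eta>2 \<and>
      C_on (int l - 1) {-h..0} \<Psi> \<and> vec_C_on n2 (int l - 1) {-h..0} \<Psi>v"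
    have "{0..} \<union> {-h..<0} = {-h..}" using h by auto
    then have u_reg: "C_on (int l - 1) {-h..} u" and \<eta>2_reg: "vec_C_on n2 (int l - 1) {-h..} \<eta>2"
      and \<Psi>_reg: "C_on (int l - 1) {-h..0} \<Psi>" and \<Psi>v_reg: "vec_C_on n2 (int l - 1) {-h..0} \<Psi>v"
      using reg by auto
    let ?X = "\<lambda>x. dae_solution n E A (delayed_forcing h b d u v0) x0 x \<and> vec_continuous_on n {0..} x"
    let ?y = "\<lambda>t. if t > h then
               scalar_prod \<gamma>1 (slow_state W z10 (\<lambda>\<tau>. u \<tau> \<cdot>\<^sub>v \<alpha>1 + u (\<tau> - h) \<cdot>\<^sub>v \<beta>1 + \<eta>1 \<tau>) t)
               - scalar_prod \<gamma>2 (nilpotent_sum N l (\<lambda>i. deriv_on {-h..} i u t \<cdot>\<^sub>v \<alpha>2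
                   + deriv_on {-h..} i u (t - h) \<cdot>\<^sub>v \<beta>2 + vec_deriv_on n2 {-h..} i \<eta>2 t))
             else
               scalar_prod \<gamma>1 (slow_state W z10 (\<lambda>\<tau>. u \<tau> \<cdot>\<^sub>v \<alpha>1 + \<Psi> (\<tau> - h) \<cdot>\<^sub>v \<beta>1 + \<eta>1 \<tau>) t)
               - scalar_prod \<gamma>2 (nilpotent_sum N l (\<lambda>i. deriv_on {-h..} i u t \<cdot>\<^sub>v \<alpha>2
                   + deriv_on {-h..0} i \<Psi> (t - h) \<cdot>\<^sub>v \<beta>2 + vec_deriv_on n2 {-h..} i \<eta>2 t))"
    define G where "G = delayed_forcing_deriv n2 h \<alpha>2 \<beta>2 u \<eta>2"
    define \<zeta> where "\<zeta> t = - nilpotent_sum N l (G t)" for t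
    have "h \<ge> 0" using h by simp
    note fast_facts = \<alpha>2 \<beta>2 \<open>h \<ge> 0\<close> u_reg \<eta>2_reg
    have G: "\<forall>i<l. G t i \<in> carrier_vec n2" for t
      unfolding G_def using delayed_forcing_deriv_carrier[OF fast_facts] by blast
    have S: "nilpotent_sum N l (G t) \<in> carrier_vec n2" for t by (rule nilpotent_sum_carrier[OF N G])
    \<comment> \<open>At \<open>0\<close>, one-sided derivatives of the prehistories meet two-sided ones of \<open>u\<close> and \<open>\<eta>2\<close>.\<close>
    have \<Psi>_deriv: "deriv_on {-h..} i u s = deriv_on {-h..0} i \<Psi> s" if "i < l" "s \<in> {-h..0}" for i s
      using u_initial h that by (intro deriv_on_eq_extension[OF u_reg \<Psi>_reg]) auto
    have \<Psi>v_deriv: "vec_deriv_on n2 {-h..} i \<eta>2 0 = vec_deriv_on n2 {-h..0} i \<Psi>v 0" if "i < l" for i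
      using \<eta>2_initial h that by (intro vec_deriv_on_eq_extension[OF \<eta>2_reg \<Psi>v_reg]) auto
    have \<zeta>_cont: "vec_continuous_on n2 {0..} \<zeta>"
      unfolding \<zeta>_def G_def by (rule fast_state_continuous[OF fast_facts N order_refl])
    have adm: "z20 = \<zeta> 0" if data: "(z0, \<Psi>, \<Psi>v) \<in> admissible_data n1 h l N \<alpha>2 \<beta>2 u \<Psi>"
    proof -
      let ?F = "\<lambda>i. deriv_on {-h..} i u 0 \<cdot>\<^sub>v \<alpha>2 + deriv_on {-h..0} i \<Psi> (-h) \<cdot>\<^sub>v \<beta>2
          + vec_deriv_on (dim_row N) {-h..0} i \<Psi>v 0"
      obtain z1 where z1: "z1 \<in> carrier_vec n1" "z0 = z1 @\<^sub>v - nilpotent_sum N l ?F"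
        using data unfolding admissible_data_def admissible_states_def by blast
      have "nilpotent_sum N l (G 0) = nilpotent_sum N l ?F"
        by (rule nilpotent_sum_cong[OF N G])
          (use \<Psi>_deriv \<Psi>v_deriv h N in \<open>simp add: G_def delayed_forcing_deriv_def\<close>)
      moreover have "z20 = - nilpotent_sum N l ?F"
        using z1(2)[unfolded z0_split append_vec_eq[OF z10 z1(1)]] by (rule conjunct2)
      ultimately show ?thesis by (simp add: \<zeta>_def)
    qed
    have y_eq: "scalar_prod \<gamma>1 (slow_state W z10 f1 t) + scalar_prod \<gamma>2 (\<zeta> t) = ?y t" if "t \<ge> 0" for t
    proof -
      have "scalar_prod \<gamma>2 (\<zeta> t) = - scalar_prod \<gamma>2 (nilpotent_sum N l (G t))"
        unfolding \<zeta>_def using \<gamma>2 S[of t] by simp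
      moreover have "nilpotent_sum N l (G t) = nilpotent_sum N l (\<lambda>i. deriv_on {-h..} i u t \<cdot>\<^sub>v \<alpha>2
                   + deriv_on {-h..0} i \<Psi> (t - h) \<cdot>\<^sub>v \<beta>2 + vec_deriv_on n2 {-h..} i \<eta>2 t)" if "t \<le> h"
        by (rule nilpotent_sum_cong[OF N G])
          (use \<Psi>_deriv that \<open>t \<ge> 0\<close> in \<open>simp add: G_def delayed_forcing_deriv_def\<close>)
      moreover have "nilpotent_sum N l (G t) = nilpotent_sum N l (\<lambda>i. deriv_on {-h..} i u t \<cdot>\<^sub>v \<alpha>2
                   + deriv_on {-h..} i u (t - h) \<cdot>\<^sub>v \<beta>2 + vec_deriv_on n2 {-h..} i \<eta>2 t)"
        by (rule nilpotent_sum_cong[OF N G]) (simp add: G_def delayed_forcing_deriv_def)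
      ultimately show ?thesis using slow_\<Psi>[of t] by (simp add: f1_def)
    qed
    have fast: "dae_solution n2 N (1\<^sub>m n2) f2 z20 \<zeta>" if "N *\<^sub>v z20 = N *\<^sub>v \<zeta> 0"
      unfolding f2_def \<zeta>_def G_def
      by (rule delayed_fast_state_solution[OF fast_facts N nil order_refl])
        (use that in \<open>simp add: \<zeta>_def G_def\<close>)
    have free: "unique_output c ?X ?y" if "N *\<^sub>v z20 = N *\<^sub>v \<zeta> 0"
    proof -
      have "unique_output c ?X (\<lambda>t. scalar_prod \<gamma>1 (slow_state W z10 f1 t) + scalar_prod \<gamma>2 (\<zeta> t))"
        by (rule decoupled[OF fast[OF that]]) (use \<zeta>_cont in \<open>auto simp: g_def\<close>)
      then show ?thesis by (rule unique_output_cong) (rule y_eq, assumption)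
    qed
    have initial: "unique_output c (\<lambda>x. ?X x \<and> x 0 = x0) ?y" if "z20 = \<zeta> 0"
    proof -
      have "unique_output c (\<lambda>x. ?X x \<and> x 0 = x0)
          (\<lambda>t. scalar_prod \<gamma>1 (slow_state W z10 f1 t) + scalar_prod \<gamma>2 (\<zeta> t))"
        by (rule decoupled[OF fast]) (use \<zeta>_cont that in \<open>auto simp: g_def\<close>)
      then show ?thesis by (rule unique_output_cong) (rule y_eq, assumption)
    qed
    \<comment> \<open>The integral equation constrains \<open>N *\<^sub>v z20\<close> only, and nothing if \<open>N = 0\<close>.\<close>
    have "N *\<^sub>v z20 = N *\<^sub>v \<zeta> 0" if "l = 0 \<or> l = 1"
    proof -
      have "N = 0\<^sub>m n2 n2" using nilpotency_exponent_le_1[OF N nil] that by auto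
      moreover have "\<zeta> 0 \<in> carrier_vec n2" using S[of 0] by (simp add: \<zeta>_def)
      ultimately show ?thesis using z20 by (simp add: zero_mat_mult_vec)
    qed
    then have "l = 0 \<or> l = 1 \<or> (z0, \<Psi>, \<Psi>v) \<in> admissible_data n1 h l N \<alpha>2 \<beta>2 u \<Psi> \<longrightarrow> unique_output c ?X ?y"
      using free adm by blast
    moreover have "(z0, \<Psi>, \<Psi>v) \<in> admissible_data n1 h l N \<alpha>2 \<beta>2 u \<Psi> \<longrightarrow>
        unique_output c (\<lambda>x. ?X x \<and> x 0 = x0) ?y"
      using initial adm by blast
    ultimately show "let X = ?X; y = ?y in
        (l = 0 \<or> l = 1 \<or> (z0, \<Psi>, \<Psi>v) \<in> admissible_data n1 h l N \<alpha>2 \<beta>2 u \<Psi> \<longrightarrow> unique_output c X y) \<and>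
        ((z0, \<Psi>, \<Psi>v) \<in> admissible_data n1 h l N \<alpha>2 \<beta>2 u \<Psi> \<longrightarrow> unique_output c (\<lambda>x. X x \<and> x 0 = x0) y)"
      unfolding Let_def by (rule conjI)
  next
    assume l: "l = 1"
    then have N0: "N = 0\<^sub>m n2 n2" using nilpotency_exponent_le_1[OF N nil] by simp
    let ?X = "dae_solution n E A (delayed_forcing h b d u v0) x0"
    let ?y = "\<lambda>t. if t > h then
               scalar_prod \<gamma>1 (slow_state W z10 (\<lambda>\<tau>. u \<tau> \<cdot>\<^sub>v \<alpha>1 + u (\<tau> - h) \<cdot>\<^sub>v \<beta>1 + \<eta>1 \<tau>) t)
               - scalar_prod \<gamma>2 (u t \<cdot>\<^sub>v \<alpha>2 + u (t - h) \<cdot>\<^sub>v \<beta>2 + \<eta>2 t)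
             else
               scalar_prod \<gamma>1 (slow_state W z10 (\<lambda>\<tau>. u \<tau> \<cdot>\<^sub>v \<alpha>1 + \<Psi> (\<tau> - h) \<cdot>\<^sub>v \<beta>1 + \<eta>1 \<tau>) t)
               - scalar_prod \<gamma>2 (u t \<cdot>\<^sub>v \<alpha>2 + \<Psi> (t - h) \<cdot>\<^sub>v \<beta>2 + \<eta>2 t)"
    note decoupled_algebraic = decoupled[OF algebraic_state_solution[OF N N0 z20, of f2]]
    have y_eq: "scalar_prod \<gamma>1 (slow_state W z10 f1 t) + scalar_prod \<gamma>2 (- f2 t) = ?y t" if "t \<ge> 0" for t
    proof -
      have "scalar_prod \<gamma>2 (- f2 t) = - scalar_prod \<gamma>2 (f2 t)"
        using \<gamma>2 f2_carrier[OF that] by simp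
      moreover have "f2 t = u t \<cdot>\<^sub>v \<alpha>2 + \<Psi> (t - h) \<cdot>\<^sub>v \<beta>2 + \<eta>2 t" if "t \<le> h"
        using u_initial that \<open>t \<ge> 0\<close> by (simp add: f2_def)
      ultimately show ?thesis using slow_\<Psi>[of t] by (simp add: f1_def f2_def)
    qed
    have "unique_output c ?X (\<lambda>t. scalar_prod \<gamma>1 (slow_state W z10 f1 t) + scalar_prod \<gamma>2 (- f2 t))"
      by (rule decoupled_algebraic) (use N0 f2_carrier in \<open>auto simp: g_def\<close>)
    then have free: "unique_output c ?X ?y" by (rule unique_output_cong) (rule y_eq, assumption)
    have initial: "unique_output c (\<lambda>x. ?X x \<and> x 0 = x0) ?y"
      if adm: "z0 \<in> admissible_states n1 h l N \<alpha>2 \<beta>2 u \<Psi> \<Psi>v" and \<eta>2_0: "\<eta>2 0 = \<Psi>v 0"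
    proof -
      let ?F = "\<lambda>i. deriv_on {-h..} i u 0 \<cdot>\<^sub>v \<alpha>2 + deriv_on {-h..0} i \<Psi> (-h) \<cdot>\<^sub>v \<beta>2
          + vec_deriv_on (dim_row N) {-h..0} i \<Psi>v 0"
      obtain z1 where z1: "z1 \<in> carrier_vec n1" "z0 = z1 @\<^sub>v - nilpotent_sum N 1 ?F"
        using adm l unfolding admissible_states_def by blast
      have "vec_deriv_on (dim_row N) {-h..0} 0 \<Psi>v 0 = \<eta>2 0"
        using \<eta>2_0 \<eta>2[of 0] h N by (intro eq_vecI) (auto simp: vec_deriv_on_def)
      moreover have "\<Psi> (- h) = u (0 - h)" using u_initial h by simp
      ultimately have F0: "?F 0 = f2 0" by (simp add: f2_def)
      have "nilpotent_sum N 1 ?F = f2 0"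
        using nilpotent_sum_one[OF N, of ?F] f2_carrier[of 0] F0 by simp
      then have z20_eq: "- f2 0 = z20"
        using z1(2)[unfolded z0_split append_vec_eq[OF z10 z1(1)]] by simp
      have "unique_output c (\<lambda>x. ?X x \<and> x 0 = x0)
          (\<lambda>t. scalar_prod \<gamma>1 (slow_state W z10 f1 t) + scalar_prod \<gamma>2 (- f2 t))"
        by (rule decoupled_algebraic) (use N0 f2_carrier z20_eq in \<open>auto simp: g_def\<close>)
      then show ?thesis by (rule unique_output_cong) (rule y_eq, assumption)
    qed
    show "let X = ?X; y = ?y in N = 0\<^sub>m n2 n2 \<and> unique_output c X y \<and>
        (z0 \<in> admissible_states n1 h l N \<alpha>2 \<beta>2 u \<Psi> \<Psi>v \<and> \<eta>2 0 = \<Psi>v 0 \<longrightarrow>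
           unique_output c (\<lambda>x. X x \<and> x 0 = x0) y)"
      unfolding Let_def using N0 free initial by blast
  next
    assume l: "l = 0"
    then have n2: "n2 = 0" using nilpotency_exponent_zero[OF N] nil by simp
    show "solvable_pencil E A"
      using solvable_pencil_without_fast_block[OF E A] form n2 by blast
  next
    assume l: "l = 0"
    then have n2: "n2 = 0" using nilpotency_exponent_zero[OF N] nil by simp
    have N0: "N = 0\<^sub>m n2 n2" using nilpotency_exponent_le_1[OF N nil] l by simp
    let ?X = "\<lambda>x. dae_solution n E A (delayed_forcing h b d u v0) x0 x \<and> x 0 = x0"
    let ?y = "\<lambda>t. if t > h then
            scalar_prod \<gamma>1 (slow_state W z10 (\<lambda>\<tau>. u \<tau> \<cdot>\<^sub>v \<alpha>1 + u (\<tau> - h) \<cdot>\<^sub>v \<beta>1 + \<eta>1 \<tau>) t)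
          else
            scalar_prod \<gamma>1 (slow_state W z10 (\<lambda>\<tau>. u \<tau> \<cdot>\<^sub>v \<alpha>1 + \<Psi> (\<tau> - h) \<cdot>\<^sub>v \<beta>1 + \<eta>1 \<tau>) t)"
    have "- f2 0 = z20" using f2_carrier[of 0] z20 n2 by (intro eq_vecI) auto
    then have "unique_output c ?X (\<lambda>t. scalar_prod \<gamma>1 (slow_state W z10 f1 t) + scalar_prod \<gamma>2 (- f2 t))"
      by (intro decoupled[OF algebraic_state_solution[OF N N0 z20, of f2]])
        (use N0 f2_carrier in \<open>auto simp: g_def\<close>)
    moreover have "scalar_prod \<gamma>1 (slow_state W z10 f1 t) + scalar_prod \<gamma>2 (- f2 t) = ?y t" if "t \<ge> 0" for t
    proof -
      have "scalar_prod \<gamma>2 (- f2 t) = 0" using f2_carrier[OF that] n2 by (simp add: scalar_prod_def)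
      then show ?thesis using slow_\<Psi>[of t] by (simp add: f1_def)
    qed
    ultimately show "unique_output c ?X ?y" by (rule unique_output_cong)
  qed
qed

end
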